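(* Let $V$ be an $n$-dimensional vector space over a field of characteristic $\neq 2$, equipped with a nondegenerate symplectic form $\xi$, and let $(\mathfrak P,\perp)$ be the associated symplectic projective space. Let $k$ be an integer with $1\le k\le n-1$ and $k\neq n-k$. Then the symplectic projective geometry $(\mathfrak P,\perp)$ can be defined in terms of the adjacency relation $\sim$ on $\mathcal{TR}_k$; consequently, $(\mathfrak P,\perp)$ can be defined in terms of the geometry of the Grassmann space $\mathbf{P}(\mathcal{TR},k)$. In particular, when $k$ is even, $(\mathfrak P,\perp)$ can be defined in terms of the adjacency $\sim$ on the set of regular $k$-dimensional subspaces of $V$ (which in this case equals $\mathcal{TR}_k$).
   Context: Notation and definitions. $V$ is a finite-dimensional vector space over a field of characteristic $\neq 2$, $\xi$ a nondegenerate symplectic (alternating) bilinear form on $V$, $n=\dim V$ (so $n$ is even). $\mathfrak P$ is the projective space of $V$: points are $1$-dimensional subspaces, lines are $2$-dimensional subspaces, incidence is inclusion; all dimensions are linear dimensions. For subspaces $U_1,U_2$, $U_1\perp U_2$ means $\xi(U_1,U_2)=0$; $U^\perp=\{u\in V:\xi(u,U)=0\}$; $\mathrm{Rad}(U)=U\cap U^\perp$ and $\mathrm{rdim}(U)=\dim\mathrm{Rad}(U)$. A subspace $U$ is regular if $\mathrm{Rad}(U)=0$ (then $\dim U$ is even) and tangential if $\mathrm{rdim}(U)=1$ (then $\dim U$ is odd). Let $\mathcal{TR}=\{U\le V:\mathrm{rdim}(U)\le 1\}$ and $\mathcal{TR}_k$ its members of dimension $k$ (i.e. regular $k$-subspaces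 if $k$ is even, tangential $k$-subspaces if $k$ is odd). For $H\in\mathcal{TR}_{k-1}$, $B\in\mathcal{TR}_{k+1}$ with $H\subset B$, the pencil is $\mathrm{P}(H,B)=\{U\in\mathcal{TR}_k: H\subset U\subset B\}$. The Grassmann space $\mathbf{P}(\mathcal{TR},k)$ is the incidence structure whose points are the elements of $\mathcal{TR}_k$ and whose lines are the nonempty pencils $\mathrm{P}(H,B)$ (such $H,B$). For $U,W\in\mathcal{TR}_k$, $U\sim W$ (adjacency) means $U\neq W$ and $U,W$ are collinear in $\mathbf{P}(\mathcal{TR},k)$, i.e. lie in a common nonempty pencil. "Can be defined in terms of" means the structure is definable (interpretable) from the given one. *)

theory Defs
  imports Complex_Main
begin

section \<open>First-order definability\<close>

text \<open>Relations are sets of tuples, tuples are lists. The arity of a relation symbol is not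
  recorded; a relation is simply false of tuples of the wrong length.\<close>

datatype ('r, 'a) struct = Struct (univ: "'a set") (rels: "'r \<Rightarrow> 'a list set")

datatype 'r formula =
    Equal nat nat
  | Atom 'r "nat list"
  | Neg "'r formula"
  | Conj "'r formula" "'r formula"
  | Exist nat "'r formula"

primrec free_vars :: "'r formula \<Rightarrow> nat set" where
  "free_vars (Equal i j) = {i, j}"
| "free_vars (Atom r is) = set is"
| "free_vars (Neg \<phi>) = free_vars \<phi>"
| "free_vars (Conj \<phi> \<psi>) = free_vars \<phi> \<union> free_vars \<psi>"
| "free_vars (Exist i \<phi>) = free_vars \<phi> - {i}"

primrec sat :: "('r, 'a) struct \<Rightarrow> (nat \<Rightarrow> 'a) \<Rightarrow> 'r formula \<Rightarrow> bool" where
  "sat M e (Equal i j) \<longleftrightarrow> e i = e j"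
| "sat M e (Atom r is) \<longleftrightarrow> map e is \<in> rels M r"
| "sat M e (Neg \<phi>) \<longleftrightarrow> \<not> sat M e \<phi>"
| "sat M e (Conj \<phi> \<psi>) \<longleftrightarrow> sat M e \<phi> \<and> sat M e \<psi>"
| "sat M e (Exist i \<phi>) \<longleftrightarrow> (\<exists>a\<in>univ M. sat M (e(i := a)) \<phi>)"

definition tuples :: "'a set \<Rightarrow> nat \<Rightarrow> 'a list set" where
  "tuples A m = {xs. length xs = m \<and> set xs \<subseteq> A}"

text \<open>Definability without parameters of an \<open>m\<close>-ary relation. The restriction on the free
  variables makes the value of \<open>nth\<close> outside the list irrelevant.\<close>

definition definable :: "('r, 'a) struct \<Rightarrow> nat \<Rightarrow> 'a list set \<Rightarrow> bool" where
  "definable M m X \<longleftrightarrow>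
     (\<exists>\<phi>. free_vars \<phi> \<subseteq> {..<m} \<and> X = {xs \<in> tuples (univ M) m. sat M (nth xs) \<phi>})"

text \<open>\<open>N\<close> is interpreted in \<open>M\<close> with coordinate map \<open>f\<close>, defined on a set \<open>D\<close> of \<open>m\<close>-tuples of
  elements of \<open>M\<close>: the domain, the kernel and the preimages of all relations of \<open>N\<close> are definable
  in \<open>M\<close>.\<close>

definition interprets ::
  "('r, 'a) struct \<Rightarrow> ('s, 'b) struct \<Rightarrow> nat \<Rightarrow> 'a list set \<Rightarrow> ('a list \<Rightarrow> 'b) \<Rightarrow> bool" where
  "interprets M N m D f \<longleftrightarrow>
     D \<subseteq> tuples (univ M) m \<and> f ` D = univ N \<and>
     definable M m D \<and>
     definable M (2 * m) {xs @ ys | xs ys. xs \<in> D \<and> ys \<in> D \<and> f xs = f ys} \<and>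
     (\<forall>s j. definable M (j * m)
        {concat xss | xss. xss \<in> tuples D j \<and> map f xss \<in> rels N s})"

text \<open>Interpretability alone only yields an abstractly isomorphic copy of \<open>N\<close>; e.g. every finite
  structure is interpretable in every structure with two elements, by coding its elements by
  equality types of tuples. To say that the elements of \<open>N\<close> themselves are defined in terms of \<open>M\<close>,
  the natural incidence \<open>J\<close> between elements of \<open>N\<close> and elements of \<open>M\<close> (here: inclusion of
  subspaces) is required to be definable along with the relations of \<open>N\<close>.\<close>

definition definable_in_terms_of ::
  "('s, 'b) struct \<Rightarrow> ('r, 'a) struct \<Rightarrow> ('b \<Rightarrow> 'a \<Rightarrow> bool) \<Rightarrow> bool" where
  "definable_in_terms_of N M J \<longleftrightarrow>
     (\<exists>m D f. interprets M N m D f \<and>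
        definable M (Suc m) {xs @ [a] | xs a. xs \<in> D \<and> a \<in> univ M \<and> J (f xs) a})"


section \<open>Symplectic geometry\<close>

locale symplectic_space = finite_dimensional_vector_space scale Basis
  for scale :: "'k::field \<Rightarrow> 'v::ab_group_add \<Rightarrow> 'v"
    and Basis :: "'v set" +
  fixes \<xi> :: "'v \<Rightarrow> 'v \<Rightarrow> 'k"
  assumes char_neq_2: "CHAR('k) \<noteq> 2"
    and linear_left: "\<And>y. Vector_Spaces.linear scale (*) (\<lambda>x. \<xi> x y)"
    and linear_right: "\<And>x. Vector_Spaces.linear scale (*) (\<lambda>y. \<xi> x y)"
    and alternating: "\<And>x. \<xi> x x = 0"
    and nondegenerate: "\<And>x. (\<And>y. \<xi> x y = 0) \<Longrightarrow> x = 0"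
begin

definition perp :: "'v set \<Rightarrow> 'v set \<Rightarrow> bool" where
  "perp U W \<longleftrightarrow> (\<forall>u\<in>U. \<forall>w\<in>W. \<xi> u w = 0)"

definition orth :: "'v set \<Rightarrow> 'v set" where
  "orth U = {u. \<forall>w\<in>U. \<xi> u w = 0}"

definition Rad :: "'v set \<Rightarrow> 'v set" where
  "Rad U = U \<inter> orth U"

definition rdim :: "'v set \<Rightarrow> nat" where
  "rdim U = dim (Rad U)"

definition regular :: "'v set \<Rightarrow> bool" where
  "regular U \<longleftrightarrow> subspace U \<and> Rad U = {0}"

definition Regular :: "nat \<Rightarrow> 'v set set" where
  "Regular k = {U. regular U \<and> dim U = k}"

definition TR :: "nat \<Rightarrow> 'v set set" where
  "TR k = {U. subspace U \<and> rdim U \<le> 1 \<and> dim U = k}"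

text \<open>\<open>Gr k\<close> is the set of all \<open>k\<close>-dimensional subspaces, so \<open>Gr 1\<close> and \<open>Gr 2\<close> are the points and
  the lines of the projective space.\<close>

definition Gr :: "nat \<Rightarrow> 'v set set" where
  "Gr k = {U. subspace U \<and> dim U = k}"

definition pencil :: "nat \<Rightarrow> 'v set \<Rightarrow> 'v set \<Rightarrow> 'v set set" where
  "pencil k H B = {U \<in> TR k. H \<subset> U \<and> U \<subset> B}"

definition pencils :: "nat \<Rightarrow> 'v set set set" where
  "pencils k = {pencil k H B | H B.
     H \<in> TR (k - 1) \<and> B \<in> TR (k + 1) \<and> H \<subset> B \<and> pencil k H B \<noteq> {}}"

definition adjacent :: "nat \<Rightarrow> 'v set \<Rightarrow> 'v set \<Rightarrow> bool" where
  "adjacent k U W \<longleftrightarrow> U \<noteq> W \<and> (\<exists>p \<in> pencils k. U \<in> p \<and> W \<in> p)"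

end


section \<open>The structures\<close>

datatype proj_symbol = Proj_Point | Proj_Line | Proj_Inc | Proj_Perp
datatype adj_symbol = Adj
datatype grass_symbol = Grass_Point | Grass_Line | Grass_Inc

context symplectic_space
begin

text \<open>Two-sorted structures are rendered with one universe and a predicate for each sort.\<close>

definition projective_geometry :: "(proj_symbol, 'v set) struct" where
  "projective_geometry = Struct (Gr 1 \<union> Gr 2)
     (\<lambda>s. case s of
        Proj_Point \<Rightarrow> {[p] | p. p \<in> Gr 1}
      | Proj_Line \<Rightarrow> {[l] | l. l \<in> Gr 2}
      | Proj_Inc \<Rightarrow> {[p, l] | p l. p \<in> Gr 1 \<and> l \<in> Gr 2 \<and> p \<subseteq> l}
      | Proj_Perp \<Rightarrow> {[a, b] | a b. a \<in> Gr 1 \<union> Gr 2 \<and> b \<in> Gr 1 \<union> Gr 2 \<and> perp a b})"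

definition adjacency_structure :: "nat \<Rightarrow> 'v set set \<Rightarrow> (adj_symbol, 'v set) struct" where
  "adjacency_structure k A =
     Struct A (\<lambda>_. {[U, W] | U W. U \<in> A \<and> W \<in> A \<and> adjacent k U W})"

definition Grassmann_space :: "nat \<Rightarrow> (grass_symbol, 'v set + 'v set set) struct" where
  "Grassmann_space k = Struct (Inl ` TR k \<union> Inr ` pencils k)
     (\<lambda>s. case s of
        Grass_Point \<Rightarrow> {[Inl U] | U. U \<in> TR k}
      | Grass_Line \<Rightarrow> {[Inr p] | p. p \<in> pencils k}
      | Grass_Inc \<Rightarrow> {[Inl U, Inr p] | U p. U \<in> TR k \<and> p \<in> pencils k \<and> U \<in> p})"

end

end

theory Submission
  imports Defs
begin

text \<open>Taking orthogonal complements identifies adjacency on \<open>TR k\<close> with adjacency on \<open>TR (n - k)\<close>, so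
  \<open>2 * k < n\<close> may be assumed. Adjacent spaces \<open>U\<close>, \<open>W\<close> lie in the star of all elements of \<open>TR k\<close>
  containing \<open>U \<inter> W\<close> and in the top of all those contained in \<open>U + W\<close>. Stars and tops are
  recovered from adjacency, and \<open>k \<noteq> n - k\<close> tells them apart: for odd \<open>k\<close> they are symplectic spaces
  of dimensions \<open>n - k + 1\<close> and \<open>k + 1\<close>, with non-orthogonality as adjacency; for even \<open>k\<close> the stars
  and the tops through a fixed regular space form symplectic spaces of dimensions \<open>k\<close> and \<open>n - k\<close>.
  Hence the stars, that is, the elements of \<open>TR (k - 1)\<close>, are interpretable, and their adjacency is
  definable. Repeating this leads to \<open>k = 1\<close>, where adjacency is non-orthogonality of points, from
  which the lines are obtained as double orthogonal complements.\<close>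

section \<open>First-order predicates\<close>

text \<open>Cliques of the adjacency graph cannot serve as stars and tops: for odd \<open>k\<close>
  a star contains orthogonal points, which are not adjacent. So the lines are found first, by a test
  with a fourth space, and stars and tops grow out of the lines through one element. The test is
  where the characteristic enters: on a hyperbolic line the point a u + b w must not be orthogonal
  to its harmonic conjugate a u - b w. One invariant separates the types: the least number of points
  of a symplectic space such that no point is orthogonal to all of them is the dimension. For even
  \<open>k\<close> all elements of a star are adjacent, so nothing can be counted inside it; the
  count is made among the stars through one regular space and needs an adjacency of stars before
  stars are known. Hence \<open>star_adj\<close> is phrased for stars and tops alike and is
  invariant under complements. Besides the projective geometry itself, its inclusion in the elements
  of the given structure has to be defined; therefore an incidence is transported through all
  interpretations.\<close>

lemma sat_cong:
  "(\<And>i. i \<in> free_vars \<phi> \<Longrightarrow> e i = e' i) \<Longrightarrow> sat M e \<phi> = sat M e' \<phi>"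
proof (induction \<phi> arbitrary: e e')
  case (Atom r js)
  then have "map e js = map e' js" by simp
  then show ?case by (simp only: sat.simps)
next
  case (Conj \<phi> \<psi>)
  then show ?case by (metis UnI1 UnI2 free_vars.simps(4) sat.simps(4))
next
  case (Exist i \<phi>)
  have "sat M (e(i := a)) \<phi> = sat M (e'(i := a)) \<phi>" for a
    by (rule Exist.IH) (use Exist.prems in auto)
  then show ?case by simp
next
  case (Neg \<phi>)
  then show ?case by (metis free_vars.simps(3) sat.simps(3))
qed simp

lemma finite_free_vars: "finite (free_vars \<phi>)"
  by (induction \<phi>) auto

text \<open>\<open>\<sigma>\<close> need not be injective. Capture is avoided by giving the bound
  variable a name outside the image of the other free variables.\<close>

lemma rename_formula:
  "\<exists>\<psi>. free_vars \<psi> \<subseteq> \<sigma> ` free_vars \<phi> \<and> (\<forall>e. sat M e \<psi> = sat M (e \<circ> \<sigma>) \<phi>)"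
proof (induction \<phi> arbitrary: \<sigma>)
  case (Equal i j)
  show ?case by (rule exI[of _ "Equal (\<sigma> i) (\<sigma> j)"]) auto
next
  case (Atom r js)
  show ?case by (rule exI[of _ "Atom r (map \<sigma> js)"]) (simp add: comp_def)
next
  case (Neg \<phi>)
  obtain \<psi> where "free_vars \<psi> \<subseteq> \<sigma> ` free_vars \<phi>" "\<forall>e. sat M e \<psi> = sat M (e \<circ> \<sigma>) \<phi>"
    using Neg[of \<sigma>] by blast
  then show ?case by (intro exI[of _ "Neg \<psi>"]) (simp add: comp_def)
next
  case (Conj \<phi>1 \<phi>2)
  obtain \<psi>1 where 1: "free_vars \<psi>1 \<subseteq> \<sigma> ` free_vars \<phi>1" "\<forall>e. sat M e \<psi>1 = sat M (e \<circ> \<sigma>) \<phi>1"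
    using Conj.IH(1)[of \<sigma>] by blast
  obtain \<psi>2 where 2: "free_vars \<psi>2 \<subseteq> \<sigma> ` free_vars \<phi>2" "\<forall>e. sat M e \<psi>2 = sat M (e \<circ> \<sigma>) \<phi>2"
    using Conj.IH(2)[of \<sigma>] by blast
  show ?case by (rule exI[of _ "Conj \<psi>1 \<psi>2"]) (use 1 2 in \<open>auto simp: comp_def\<close>)
next
  case (Exist i \<phi>)
  obtain j where j: "j \<notin> \<sigma> ` (free_vars \<phi> - {i})"
    using ex_new_if_finite[OF infinite_UNIV_nat] finite_free_vars by (metis finite_Diff finite_imageI)
  obtain \<psi> where \<psi>: "free_vars \<psi> \<subseteq> \<sigma>(i := j) ` free_vars \<phi>"
      "\<forall>e. sat M e \<psi> = sat M (e \<circ> \<sigma>(i := j)) \<phi>"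
    using Exist.IH[of "\<sigma>(i := j)"] by blast
  have "sat M (e(j := a)) \<psi> = sat M ((e \<circ> \<sigma>)(i := a)) \<phi>" for e a
    using j by (subst \<psi>(2)[rule_format], intro sat_cong) auto
  moreover have "free_vars (Exist j \<psi>) \<subseteq> \<sigma> ` free_vars (Exist i \<phi>)"
    using \<psi>(1) by (auto split: if_splits)
  ultimately show ?case by (intro exI[of _ "Exist j \<psi>"]) (simp add: comp_def)
qed

text \<open>First-orderness is a property of HOL predicates of environments, so connectives and
  quantifiers become closure rules and formulas are hardly ever written down. Only environments with
  values in the universe count, so the notion is vacuous over an empty universe.\<close>

definition fo :: "('r, 'a) struct \<Rightarrow> ((nat \<Rightarrow> 'a) \<Rightarrow> bool) \<Rightarrow> bool" where
  "fo M \<Phi> \<longleftrightarrow> (\<exists>\<phi>. \<forall>e. range e \<subseteq> univ M \<longrightarrow> (\<Phi> e \<longleftrightarrow> sat M e \<phi>))"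

lemma fo_cong:
  "fo M \<Phi> \<Longrightarrow> (\<And>e. range e \<subseteq> univ M \<Longrightarrow> \<Phi> e = \<Psi> e) \<Longrightarrow> fo M \<Psi>"
  unfolding fo_def by metis

lemma fo_eq: "fo M (\<lambda>e. e i = e j)"
  unfolding fo_def by (intro exI[of _ "Equal i j"]) simp

lemma fo_not: "fo M \<Phi> \<Longrightarrow> fo M (\<lambda>e. \<not> \<Phi> e)"
  unfolding fo_def by (metis sat.simps(3))

lemma fo_conj: "fo M \<Phi> \<Longrightarrow> fo M \<Psi> \<Longrightarrow> fo M (\<lambda>e. \<Phi> e \<and> \<Psi> e)"
  unfolding fo_def by (metis sat.simps(4))

lemma fo_disj: "fo M \<Phi> \<Longrightarrow> fo M \<Psi> \<Longrightarrow> fo M (\<lambda>e. \<Phi> e \<or> \<Psi> e)"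
  using fo_not[of M "\<lambda>e. \<not> \<Phi> e \<and> \<not> \<Psi> e"] fo_conj[of M "\<lambda>e. \<not> \<Phi> e" "\<lambda>e. \<not> \<Psi> e"]
    fo_not[of M \<Phi>] fo_not[of M \<Psi>] by (simp add: de_Morgan_conj)

lemma fo_imp: "fo M \<Phi> \<Longrightarrow> fo M \<Psi> \<Longrightarrow> fo M (\<lambda>e. \<Phi> e \<longrightarrow> \<Psi> e)"
  using fo_disj[of M "\<lambda>e. \<not> \<Phi> e" \<Psi>] fo_not[of M \<Phi>] by simp

lemma fo_iff: "fo M \<Phi> \<Longrightarrow> fo M \<Psi> \<Longrightarrow> fo M (\<lambda>e. \<Phi> e = \<Psi> e)"
  unfolding iff_conv_conj_imp by (intro fo_conj fo_imp)

lemma fo_const: "fo M (\<lambda>e. c)"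
  using fo_eq[of M 0 0] fo_not[OF fo_eq[of M 0 0]] by (cases c) simp_all

lemma fo_rename: "fo M \<Phi> \<Longrightarrow> fo M (\<lambda>e. \<Phi> (\<lambda>i. e (\<sigma> i)))"
proof -
  assume "fo M \<Phi>"
  then obtain \<phi> where \<phi>: "\<And>e. range e \<subseteq> univ M \<Longrightarrow> \<Phi> e \<longleftrightarrow> sat M e \<phi>" by (auto simp: fo_def)
  obtain \<psi> where "\<forall>e. sat M e \<psi> = sat M (e \<circ> \<sigma>) \<phi>" using rename_formula[of \<sigma> \<phi>] by blast
  moreover have "\<Phi> (\<lambda>i. e (\<sigma> i)) \<longleftrightarrow> sat M (e \<circ> \<sigma>) \<phi>" if "range e \<subseteq> univ M" for e
    unfolding comp_def by (rule \<phi>) (use that in auto)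
  ultimately show ?thesis unfolding fo_def by metis
qed

lemma range_case_nat: "range e \<subseteq> A \<Longrightarrow> a \<in> A \<Longrightarrow> range (case_nat a e) \<subseteq> A"
  by (auto simp: image_subset_iff split: nat.split)

text \<open>The bound variable becomes de Bruijn index 0, so that these rules reduce the
  first-orderness of a concrete predicate to that of its atoms by plain resolution.\<close>

lemma fo_ex:
  assumes "fo M (\<lambda>e. \<Psi> (\<lambda>i. e (Suc i)) (e 0))"
  shows "fo M (\<lambda>e. \<exists>a\<in>univ M. \<Psi> e a)"
proof -
  obtain \<phi> where \<phi>: "\<And>e. range e \<subseteq> univ M \<Longrightarrow> \<Psi> (\<lambda>i. e (Suc i)) (e 0) \<longleftrightarrow> sat M e \<phi>"
    using assms by (auto simp: fo_def)
  have "finite {i. Suc i \<in> free_vars \<phi>}"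
    using finite_vimageI[OF finite_free_vars, of Suc] by (simp add: vimage_def)
  then obtain j where j: "Suc j \<notin> free_vars \<phi>"
    using ex_new_if_finite[OF infinite_UNIV_nat] by blast
  obtain \<psi> where \<psi>: "\<And>e. sat M e \<psi> = sat M (e \<circ> case_nat j id) \<phi>"
    using rename_formula[of "case_nat j id" \<phi> M] by blast
  have "\<Psi> e a \<longleftrightarrow> sat M (e(j := a)) \<psi>" if "range e \<subseteq> univ M" "a \<in> univ M" for e a
  proof -
    have "\<Psi> e a \<longleftrightarrow> sat M (case_nat a e) \<phi>"
      using \<phi>[of "case_nat a e"] range_case_nat[OF that] by simp
    also have "\<dots> \<longleftrightarrow> sat M (e(j := a) \<circ> case_nat j id) \<phi>"
      by (rule sat_cong) (use j in \<open>auto split: nat.splits\<close>)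
    finally show ?thesis using \<psi> by simp
  qed
  then show ?thesis unfolding fo_def by (intro exI[of _ "Exist j \<psi>"]) auto
qed

lemma fo_all:
  assumes "fo M (\<lambda>e. \<Psi> (\<lambda>i. e (Suc i)) (e 0))"
  shows "fo M (\<lambda>e. \<forall>a\<in>univ M. \<Psi> e a)"
  using fo_not[OF fo_ex[of M "\<lambda>e a. \<not> \<Psi> e a", OF fo_not[OF assms]]] by simp

text \<open>\<open>m\<close> is a number of the metalanguage: this is a finite disjunction, not a
  quantifier of the formula.\<close>

lemma fo_ex_less: "(\<And>i. i < (m::nat) \<Longrightarrow> fo M (\<Phi> i)) \<Longrightarrow> fo M (\<lambda>e. \<exists>i<m. \<Phi> i e)"
proof (induction m)
  case 0
  show ?case by (simp add: fo_const)
next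
  case (Suc m)
  then have "fo M (\<lambda>e. \<Phi> m e \<or> (\<exists>i<m. \<Phi> i e))" by (intro fo_disj) auto
  then show ?case by (rule fo_cong) (auto simp: less_Suc_eq)
qed

lemma fo_all_less: "(\<And>i. i < (m::nat) \<Longrightarrow> fo M (\<Phi> i)) \<Longrightarrow> fo M (\<lambda>e. \<forall>i<m. \<Phi> i e)"
  using fo_not[OF fo_ex_less[of m M "\<lambda>i e. \<not> \<Phi> i e"]] fo_not[of M "\<Phi> i" for i] by simp

lemma tuples_0: "tuples A 0 = {[]}"
  by (auto simp: tuples_def)

lemma tuplesI: "length xs = m \<Longrightarrow> (\<And>i. i < m \<Longrightarrow> xs ! i \<in> A) \<Longrightarrow> xs \<in> tuples A m"
  by (auto simp: tuples_def in_set_conv_nth)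

lemma tuples_nth: "xs \<in> tuples A m \<Longrightarrow> i < m \<Longrightarrow> xs ! i \<in> A"
  by (auto simp: tuples_def)

lemma fo_ex_tuple:
  assumes "fo M (\<lambda>e. \<Psi> (\<lambda>i. e (m + i)) (map e [0..<m]))"
  shows "fo M (\<lambda>e. \<exists>xs\<in>tuples (univ M) m. \<Psi> e xs)"
  using assms
proof (induction m arbitrary: \<Psi>)
  case 0
  then show ?case by (simp add: tuples_0)
next
  case (Suc m)
  have eq: "map e [0..<m] @ [e m] = map e [0..<Suc m]" for e :: "nat \<Rightarrow> 'b" by simp
  have "fo M (\<lambda>e. \<exists>a\<in>univ M. \<exists>xs\<in>tuples (univ M) m. \<Psi> e (xs @ [a]))"
  proof (rule fo_ex, rule Suc.IH)
    show "fo M (\<lambda>e. \<Psi> (\<lambda>i. e (m + Suc i)) (map e [0..<m] @ [e (m + 0)]))"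
      using Suc.prems by simp
  qed
  moreover have "(\<exists>xs\<in>tuples (univ M) (Suc m). \<Psi> e xs) \<longleftrightarrow>
      (\<exists>a\<in>univ M. \<exists>xs\<in>tuples (univ M) m. \<Psi> e (xs @ [a]))" for e
  proof
    assume "\<exists>xs\<in>tuples (univ M) (Suc m). \<Psi> e xs"
    then obtain xs where xs: "length xs = Suc m" "set xs \<subseteq> univ M" "\<Psi> e xs"
      by (auto simp: tuples_def)
    then obtain ys a where "xs = ys @ [a]" by (metis length_Suc_conv_rev)
    then show "\<exists>a\<in>univ M. \<exists>xs\<in>tuples (univ M) m. \<Psi> e (xs @ [a])"
      using xs by (auto simp: tuples_def)
  next
    assume "\<exists>a\<in>univ M. \<exists>xs\<in>tuples (univ M) m. \<Psi> e (xs @ [a])"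
    then obtain a xs where "a \<in> univ M" "xs \<in> tuples (univ M) m" "\<Psi> e (xs @ [a])" by blast
    then show "\<exists>xs\<in>tuples (univ M) (Suc m). \<Psi> e xs"
      by (intro bexI[of _ "xs @ [a]"]) (auto simp: tuples_def)
  qed
  ultimately show ?case by (simp only:)
qed

lemma fo_atom: "fo M (\<lambda>e. map e js \<in> rels M r)"
  unfolding fo_def by (intro exI[of _ "Atom r js"]) simp

lemma fo_definable:
  assumes "definable M m X"
  shows "fo M (\<lambda>e. map e js \<in> X)"
proof (cases "length js = m")
  case True
  obtain \<phi> where \<phi>: "free_vars \<phi> \<subseteq> {..<m}" "X = {xs \<in> tuples (univ M) m. sat M (nth xs) \<phi>}"
    using assms by (auto simp: definable_def)
  have "fo M (\<lambda>e. sat M e \<phi>)" by (auto simp: fo_def)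
  then have "fo M (\<lambda>e. sat M (\<lambda>i. e (js ! i)) \<phi>)" by (rule fo_rename)
  then show ?thesis
  proof (rule fo_cong)
    fix e :: "nat \<Rightarrow> 'b" assume "range e \<subseteq> univ M"
    then have "map e js \<in> tuples (univ M) m" using True by (auto simp: tuples_def)
    moreover have "sat M (nth (map e js)) \<phi> = sat M (\<lambda>i. e (js ! i)) \<phi>"
      by (rule sat_cong) (use \<phi>(1) True in \<open>auto dest!: subsetD\<close>)
    ultimately show "sat M (\<lambda>i. e (js ! i)) \<phi> = (map e js \<in> X)" using \<phi>(2) by simp
  qed
next
  case False
  then have "map e js \<notin> X" for e using assms by (auto simp: definable_def tuples_def)
  then show ?thesis by (simp add: fo_const)
qed

text \<open>Arity 0 is treated apart: \<open>fo\<close> is vacuous over an empty universe, and there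
  is no tuple entry to which stray variables could be redirected.\<close>

lemma definable_0:
  fixes M :: "('r, 'a) struct"
  assumes X: "X \<subseteq> {[]}"
  shows "definable M 0 X"
proof -
  \<comment> \<open>\<open>Exist 0 (Equal 0 0)\<close> says that the universe is nonempty; it or its
    negation has the required truth value in this structure.\<close>
  define \<phi> where "\<phi> = (if ([] \<in> X) = (univ M \<noteq> {}) then Exist 0 (Equal 0 0)
    else Neg (Exist 0 (Equal 0 0)) :: 'r formula)"
  have "sat M (nth []) \<phi> \<longleftrightarrow> [] \<in> X" by (auto simp: \<phi>_def)
  moreover have "free_vars \<phi> \<subseteq> {..<0}" by (simp add: \<phi>_def)
  moreover have "X = (if [] \<in> X then {[]} else {})" using X by auto
  ultimately have "X = {xs \<in> tuples (univ M) 0. sat M (nth xs) \<phi>}"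
    unfolding tuples_0 by (cases "[] \<in> X") (simp_all cong: conj_cong)
  with \<open>free_vars \<phi> \<subseteq> {..<0}\<close> show ?thesis unfolding definable_def by (intro exI[of _ \<phi>] conjI)
qed

lemma definableI:
  assumes "fo M (\<lambda>e. \<Phi> (map e [0..<m]))" "X = {xs \<in> tuples (univ M) m. \<Phi> xs}"
  shows "definable M m X"
proof (cases "m = 0")
  case True
  then show ?thesis using assms(2) by (auto intro!: definable_0 simp: tuples_0)
next
  case False
  obtain \<phi> where \<phi>: "\<And>e. range e \<subseteq> univ M \<Longrightarrow> \<Phi> (map e [0..<m]) \<longleftrightarrow> sat M e \<phi>"
    using assms(1) by (auto simp: fo_def)
  \<comment> \<open>Variables beyond the tuple are redirected to its first entry, which exists
    because \<open>m\<close> is nonzero; the predicate reads only the first \<open>m\<close>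
    variables.\<close>
  define \<sigma> where "\<sigma> i = (if i < m then i else 0)" for i
  obtain \<psi> where \<psi>: "free_vars \<psi> \<subseteq> \<sigma> ` free_vars \<phi>" "\<And>e. sat M e \<psi> = sat M (e \<circ> \<sigma>) \<phi>"
    using rename_formula[of \<sigma> \<phi> M] by blast
  have "\<Phi> xs \<longleftrightarrow> sat M (nth xs) \<psi>" if xs: "xs \<in> tuples (univ M) m" for xs
  proof -
    have "range (nth xs \<circ> \<sigma>) \<subseteq> univ M" using xs False by (auto simp: \<sigma>_def tuples_nth)
    from \<phi>[OF this] have "\<Phi> (map (nth xs \<circ> \<sigma>) [0..<m]) \<longleftrightarrow> sat M (nth xs) \<psi>" by (simp add: \<psi>(2))
    moreover have "map (nth xs \<circ> \<sigma>) [0..<m] = xs"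
      using xs by (intro nth_equalityI) (auto simp: \<sigma>_def tuples_def)
    ultimately show ?thesis by simp
  qed
  moreover have "free_vars \<psi> \<subseteq> {..<m}" using \<psi>(1) False by (auto simp: \<sigma>_def split: if_splits)
  ultimately have "free_vars \<psi> \<subseteq> {..<m} \<and> X = {xs \<in> tuples (univ M) m. sat M (nth xs) \<psi>}"
    unfolding assms(2) by (simp cong: conj_cong)
  then show ?thesis unfolding definable_def by blast
qed

section \<open>Interpretations\<close>

text \<open>The environment that lists the codes \<open>E 0\<close>, \<open>E 1\<close>, ... one
  after the other, each of length \<open>m\<close>.\<close>

definition flatten :: "nat \<Rightarrow> (nat \<Rightarrow> 'a list) \<Rightarrow> nat \<Rightarrow> 'a" where
  "flatten m E n = E (n div m) ! (n mod m)"

text \<open>In the environment of the formula, the parameter \<open>a\<close> from \<open>M\<close> is followed by the codes of the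
  elements of the interpreted structure, in blocks of length \<open>m\<close>.\<close>

definition crel :: "('r, 'a) struct \<Rightarrow> nat \<Rightarrow> 'a list set \<Rightarrow> ('a list \<Rightarrow> 'b) \<Rightarrow>
    ((nat \<Rightarrow> 'b) \<Rightarrow> 'a \<Rightarrow> bool) \<Rightarrow> bool" where
  "crel M m D f \<Phi> \<longleftrightarrow> (\<exists>\<Psi>. fo M \<Psi> \<and> (\<forall>E a. (\<forall>i. E i \<in> D) \<longrightarrow> a \<in> univ M \<longrightarrow>
     \<Psi> (case_nat a (flatten m E)) = \<Phi> (\<lambda>i. f (E i)) a))"

text \<open>Stronger in form than \<open>interprets\<close>: all first-order predicates pull back,
  which makes composition easy. By \<open>interpI\<close> only equality and the relations need to be
  checked. The condition \<open>0 < m\<close> keeps the blocks of \<open>flatten\<close>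
  nonempty.\<close>

definition interp :: "('r, 'a) struct \<Rightarrow> ('s, 'b) struct \<Rightarrow> nat \<Rightarrow> 'a list set \<Rightarrow>
    ('a list \<Rightarrow> 'b) \<Rightarrow> bool" where
  "interp M N m D f \<longleftrightarrow> 0 < m \<and> D \<subseteq> tuples (univ M) m \<and> f ` D = univ N \<and> definable M m D \<and>
     (\<forall>\<Phi>. fo N \<Phi> \<longrightarrow> crel M m D f (\<lambda>e a. \<Phi> e))"

lemma crelI:
  assumes "fo M \<Psi>" "\<And>E a. (\<And>i. E i \<in> D) \<Longrightarrow> a \<in> univ M \<Longrightarrow>
     \<Psi> (case_nat a (flatten m E)) = \<Phi> (\<lambda>i. f (E i)) a"
  shows "crel M m D f \<Phi>"
proof -
  have "\<Psi> (case_nat a (flatten m E)) = \<Phi> (\<lambda>i. f (E i)) a"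
    if "\<forall>i. E i \<in> D" "a \<in> univ M" for E a
    by (rule assms(2)[OF spec[OF that(1)] that(2)])
  then have "\<forall>E a. (\<forall>i. E i \<in> D) \<longrightarrow> a \<in> univ M \<longrightarrow>
      \<Psi> (case_nat a (flatten m E)) = \<Phi> (\<lambda>i. f (E i)) a"
    by (intro allI impI)
  with assms(1) show ?thesis unfolding crel_def by (intro exI[of _ \<Psi>] conjI)
qed

lemma crelE:
  assumes "crel M m D f \<Phi>"
  obtains \<Psi> where "fo M \<Psi>" "\<And>E a. (\<And>i. E i \<in> D) \<Longrightarrow> a \<in> univ M \<Longrightarrow>
     \<Psi> (case_nat a (flatten m E)) = \<Phi> (\<lambda>i. f (E i)) a"
proof -
  from assms[unfolded crel_def] obtain \<Psi> where \<Psi>: "fo M \<Psi>"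
    "\<forall>E a. (\<forall>i. E i \<in> D) \<longrightarrow> a \<in> univ M \<longrightarrow>
     \<Psi> (case_nat a (flatten m E)) = \<Phi> (\<lambda>i. f (E i)) a" by (elim exE conjE)
  show thesis
  proof (rule that)
    show "\<Psi> (case_nat a (flatten m E)) = \<Phi> (\<lambda>i. f (E i)) a"
      if "\<And>i. E i \<in> D" "a \<in> univ M" for E a
      using \<Psi>(2)[rule_format, of E a] that by simp
  qed (rule \<Psi>(1))
qed

lemma crel_cong:
  assumes "crel M m D f \<Phi>"
    and "\<And>e a. range e \<subseteq> f ` D \<Longrightarrow> a \<in> univ M \<Longrightarrow> \<Phi> e a = \<Psi> e a"
  shows "crel M m D f \<Psi>"
proof (rule crelE[OF assms(1)])
  fix \<Theta> assume \<Theta>: "fo M \<Theta>" "\<And>E a. (\<And>i. E i \<in> D) \<Longrightarrow> a \<in> univ M \<Longrightarrow>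
     \<Theta> (case_nat a (flatten m E)) = \<Phi> (\<lambda>i. f (E i)) a"
  have "\<Phi> (\<lambda>i. f (E i)) a = \<Psi> (\<lambda>i. f (E i)) a" if "\<And>i. E i \<in> D" "a \<in> univ M" for E a
    by (rule assms(2)) (use that in auto)
  then show ?thesis using \<Theta>(2) by (intro crelI[OF \<Theta>(1)]) simp
qed

lemma crel_not:
  assumes "crel M m D f \<Phi>"
  shows "crel M m D f (\<lambda>e a. \<not> \<Phi> e a)"
proof (rule crelE[OF assms])
  fix \<Theta> assume \<Theta>: "fo M \<Theta>" "\<And>E a. (\<And>i. E i \<in> D) \<Longrightarrow> a \<in> univ M \<Longrightarrow>
     \<Theta> (case_nat a (flatten m E)) = \<Phi> (\<lambda>i. f (E i)) a"
  show ?thesis using \<Theta>(2) by (intro crelI[OF fo_not[OF \<Theta>(1)]]) simp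
qed

lemma crel_conj:
  assumes "crel M m D f \<Phi>" "crel M m D f \<Psi>"
  shows "crel M m D f (\<lambda>e a. \<Phi> e a \<and> \<Psi> e a)"
proof (rule crelE[OF assms(1)], rule crelE[OF assms(2)])
  fix \<Theta> \<Theta>' assume \<Theta>: "fo M \<Theta>" "\<And>E a. (\<And>i. E i \<in> D) \<Longrightarrow> a \<in> univ M \<Longrightarrow>
     \<Theta> (case_nat a (flatten m E)) = \<Phi> (\<lambda>i. f (E i)) a"
    and \<Theta>': "fo M \<Theta>'" "\<And>E a. (\<And>i. E i \<in> D) \<Longrightarrow> a \<in> univ M \<Longrightarrow>
     \<Theta>' (case_nat a (flatten m E)) = \<Psi> (\<lambda>i. f (E i)) a"
  show ?thesis using \<Theta>(2) \<Theta>'(2) by (intro crelI[OF fo_conj[OF \<Theta>(1) \<Theta>'(1)]]) simp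
qed

lemma crel_imp:
  assumes "crel M m D f \<Phi>" "crel M m D f \<Psi>"
  shows "crel M m D f (\<lambda>e a. \<Phi> e a \<longrightarrow> \<Psi> e a)"
  using crel_not[OF crel_conj[OF assms(1) crel_not[OF assms(2)]]] by simp

lemma flatten_comp:
  assumes "0 < m"
  shows "flatten m (\<lambda>i. E (\<sigma> i)) = (\<lambda>n. flatten m E (\<sigma> (n div m) * m + n mod m))"
  using assms by (auto simp: flatten_def)

lemma crel_rename:
  assumes "0 < m" "crel M m D f \<Phi>"
  shows "crel M m D f (\<lambda>e a. \<Phi> (\<lambda>i. e (\<sigma> i)) a)"
proof (rule crelE[OF assms(2)])
  fix \<Theta> assume \<Theta>: "fo M \<Theta>" "\<And>E a. (\<And>i. E i \<in> D) \<Longrightarrow> a \<in> univ M \<Longrightarrow>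
     \<Theta> (case_nat a (flatten m E)) = \<Phi> (\<lambda>i. f (E i)) a"
  \<comment> \<open>Index 0 is the parameter and stays; position \<open>n mod m\<close> of block
    \<open>n div m\<close> is read in block \<open>\<sigma> (n div m)\<close> instead.\<close>
  define \<rho> where "\<rho> = case_nat 0 (\<lambda>n. Suc (\<sigma> (n div m) * m + n mod m))"
  have "case_nat a (flatten m (\<lambda>i. E (\<sigma> i))) = (\<lambda>i. case_nat a (flatten m E) (\<rho> i))"
    for a and E :: "nat \<Rightarrow> 'b list"
    unfolding flatten_comp[OF assms(1)] by (auto simp: \<rho>_def fun_eq_iff split: nat.splits)
  then show ?thesis
    using \<Theta>(2)[of "\<lambda>i. E (\<sigma> i)" for E] by (intro crelI[OF fo_rename[OF \<Theta>(1), of \<rho>]]) simp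
qed

lemma flatten_less: "n < m \<Longrightarrow> flatten m E n = E 0 ! n"
  by (simp add: flatten_def)

lemma flatten_add: "0 < m \<Longrightarrow> flatten m E (m + n) = flatten m (\<lambda>i. E (Suc i)) n"
  by (simp add: flatten_def)

lemma crel_ex:
  assumes m: "0 < m" "definable M m D" "D \<subseteq> tuples (univ M) m"
    and "crel M m D f (\<lambda>e a. \<Psi> (\<lambda>i. e (Suc i)) (e 0) a)"
  shows "crel M m D f (\<lambda>e a. \<exists>b\<in>f ` D. \<Psi> e b a)"
proof (rule crelE[OF assms(4)])
  fix \<Theta> assume \<Theta>: "fo M \<Theta>" "\<And>E a. (\<And>i. E i \<in> D) \<Longrightarrow> a \<in> univ M \<Longrightarrow>
     \<Theta> (case_nat a (flatten m E)) = \<Psi> (\<lambda>i. f (E (Suc i))) (f (E 0)) a"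
  define \<Theta>' where "\<Theta>' e xs \<longleftrightarrow> xs \<in> D \<and>
    \<Theta> (case_nat (e 0) (\<lambda>n. if n < m then xs ! n else e (Suc (n - m))))" for e xs
  \<comment> \<open>\<open>\<Theta>\<close> expects the parameter, then the code of the bound
    element, then the rest. After quantification over tuples that code occupies the indices below
    \<open>m\<close> and the parameter index \<open>m\<close>; the rest is in place.\<close>
  define \<rho> where "\<rho> n = (if n = 0 then m else if n \<le> m then n - 1 else n)" for n
  have "fo M (\<lambda>e. map e [0..<m] \<in> D \<and> \<Theta> (\<lambda>i. e (\<rho> i)))"
    by (rule fo_conj[OF fo_definable[OF m(2)] fo_rename[OF \<Theta>(1)]])
  moreover have "(\<lambda>i. e (\<rho> i)) = case_nat (e (m + 0))
      (\<lambda>n. if n < m then map e [0..<m] ! n else e (m + Suc (n - m)))" for e :: "nat \<Rightarrow> 'b"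
  proof
    fix n show "e (\<rho> n) = case_nat (e (m + 0))
        (\<lambda>n. if n < m then map e [0..<m] ! n else e (m + Suc (n - m))) n"
      using m(1) by (cases n) (simp_all add: \<rho>_def)
  qed
  ultimately have "fo M (\<lambda>e. \<Theta>' (\<lambda>i. e (m + i)) (map e [0..<m]))"
    unfolding \<Theta>'_def by (simp only:)
  then have "fo M (\<lambda>e. \<exists>xs\<in>tuples (univ M) m. \<Theta>' e xs)" by (rule fo_ex_tuple)
  then show ?thesis
  proof (rule crelI)
    fix E :: "nat \<Rightarrow> 'b list" and a assume E: "\<And>i. E i \<in> D" and a: "a \<in> univ M"
    have "\<Theta>' (case_nat a (flatten m E)) xs \<longleftrightarrow> \<Psi> (\<lambda>i. f (E i)) (f xs) a" if xs: "xs \<in> D" for xs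
    proof -
      have *: "(\<lambda>n. if n < m then xs ! n else flatten m E (n - m)) = flatten m (case_nat xs E)"
      proof
        fix n show "(if n < m then xs ! n else flatten m E (n - m)) = flatten m (case_nat xs E) n"
          using m(1) flatten_add[of m "case_nat xs E" "n - m"] by (cases "n < m") (auto simp: flatten_less)
      qed
      have "case_nat xs E i \<in> D" for i using E xs by (cases i) simp_all
      from \<Theta>(2)[of "case_nat xs E", OF this a] show ?thesis
        using xs by (simp add: \<Theta>'_def * cong: if_cong)
    qed
    then show "(\<exists>xs\<in>tuples (univ M) m. \<Theta>' (case_nat a (flatten m E)) xs) =
        (\<exists>b\<in>f ` D. \<Psi> (\<lambda>i. f (E i)) b a)"
      using m(3) unfolding \<Theta>'_def by blast
  qed
qed

lemma crel_all:
  assumes "0 < m" "definable M m D" "D \<subseteq> tuples (univ M) m"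
    and "crel M m D f (\<lambda>e a. \<Psi> (\<lambda>i. e (Suc i)) (e 0) a)"
  shows "crel M m D f (\<lambda>e a. \<forall>b\<in>f ` D. \<Psi> e b a)"
  using crel_not[OF crel_ex[OF assms(1-3), of f "\<lambda>e b a. \<not> \<Psi> e b a", OF crel_not[OF assms(4)]]]
  by simp

lemma interpI:
  assumes "0 < m" "D \<subseteq> tuples (univ M) m" "f ` D = univ N" "definable M m D"
    and eq: "crel M m D f (\<lambda>e a. e 0 = e 1)"
    and rel: "\<And>r j. crel M m D f (\<lambda>e a. map e [0..<j] \<in> rels N r)"
  shows "interp M N m D f"
proof -
  have "crel M m D f (\<lambda>e a. sat N e \<phi>)" for \<phi>
  proof (induction \<phi>)
    case (Equal i j)
    then show ?case using crel_rename[OF assms(1) eq, of "case_nat i (\<lambda>_. j)"] by simp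
  next
    case (Atom r js)
    have "map (\<lambda>i. e (js ! i)) [0..<length js] = map e js" for e :: "nat \<Rightarrow> 'c"
      by (intro nth_equalityI) auto
    then show ?case using crel_rename[OF assms(1) rel[where j="length js" and r=r], of "nth js"] by simp
  next
    case (Exist i \<phi>)
    \<comment> \<open>The quantified element arrives at index 0 and takes the role of variable
      \<open>i\<close>; all other variables are shifted.\<close>
    define \<sigma> where "\<sigma> j = (if j = i then 0 else Suc j)" for j
    have *: "(\<lambda>j. e (\<sigma> j)) = (\<lambda>j. e (Suc j))(i := e 0)" for e :: "nat \<Rightarrow> 'c" by (auto simp: \<sigma>_def)
    have "crel M m D f (\<lambda>e a. sat N ((\<lambda>j. e (Suc j))(i := e 0)) \<phi>)"
      using crel_rename[OF assms(1) Exist, of \<sigma>] by (simp only: *)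
    from crel_ex[OF assms(1,4,2), of f "\<lambda>e b a. sat N (e(i := b)) \<phi>", OF this]
    show ?case by (simp add: assms(3))
  qed (auto intro: crel_not crel_conj)
  note sat = this
  have "crel M m D f (\<lambda>e a. \<Phi> e)" if \<Phi>: "fo N \<Phi>" for \<Phi>
  proof -
    obtain \<phi> where "\<And>e. range e \<subseteq> f ` D \<Longrightarrow> \<Phi> e = sat N e \<phi>"
      using \<Phi> by (auto simp: fo_def assms(3))
    then show ?thesis by (intro crel_cong[OF sat[of \<phi>]]) simp
  qed
  then show ?thesis unfolding interp_def using assms(1-4) by simp
qed

lemma interpD:
  assumes "interp M N m D f"
  shows "0 < m" "D \<subseteq> tuples (univ M) m" "f ` D = univ N" "definable M m D"
    "\<And>\<Phi>. fo N \<Phi> \<Longrightarrow> crel M m D f (\<lambda>e a. \<Phi> e)"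
  using assms by (auto simp: interp_def)

section \<open>Blocks of coordinates and concatenated codes\<close>

definition block :: "nat \<Rightarrow> (nat \<Rightarrow> 'a) \<Rightarrow> nat \<Rightarrow> 'a list" where
  "block m e i = map (\<lambda>l. e (i * m + l)) [0..<m]"

lemma block_index_less:
  assumes "i < j" "l < m"
  shows "i * m + l < j * (m::nat)"
proof -
  have "i * m + l < Suc i * m" using assms(2) by simp
  also have "\<dots> \<le> j * m" using assms(1) by (intro mult_le_mono1) simp
  finally show ?thesis .
qed

lemma nth_concat_uniform:
  assumes "\<And>xs. xs \<in> set xss \<Longrightarrow> length xs = m" "i < length xss" "l < m"
  shows "concat xss ! (i * m + l) = xss ! i ! l"
  using assms
proof (induction xss arbitrary: i)
  case (Cons xs xss)
  then show ?case by (cases i) (simp_all add: nth_append)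
qed simp

lemma length_concat_uniform:
  "(\<And>xs. xs \<in> set xss \<Longrightarrow> length xs = m) \<Longrightarrow> length (concat xss) = length xss * m"
  by (induction xss) simp_all

lemma concat_in_tuples:
  assumes "D \<subseteq> tuples A m" "xss \<in> tuples D j"
  shows "concat xss \<in> tuples A (j * m)"
  using assms length_concat_uniform[of xss m] by (fastforce simp: tuples_def)

lemma block_concat:
  assumes "D \<subseteq> tuples A m" "xss \<in> tuples D j" "i < j"
  shows "block m (nth (concat xss)) i = xss ! i"
proof (rule nth_equalityI)
  have len: "length xs = m" if "xs \<in> set xss" for xs
    using assms(1,2) that by (auto simp: tuples_def)
  have i: "i < length xss" using assms by (auto simp: tuples_def)
  then show "length (block m (nth (concat xss)) i) = length (xss ! i)" by (simp add: block_def len)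
  show "block m (nth (concat xss)) i ! l = xss ! i ! l"
    if "l < length (block m (nth (concat xss)) i)" for l
    using that nth_concat_uniform[OF len i, of l] by (simp add: block_def)
qed

lemma concat_block:
  assumes "length zs = j * m"
  shows "concat (map (block m (nth zs)) [0..<j]) = zs"
proof (rule nth_equalityI)
  let ?xss = "map (block m (nth zs)) [0..<j]"
  have len: "length xs = m" if "xs \<in> set ?xss" for xs using that by (auto simp: block_def)
  show eq: "length (concat ?xss) = length zs" using length_concat_uniform[of ?xss m] len assms by simp
  fix n assume "n < length (concat ?xss)"
  then have n: "n < j * m" by (simp only: eq assms)
  then have m: "0 < m" by (cases m) simp_all
  have q: "n div m < j" using n by (simp add: less_mult_imp_div_less)
  have "concat ?xss ! (n div m * m + n mod m) = ?xss ! (n div m) ! (n mod m)"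
    by (rule nth_concat_uniform[OF len]) (use m q in simp_all)
  then show "concat ?xss ! n = zs ! n" using m q by (simp add: block_def)
qed

lemma map_nth_tuple: "xs \<in> tuples A j \<Longrightarrow> map (\<lambda>i. g (xs ! i)) [0..<j] = map g xs"
  by (intro nth_equalityI) (auto simp: tuples_def)

text \<open>The blocks of a flat tuple sit at fixed indices, so the right-hand side can be expressed
  by a formula, while quantification over lists of codes cannot.\<close>

lemma concat_set_eq:
  assumes "D \<subseteq> tuples A m"
  shows "{concat xss | xss. xss \<in> tuples D j \<and> \<Phi> (map f xss)} =
    {zs \<in> tuples A (j * m). (\<forall>i<j. block m (nth zs) i \<in> D) \<and>
      \<Phi> (map (\<lambda>i. f (block m (nth zs) i)) [0..<j])}" (is "?L = ?R")
proof
  show "?L \<subseteq> ?R"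
  proof
    fix zs assume "zs \<in> ?L"
    then obtain xss where xss: "zs = concat xss" "xss \<in> tuples D j" "\<Phi> (map f xss)" by blast
    have "map (\<lambda>i. f (block m (nth zs) i)) [0..<j] = map (\<lambda>i. f (xss ! i)) [0..<j]"
      unfolding xss(1) using block_concat[OF assms xss(2)] by (intro map_cong) simp_all
    also have "\<dots> = map f xss" by (rule map_nth_tuple[OF xss(2)])
    finally show "zs \<in> ?R"
      using xss concat_in_tuples[OF assms xss(2)] block_concat[OF assms xss(2)] tuples_nth[OF xss(2)]
      by simp
  qed
  show "?R \<subseteq> ?L"
  proof
    fix zs assume zs: "zs \<in> ?R"
    let ?xss = "map (block m (nth zs)) [0..<j]"
    have "concat ?xss = zs" using zs by (intro concat_block) (simp add: tuples_def)
    moreover have "?xss \<in> tuples D j" using zs by (intro tuplesI) simp_all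
    moreover have "\<Phi> (map f ?xss)" using zs by (simp add: comp_def)
    ultimately show "zs \<in> ?L" by (metis (mono_tags, lifting) mem_Collect_eq)
  qed
qed

lemma definable_concat:
  assumes "interp M N m D f" "fo N (\<lambda>e. \<Phi> (map e [0..<j]))"
  shows "definable M (j * m) {concat xss | xss. xss \<in> tuples D j \<and> \<Phi> (map f xss)}"
proof (cases "j = 0")
  case True
  then show ?thesis by (auto simp: tuples_0 intro: definable_0)
next
  case False
  note M = interpD[OF assms(1)]
  obtain \<Psi> where \<Psi>: "fo M \<Psi>" "\<And>E a. (\<And>i. E i \<in> D) \<Longrightarrow> a \<in> univ M \<Longrightarrow>
     \<Psi> (case_nat a (flatten m E)) = \<Phi> (map (\<lambda>i. f (E i)) [0..<j])"
    using crelE[OF M(5)[OF assms(2)]] by blast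
  \<comment> \<open>\<open>\<Psi>\<close> reads a parameter and infinitely many codes, but only
    \<open>j\<close> are given: the parameter is filled with variable 0 and the codes are repeated
    cyclically.\<close>
  define \<rho> where "\<rho> = case_nat 0 (\<lambda>n. (n div m mod j) * m + n mod m)"
  show ?thesis
  proof (rule definableI[OF _ concat_set_eq[OF M(2)]])
    have "fo M (\<lambda>e. (\<forall>i<j. block m e i \<in> D) \<and> \<Psi> (\<lambda>n. e (\<rho> n)))"
    proof (intro fo_conj fo_all_less)
      show "fo M (\<lambda>e. block m e i \<in> D)" for i
        using fo_definable[OF M(4), of "map (\<lambda>l. i * m + l) [0..<m]"] by (simp add: block_def comp_def)
    qed (rule fo_rename[OF \<Psi>(1)])
    then show "fo M (\<lambda>e. (\<forall>i<j. block m (nth (map e [0..<j * m])) i \<in> D) \<and>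
        \<Phi> (map (\<lambda>i. f (block m (nth (map e [0..<j * m])) i)) [0..<j]))"
    proof (rule fo_cong)
      fix e :: "nat \<Rightarrow> _" assume e: "range e \<subseteq> univ M"
      have b: "block m (nth (map e [0..<j * m])) i = block m e i" if "i < j" for i
        using block_index_less[OF that] by (simp add: block_def)
      have "\<Psi> (\<lambda>n. e (\<rho> n)) = \<Phi> (map (\<lambda>i. f (block m e i)) [0..<j])"
        if D: "\<forall>i<j. block m e i \<in> D"
      proof -
        have "block m e (i mod j) \<in> D" for i using D False by simp
        moreover have "e 0 \<in> univ M" using e by blast
        ultimately have "\<Psi> (case_nat (e 0) (flatten m (\<lambda>i. block m e (i mod j)))) =
            \<Phi> (map (\<lambda>i. f (block m e (i mod j))) [0..<j])"
          by (rule \<Psi>(2))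
        moreover have "case_nat (e 0) (flatten m (\<lambda>i. block m e (i mod j))) = (\<lambda>n. e (\<rho> n))"
          using M(1) by (auto simp: flatten_def \<rho>_def block_def fun_eq_iff split: nat.split)
        moreover have "map (\<lambda>i. f (block m e (i mod j))) [0..<j] = map (\<lambda>i. f (block m e i)) [0..<j]"
          by simp
        ultimately show ?thesis by simp
      qed
      moreover have "map (\<lambda>i. f (block m (nth (map e [0..<j * m])) i)) [0..<j] =
          map (\<lambda>i. f (block m e i)) [0..<j]"
        using b by (intro map_cong) simp_all
      ultimately show "((\<forall>i<j. block m e i \<in> D) \<and> \<Psi> (\<lambda>n. e (\<rho> n))) =
          ((\<forall>i<j. block m (nth (map e [0..<j * m])) i \<in> D) \<and>
          \<Phi> (map (\<lambda>i. f (block m (nth (map e [0..<j * m])) i)) [0..<j]))"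
        using b by (metis (no_types, lifting))
    qed
  qed
qed

lemma interp_interprets:
  assumes "interp M N m D f"
  shows "interprets M N m D f"
proof -
  note M = interpD[OF assms]
  have "fo N (\<lambda>e. map e [0..<2] ! 0 = map e [0..<2] ! 1)" using fo_eq[of N 0 1] by simp
  from definable_concat[OF assms this]
  have "definable M (2 * m) {concat xss | xss. xss \<in> tuples D 2 \<and> map f xss ! 0 = map f xss ! 1}" .
  moreover have "{concat xss | xss. xss \<in> tuples D 2 \<and> map f xss ! 0 = map f xss ! 1} =
      {xs @ ys | xs ys. xs \<in> D \<and> ys \<in> D \<and> f xs = f ys}" (is "?L = ?R")
  proof
    show "?L \<subseteq> ?R"
    proof
      fix zs assume "zs \<in> ?L"
      then obtain xss where xss: "zs = concat xss" "xss \<in> tuples D 2" "map f xss ! 0 = map f xss ! 1"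
        by blast
      then obtain xs ys where "xss = [xs, ys]" "xs \<in> D" "ys \<in> D"
        by (auto simp: tuples_def length_Suc_conv numeral_2_eq_2)
      with xss show "zs \<in> ?R" by auto
    qed
    show "?R \<subseteq> ?L"
    proof
      fix zs assume "zs \<in> ?R"
      then obtain xs ys where "zs = xs @ ys" "xs \<in> D" "ys \<in> D" "f xs = f ys" by blast
      then show "zs \<in> ?L" by (intro CollectI exI[of _ "[xs, ys]"]) (simp add: tuples_def)
    qed
  qed
  moreover have "definable M (j * m) {concat xss | xss. xss \<in> tuples D j \<and> map f xss \<in> rels N s}" for s j
    by (rule definable_concat[OF assms fo_atom])
  ultimately show ?thesis using M(2-4) unfolding interprets_def by simp
qed

section \<open>Composition of interpretations\<close>

definition comp_dom :: "nat \<Rightarrow> 'a list set \<Rightarrow> ('a list \<Rightarrow> 'b) \<Rightarrow> nat \<Rightarrow> 'b list set \<Rightarrow> 'a list set" where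
  "comp_dom m D f m' D' = {concat xss | xss. xss \<in> tuples D m' \<and> map f xss \<in> D'}"

definition comp_map :: "nat \<Rightarrow> ('a list \<Rightarrow> 'b) \<Rightarrow> nat \<Rightarrow> ('b list \<Rightarrow> 'c) \<Rightarrow> 'a list \<Rightarrow> 'c" where
  "comp_map m f m' f' zs = f' (map (\<lambda>i. f (block m (nth zs) i)) [0..<m'])"

lemma crel_comp:
  assumes M: "0 < m" "D \<subseteq> tuples (univ M) m" and "0 < m'"
    and "crel M m D f \<Theta>"
    and \<Phi>: "\<And>F a. (\<And>i. F i \<in> D') \<Longrightarrow> a \<in> univ M \<Longrightarrow> \<Theta> (flatten m' F) a = \<Phi> (\<lambda>i. f' (F i)) a"
  shows "crel M (m' * m) (comp_dom m D f m' D') (comp_map m f m' f') \<Phi>"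
proof (rule crelE[OF assms(4)])
  fix \<Psi> assume \<Psi>: "fo M \<Psi>" "\<And>E a. (\<And>i. E i \<in> D) \<Longrightarrow> a \<in> univ M \<Longrightarrow>
     \<Psi> (case_nat a (flatten m E)) = \<Theta> (\<lambda>i. f (E i)) a"
  show ?thesis
  proof (rule crelI[OF \<Psi>(1)])
    fix F :: "nat \<Rightarrow> _ list" and a assume F: "\<And>i. F i \<in> comp_dom m D f m' D'" and a: "a \<in> univ M"
    define E where "E j = block m (nth (F (j div m'))) (j mod m')" for j
    define F' where "F' i = map (\<lambda>l. f (block m (nth (F i)) l)) [0..<m']" for i
    have F_in: "(\<forall>i<m'. block m (nth (F j)) i \<in> D) \<and> F' j \<in> D'" for j
      using F[of j] unfolding comp_dom_def concat_set_eq[OF M(2), of m' "\<lambda>ys. ys \<in> D'"] F'_def by blast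
    have "E j \<in> D" for j using F_in assms(3) by (simp add: E_def)
    from \<Psi>(2)[of E, OF this a] have "\<Psi> (case_nat a (flatten m E)) = \<Theta> (\<lambda>i. f (E i)) a" .
    moreover have "flatten m E = flatten (m' * m) F"
    proof
      fix n
      have "n mod (m' * m) = m * (n div m mod m') + n mod m" by (metis mod_mult2_eq mult.commute)
      moreover have "n div (m' * m) = n div m div m'" by (metis div_mult2_eq mult.commute)
      ultimately show "flatten m E n = flatten (m' * m) F n"
        using M(1) by (simp add: flatten_def E_def block_def mult.commute)
    qed
    moreover have "(\<lambda>i. f (E i)) = flatten m' F'"
      using assms(3) by (auto simp: flatten_def E_def F'_def)
    moreover have "\<Theta> (flatten m' F') a = \<Phi> (\<lambda>i. f' (F' i)) a"
      by (rule \<Phi>) (use F_in a in simp_all)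
    moreover have "(\<lambda>i. f' (F' i)) = (\<lambda>i. comp_map m f m' f' (F i))"
      by (simp add: comp_map_def F'_def)
    ultimately show "\<Psi> (case_nat a (flatten (m' * m) F)) = \<Phi> (\<lambda>i. comp_map m f m' f' (F i)) a"
      by simp
  qed
qed

lemma flatten_in:
  assumes "0 < m" "D \<subseteq> tuples A m" "\<And>i. F i \<in> D"
  shows "flatten m F n \<in> A"
proof -
  have "F (n div m) \<in> tuples A m" using assms by blast
  then show ?thesis unfolding flatten_def by (rule tuples_nth) (simp add: assms(1))
qed

lemma interp_comp:
  assumes MN: "interp M N m D f" and NP: "interp N P m' D' f'"
  shows "interp M P (m' * m) (comp_dom m D f m' D') (comp_map m f m' f')"
proof -
  note M = interpD[OF MN] and N = interpD[OF NP]
  have eq: "comp_map m f m' f' (concat xss) = f' (map f xss)" if "xss \<in> tuples D m'" for xss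
  proof -
    have "map (\<lambda>i. f (block m (nth (concat xss)) i)) [0..<m'] = map (\<lambda>i. f (xss ! i)) [0..<m']"
      using block_concat[OF M(2) that] by (intro map_cong) simp_all
    then show ?thesis unfolding comp_map_def using map_nth_tuple[OF that] by metis
  qed
  have "comp_map m f m' f' ` comp_dom m D f m' D' = univ P"
  proof
    show "comp_map m f m' f' ` comp_dom m D f m' D' \<subseteq> univ P"
      using eq N(3) by (auto simp: comp_dom_def)
    show "univ P \<subseteq> comp_map m f m' f' ` comp_dom m D f m' D'"
    proof
      fix p assume "p \<in> univ P"
      then obtain ys where ys: "ys \<in> D'" "p = f' ys" using N(3) by blast
      then have "set ys \<subseteq> f ` D" "length ys = m'" using N(2) M(3) by (auto simp: tuples_def)
      then have "ys \<in> map f ` lists D" by (simp add: lists_image[symmetric] in_lists_conv_set subset_iff)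
      then obtain xss where xss: "set xss \<subseteq> D" "ys = map f xss" by (auto simp: in_lists_conv_set)
      then have "xss \<in> tuples D m'" using \<open>length ys = m'\<close> by (simp add: tuples_def)
      then have "concat xss \<in> comp_dom m D f m' D'" "comp_map m f m' f' (concat xss) = p"
        using eq xss ys by (auto simp: comp_dom_def)
      then show "p \<in> comp_map m f m' f' ` comp_dom m D f m' D'" by blast
    qed
  qed
  moreover have "definable M (m' * m) (comp_dom m D f m' D')"
    unfolding comp_dom_def by (rule definable_concat[OF MN fo_definable[OF N(4)]])
  moreover have "comp_dom m D f m' D' \<subseteq> tuples (univ M) (m' * m)"
    using concat_in_tuples[OF M(2)] by (auto simp: comp_dom_def)
  moreover have "crel M (m' * m) (comp_dom m D f m' D') (comp_map m f m' f') (\<lambda>e a. \<Phi> e)"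
    if "fo P \<Phi>" for \<Phi>
  proof (rule crelE[OF N(5)[OF that]])
    fix \<Psi> assume \<Psi>: "fo N \<Psi>" "\<And>E a. (\<And>i. E i \<in> D') \<Longrightarrow> a \<in> univ N \<Longrightarrow>
     \<Psi> (case_nat a (flatten m' E)) = \<Phi> (\<lambda>i. f' (E i))"
    \<comment> \<open>\<open>\<Psi>\<close> has a parameter slot for an element of \<open>N\<close>
      on which its value does not depend; the first coordinate of the code fills it.\<close>
    define \<rho> where "\<rho> = case_nat 0 id"
    show ?thesis
    proof (rule crel_comp[OF M(1,2) N(1) M(5)[OF fo_rename[OF \<Psi>(1), of \<rho>]]])
      fix F :: "nat \<Rightarrow> _ list" and a assume "\<And>i. F i \<in> D'"
      then show "\<Psi> (\<lambda>i. flatten m' F (\<rho> i)) = \<Phi> (\<lambda>i. f' (F i))"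
        using \<Psi>(2)[of F "flatten m' F 0"] flatten_in[OF N(1,2), of F]
        by (simp add: \<rho>_def nat.case_distrib[of "flatten m' F"] cong: nat.case_cong)
    qed
  qed
  ultimately show ?thesis using M(1) N(1) unfolding interp_def by simp
qed

text \<open>Incidences compose through an intermediate element of \<open>N\<close>: the parameter of
  the second relation becomes a quantified element of the first interpretation.\<close>

lemma crel_incidence_comp:
  fixes N :: "('s, 'b) struct"
  assumes MN: "interp M N m D f" and NP: "interp N P m' D' f'"
    and I: "crel M m D f (\<lambda>e a. I (e 0) a)" and J: "crel N m' D' f' (\<lambda>e b. J (e 0) b)"
  shows "crel M (m' * m) (comp_dom m D f m' D') (comp_map m f m' f')
    (\<lambda>e a. \<exists>b\<in>univ N. J (e 0) b \<and> I b a)"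
proof (rule crelE[OF J])
  note M = interpD[OF MN] and N = interpD[OF NP]
  fix \<Psi> assume \<Psi>: "fo N \<Psi>" "\<And>E a. (\<And>i. E i \<in> D') \<Longrightarrow> a \<in> univ N \<Longrightarrow>
     \<Psi> (case_nat a (flatten m' E)) = J (f' (E 0)) a"
  have "crel M m D f (\<lambda>e a. \<Psi> (case_nat (e 0) (\<lambda>i. e (Suc i))) \<and> I (e 0) a)"
  proof (rule crel_cong[OF crel_conj[OF M(5)[OF \<Psi>(1)] I]])
    fix e :: "nat \<Rightarrow> 'b" and a
    have "case_nat (e 0) (\<lambda>i. e (Suc i)) = e" by (auto simp: fun_eq_iff split: nat.split)
    then show "(\<Psi> e \<and> I (e 0) a) = (\<Psi> (case_nat (e 0) (\<lambda>i. e (Suc i))) \<and> I (e 0) a)" by simp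
  qed
  from crel_ex[OF M(1,4,2), of f "\<lambda>e b a. \<Psi> (case_nat b e) \<and> I b a", OF this]
  have "crel M m D f (\<lambda>e a. \<exists>b\<in>univ N. \<Psi> (case_nat b e) \<and> I b a)" by (simp add: M(3))
  then show ?thesis
  proof (rule crel_comp[OF M(1,2) N(1)])
    fix F :: "nat \<Rightarrow> _ list" and a assume F: "\<And>i. F i \<in> D'"
    show "(\<exists>b\<in>univ N. \<Psi> (case_nat b (flatten m' F)) \<and> I b a) = (\<exists>b\<in>univ N. J (f' (F 0)) b \<and> I b a)"
      by (rule bex_cong[OF refl]) (simp add: \<Psi>(2)[of F, OF F])
  qed
qed

section \<open>Linear algebra of the symplectic form\<close>

context symplectic_space
begin

lemma xi_add_left: "\<xi> (x + x') y = \<xi> x y + \<xi> x' y"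
  using linear_left[of y] unfolding Vector_Spaces.linear_iff by blast

lemma xi_add_right: "\<xi> x (y + y') = \<xi> x y + \<xi> x y'"
  using linear_right[of x] unfolding Vector_Spaces.linear_iff by blast

lemma xi_scale_left: "\<xi> (scale c x) y = c * \<xi> x y"
  using linear_left[of y] unfolding Vector_Spaces.linear_iff by blast

lemma xi_scale_right: "\<xi> x (scale c y) = c * \<xi> x y"
  using linear_right[of x] unfolding Vector_Spaces.linear_iff by blast

lemma xi_zero_left [simp]: "\<xi> 0 y = 0"
  using xi_scale_left[of 0 0 y] by simp

lemma xi_zero_right [simp]: "\<xi> x 0 = 0"
  using xi_scale_right[of x 0 0] by simp

lemma xi_skew: "\<xi> y x = - \<xi> x y"
proof -
  have "\<xi> x y + \<xi> y x = \<xi> (x + y) (x + y)"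
    unfolding xi_add_left xi_add_right by (simp add: alternating[of x] alternating[of y])
  also have "\<dots> = 0" by (rule alternating)
  finally have "\<xi> x y + \<xi> y x = 0" .
  then show ?thesis by (simp add: eq_neg_iff_add_eq_0 add.commute)
qed

lemma xi_minus_left: "\<xi> (- x) y = - \<xi> x y"
  using xi_add_left[of x "- x" y] by (simp add: minus_unique)

lemma xi_minus_right: "\<xi> x (- y) = - \<xi> x y"
  using xi_add_right[of x y "- y"] by (simp add: minus_unique)

lemma xi_diff_left: "\<xi> (x - x') y = \<xi> x y - \<xi> x' y"
  using xi_add_left[of x "- x'" y] by (simp add: xi_minus_left)

lemma xi_diff_right: "\<xi> x (y - y') = \<xi> x y - \<xi> x y'"
  using xi_add_right[of x y "- y'"] by (simp add: xi_minus_right)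

lemmas xi_simps = xi_add_left xi_add_right xi_scale_left xi_scale_right xi_minus_left
  xi_minus_right xi_diff_left xi_diff_right alternating

lemma xi_eq_0_sym: "\<xi> x y = 0 \<longleftrightarrow> \<xi> y x = 0"
  using xi_skew[of y x] by simp

lemma orth_iff: "x \<in> orth U \<longleftrightarrow> (\<forall>w\<in>U. \<xi> x w = 0)"
  by (simp add: orth_def)

lemma orthD: "x \<in> orth U \<Longrightarrow> w \<in> U \<Longrightarrow> \<xi> x w = 0"
  by (simp add: orth_def)

lemma orthD': "x \<in> orth U \<Longrightarrow> w \<in> U \<Longrightarrow> \<xi> w x = 0"
  using orthD xi_eq_0_sym by blast

lemma orth_singleton: "x \<in> orth {a} \<longleftrightarrow> \<xi> x a = 0"
  by (simp add: orth_def)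

lemma span_of_subspace [simp]: "subspace S \<Longrightarrow> span S = S"
  by simp

lemma subspace_orth [simp, intro]: "subspace (orth U)"
  by (rule subspaceI) (simp_all add: orth_def xi_simps)

lemma orth_antimono: "U \<subseteq> W \<Longrightarrow> orth W \<subseteq> orth U"
  by (auto simp: orth_def)

lemma subset_orth_iff: "U \<subseteq> orth W \<longleftrightarrow> W \<subseteq> orth U"
  using xi_eq_0_sym by (fastforce simp: orth_def)

lemma subset_orth_orth: "U \<subseteq> orth (orth U)"
  by (rule subset_orth_iff[THEN iffD1, OF subset_refl])

lemma orth_span [simp]: "orth (span S) = orth S"
proof
  show "orth (span S) \<subseteq> orth S" by (intro orth_antimono span_superset)
  have "span S \<subseteq> orth (orth S)"
    by (intro span_minimal subspace_orth subset_orth_orth)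
  then show "orth S \<subseteq> orth (span S)" by (rule subset_orth_iff[THEN iffD1])
qed

lemma orth_Un: "orth (U \<union> W) = orth U \<inter> orth W"
  by (auto simp: orth_def)

lemma orth_UNIV: "orth UNIV = {0}"
  using nondegenerate by (auto simp: orth_def)

section \<open>Dimensions of orthogonal complements\<close>

lemma dim_inter_perp:
  assumes "subspace S" "b \<in> S" "\<xi> b a \<noteq> 0"
  shows "dim S = dim (S \<inter> orth {a}) + 1"
proof -
  have T: "subspace (S \<inter> orth {a})" using assms(1) by (intro subspace_inter) auto
  have "b \<notin> S \<inter> orth {a}" using assms(3) by (simp add: orth_singleton)
  then have "dim (insert b (S \<inter> orth {a})) = dim (S \<inter> orth {a}) + 1"
    using T by (simp add: dim_insert)
  moreover have "span (insert b (S \<inter> orth {a})) = S"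
  proof (rule span_subspace)
    show "insert b (S \<inter> orth {a}) \<subseteq> S" using assms by auto
    show "S \<subseteq> span (insert b (S \<inter> orth {a}))"
    proof
      fix x assume x: "x \<in> S"
      have "x - scale (\<xi> x a / \<xi> b a) b \<in> S \<inter> orth {a}"
        using x assms by (auto simp: orth_singleton xi_simps subspace_diff subspace_scale)
      then show "x \<in> span (insert b (S \<inter> orth {a}))"
        unfolding span_breakdown_eq using span_base by blast
    qed
  qed (rule assms(1))
  ultimately show ?thesis by (metis dim_span)
qed

lemma dim_inter_perp_le:
  assumes "subspace S"
  shows "dim S \<le> dim (S \<inter> orth {a}) + 1"
proof (cases "S \<subseteq> orth {a}")
  case True
  then show ?thesis by (simp add: Int_absorb2)
next
  case False
  then obtain b where "b \<in> S" "b \<notin> orth {a}" by blast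
  then have "b \<in> S" "\<xi> b a \<noteq> 0" by (simp_all add: orth_singleton)
  then show ?thesis using dim_inter_perp[OF assms] by simp
qed

lemma dim_inter_orth_le:
  assumes "finite B" "subspace S"
  shows "dim S \<le> dim (S \<inter> orth B) + card B"
  using assms
proof (induction B)
  case empty
  then show ?case by (simp add: orth_def)
next
  case (insert b B)
  have "S \<inter> orth (insert b B) = (S \<inter> orth B) \<inter> orth {b}" by (auto simp: orth_def)
  moreover have "dim (S \<inter> orth B) \<le> dim ((S \<inter> orth B) \<inter> orth {b}) + 1"
    using insert.prems by (intro dim_inter_perp_le subspace_inter) auto
  ultimately show ?case using insert by simp
qed

lemma dim_UNIV': "dim (UNIV :: 'v set) = dimension"
  by (simp add: dimension_def)

text \<open>A basis of \<open>U\<close> imposes at most \<open>dim U\<close> linear conditions,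
  which bounds the complement from below. The remaining vectors of a basis of the whole space cut
  \<open>orth U\<close> down to 0, which bounds it from above.\<close>

lemma dim_orth:
  assumes "subspace U"
  shows "dim U + dim (orth U) = dimension"
proof -
  obtain B where B: "B \<subseteq> U" "independent B" "U \<subseteq> span B" "card B = dim U"
    using basis_exists by blast
  have span_B: "span B = U" using span_subspace[OF B(1,3) assms] .
  have fin: "finite B" using B(2) by (rule finiteI_independent)
  have "orth B = orth U" using orth_span[of B] span_B by simp
  then have 1: "dimension \<le> dim (orth U) + dim U"
    using dim_inter_orth_le[OF fin subspace_UNIV] B(4) by (simp add: dimension_def)
  obtain B' where B': "B \<subseteq> B'" "independent B'" "UNIV \<subseteq> span B'"
    by (rule maximal_independent_subset_extend[OF subset_UNIV B(2)])
  have fin': "finite B'" using B'(2) by (rule finiteI_independent)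
  have card': "card B' = dimension"
    using basis_card_eq_dim[OF subset_UNIV B'(3,2)] dim_UNIV' by simp
  have "orth U \<inter> orth (B' - B) = orth B'"
    unfolding span_B[symmetric] orth_span orth_Un[symmetric] using B'(1) by (simp add: Un_absorb1)
  also have "\<dots> = {0}" using B'(3) orth_span[of B'] orth_UNIV by (simp add: top.extremum_unique)
  finally have "dim (orth U \<inter> orth (B' - B)) = 0" by simp
  then have "dim (orth U) \<le> card (B' - B)"
    using dim_inter_orth_le[OF finite_Diff[OF fin'] subspace_orth, of U B] by (simp only: add_0)
  also have "\<dots> = dimension - dim U"
    using B'(1) fin card' B(4) by (simp add: card_Diff_subset)
  finally show ?thesis using 1 dim_subset_UNIV[of U] by simp
qed

lemma orth_orth [simp]:
  assumes "subspace U"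
  shows "orth (orth U) = U"
proof (rule sym, rule subspace_dim_equal)
  show "U \<subseteq> orth (orth U)" by (rule subset_orth_orth)
  show "dim (orth (orth U)) \<le> dim U"
    using dim_orth[OF assms] dim_orth[of "orth U"] by simp
qed (use assms in auto)

lemma orth_subset_iff: "subspace U \<Longrightarrow> subspace W \<Longrightarrow> orth U \<subseteq> orth W \<longleftrightarrow> W \<subseteq> U"
  by (metis orth_antimono orth_orth)

lemma orth_eq_iff: "subspace U \<Longrightarrow> subspace W \<Longrightarrow> orth U = orth W \<longleftrightarrow> U = W"
  by (metis orth_orth)

section \<open>Joins and one-dimensional extensions\<close>

definition join :: "'v set \<Rightarrow> 'v set \<Rightarrow> 'v set" where
  "join U W = span (U \<union> W)"

lemma subspace_join [simp, intro]: "subspace (join U W)"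
  by (simp add: join_def)

lemma join_upper: "U \<subseteq> join U W" "W \<subseteq> join U W"
  using span_superset[of "U \<union> W"] by (auto simp: join_def)

lemma join_least: "U \<subseteq> X \<Longrightarrow> W \<subseteq> X \<Longrightarrow> subspace X \<Longrightarrow> join U W \<subseteq> X"
  unfolding join_def by (rule span_minimal) auto

lemma join_commute: "join U W = join W U"
  by (simp add: join_def Un_commute)

lemma join_subset_iff: "subspace X \<Longrightarrow> join U W \<subseteq> X \<longleftrightarrow> U \<subseteq> X \<and> W \<subseteq> X"
  using join_least[of U X W] subset_trans[OF join_upper(1)[of U W]] subset_trans[OF join_upper(2)[of W U]]
  by metis

lemma dim_join:
  assumes "subspace U" "subspace W"
  shows "dim (join U W) + dim (U \<inter> W) = dim U + dim W"
  using dim_sums_Int[OF assms] span_Un[of U W] assms by (simp add: join_def)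

lemma orth_join: "orth (join U W) = orth U \<inter> orth W"
  by (simp add: join_def orth_Un)

lemma orth_inter: "subspace U \<Longrightarrow> subspace W \<Longrightarrow> orth (U \<inter> W) = join (orth U) (orth W)"
  by (metis orth_join orth_orth subspace_join)

definition ext :: "'v set \<Rightarrow> 'v \<Rightarrow> 'v set" where
  "ext H x = span (insert x H)"

lemma subspace_ext [simp, intro]: "subspace (ext H x)"
  by (simp add: ext_def)

lemma ext_iff: "subspace H \<Longrightarrow> v \<in> ext H x \<longleftrightarrow> (\<exists>c. v - scale c x \<in> H)"
  by (simp add: ext_def span_breakdown_eq)

lemma extE:
  assumes "subspace H" "v \<in> ext H x"
  obtains h c where "h \<in> H" "v = h + scale c x"
  using assms ext_iff[of H v x] by (metis diff_add_cancel)

lemma ext_upper: "H \<subseteq> ext H x" "x \<in> ext H x"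
  using span_superset[of "insert x H"] by (auto simp: ext_def)

lemma ext_least: "H \<subseteq> X \<Longrightarrow> x \<in> X \<Longrightarrow> subspace X \<Longrightarrow> ext H x \<subseteq> X"
  unfolding ext_def by (rule span_minimal) auto

lemma dim_ext: "subspace H \<Longrightarrow> x \<notin> H \<Longrightarrow> dim (ext H x) = dim H + 1"
  by (simp add: ext_def dim_insert)

lemma ext_eqI:
  assumes "subspace H" "subspace U" "H \<subseteq> U" "x \<in> U" "x \<notin> H" "dim U \<le> dim H + 1"
  shows "U = ext H x"
  using assms by (intro subspace_dim_equal[symmetric] ext_least) (simp_all add: dim_ext)

text \<open>Valid over every field, however small; it supplies vectors off two hyperplanes at
  once.\<close>

lemma not_covered_by_two_subspaces:
  assumes "subspace A" "subspace B" "subspace S" "\<not> S \<subseteq> A" "\<not> S \<subseteq> B"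
  obtains x where "x \<in> S" "x \<notin> A" "x \<notin> B"
proof -
  obtain a b where ab: "a \<in> S" "a \<notin> A" "b \<in> S" "b \<notin> B" using assms by blast
  show thesis
  proof (cases "a \<in> B \<and> b \<in> A")
    case True
    have "a + b \<notin> A" using True ab(2) assms(1) by (metis add_diff_cancel_right' subspace_diff)
    moreover have "a + b \<notin> B" using True ab(4) assms(2) by (metis add_diff_cancel_left' subspace_diff)
    ultimately show thesis using that ab assms(3) subspace_add by blast
  qed (use that ab in blast)
qed

section \<open>Radicals\<close>

lemma subspace_Rad [simp]: "subspace U \<Longrightarrow> subspace (Rad U)"
  unfolding Rad_def by (intro subspace_inter) auto

lemma Rad_iff: "x \<in> Rad U \<longleftrightarrow> x \<in> U \<and> (\<forall>w\<in>U. \<xi> x w = 0)"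
  by (simp add: Rad_def orth_def)

lemma Rad_orth: "subspace U \<Longrightarrow> Rad (orth U) = Rad U"
  by (auto simp: Rad_def)

lemma regular_iff_dim: "subspace U \<Longrightarrow> regular U \<longleftrightarrow> rdim U = 0"
  using subspace_0[OF subspace_Rad, of U] by (auto simp: regular_def rdim_def)

lemma regular_decomp:
  assumes "subspace H" "Rad H = {0}"
  obtains h v' where "h \<in> H" "v' \<in> orth H" "v = h + v'"
proof -
  have "dim (join H (orth H)) = dimension"
    using dim_join[OF assms(1) subspace_orth, of H] dim_orth[OF assms(1)] assms(2)
    by (simp add: Rad_def)
  then have "join H (orth H) = UNIV" using dim_eq_full[of "join H (orth H)"] by (simp add: join_def span_span)
  then have "v \<in> span (H \<union> orth H)" by (simp add: join_def)
  then obtain x y where "v = x + y" "x \<in> span H" "y \<in> span (orth H)" unfolding span_Un by blast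
  then show thesis using that assms(1) by simp
qed

text \<open>Induction: a hyperbolic plane spanned by \<open>u\<close> and \<open>w\<close> is split
  off, which lowers the dimension by 2 and keeps the radical.\<close>

lemma even_rdim:
  assumes "subspace U"
  shows "even (rdim U) \<longleftrightarrow> even (dim U)"
  using assms
proof (induction "dim U" arbitrary: U rule: less_induct)
  case less
  show ?case
  proof (cases "U \<subseteq> orth U")
    case True
    then show ?thesis by (simp add: rdim_def Rad_def Int_absorb2)
  next
    case False
    then obtain u w where uw: "u \<in> U" "w \<in> U" "\<xi> u w \<noteq> 0" by (auto simp: orth_def)
    have wu: "\<xi> w u \<noteq> 0" using uw(3) xi_eq_0_sym by blast
    define U1 where "U1 = U \<inter> orth {u}"
    define U2 where "U2 = U1 \<inter> orth {w}"
    have s1: "subspace U1" unfolding U1_def using less.prems by (intro subspace_inter) auto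
    have s2: "subspace U2" unfolding U2_def using s1 by (intro subspace_inter) auto
    have d1: "dim U = dim U1 + 1" unfolding U1_def by (rule dim_inter_perp[OF less.prems uw(2) wu])
    have u1: "u \<in> U1" using uw by (simp add: U1_def orth_singleton alternating)
    have d2: "dim U1 = dim U2 + 1" unfolding U2_def by (rule dim_inter_perp[OF s1 u1 uw(3)])
    have "Rad U2 = Rad U"
    proof
      show "Rad U \<subseteq> Rad U2" using uw by (auto simp: Rad_iff U1_def U2_def orth_singleton)
      show "Rad U2 \<subseteq> Rad U"
      proof
        fix x assume x: "x \<in> Rad U2"
        have x2: "x \<in> U" "\<xi> x u = 0" "\<xi> x w = 0" using x by (auto simp: Rad_iff U1_def U2_def orth_singleton)
        have "\<xi> x y = 0" if y: "y \<in> U" for y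
        proof -
          \<comment> \<open>The component of \<open>y\<close> orthogonal to the plane of
            \<open>u\<close> and \<open>w\<close>.\<close>
          define y' where "y' = y - scale (\<xi> y w / \<xi> u w) u - scale (\<xi> y u / \<xi> w u) w"
          have "y' \<in> U2"
            using y uw wu less.prems
            by (auto simp: y'_def U1_def U2_def orth_singleton xi_simps intro!: subspace_diff subspace_scale)
          then have "\<xi> x y' = 0" using x by (simp add: Rad_iff)
          then show ?thesis using x2 by (simp add: y'_def xi_simps)
        qed
        then show "x \<in> Rad U" using x2(1) by (simp add: Rad_iff)
      qed
    qed
    then have "rdim U2 = rdim U" by (simp add: rdim_def)
    then show ?thesis using less.hyps[of U2] s2 d1 d2 by simp
  qed
qed

text \<open>A vector of \<open>Rad H\<close> orthogonal to one more vector of \<open>U\<close> lies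
  in \<open>Rad U\<close>, and \<open>Rad U\<close> meets \<open>H\<close> inside
  \<open>Rad H\<close>; each costs at most one dimension.\<close>

lemma rdim_hyperplane:
  assumes "subspace H" "subspace U" "H \<subseteq> U" "dim U = dim H + 1"
  shows "rdim H \<le> rdim U + 1" "rdim U \<le> rdim H + 1"
proof -
  obtain a where a: "a \<in> U" "a \<notin> H" using assms by (metis Suc_eq_plus1 n_not_Suc_n subsetI subset_antisym)
  have U: "U = ext H a" using assms a by (intro ext_eqI) auto
  have "Rad H \<inter> orth {a} \<subseteq> Rad U"
  proof
    fix x assume x: "x \<in> Rad H \<inter> orth {a}"
    have "\<xi> x y = 0" if y: "y \<in> U" for y
      using y unfolding U by (rule extE[OF assms(1)]) (use x in \<open>auto simp: Rad_iff orth_singleton xi_simps\<close>)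
    then show "x \<in> Rad U" using x assms(3) by (auto simp: Rad_iff)
  qed
  then have "dim (Rad H \<inter> orth {a}) \<le> dim (Rad U)" by (rule dim_subset)
  then show "rdim H \<le> rdim U + 1"
    using dim_inter_perp_le[OF subspace_Rad[OF assms(1)], of a] by (simp add: rdim_def)
  have "Rad U \<subseteq> U" by (auto simp: Rad_def)
  then have "dim (join (Rad U) H) \<le> dim H + 1"
    using assms join_least[of "Rad U" U H] dim_subset by (metis)
  moreover have "dim (join (Rad U) H) + dim (Rad U \<inter> H) = dim (Rad U) + dim H"
    using assms by (intro dim_join) auto
  moreover have "dim (Rad U \<inter> H) \<le> dim (Rad H)"
    using assms(3) by (intro dim_subset) (auto simp: Rad_iff subset_iff)
  ultimately show "rdim U \<le> rdim H + 1" by (simp add: rdim_def)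
qed

section \<open>The families \<open>TR k\<close>\<close>

lemma TR_D: "U \<in> TR k \<Longrightarrow> subspace U" "U \<in> TR k \<Longrightarrow> dim U = k" "U \<in> TR k \<Longrightarrow> rdim U \<le> 1"
  by (auto simp: TR_def)

text \<open>An even radical dimension bounded by 1 is 0; in \<open>TR_odd_Rad\<close>, an odd one is
  1.\<close>

lemma TR_even: "even k \<Longrightarrow> U \<in> TR k \<longleftrightarrow> subspace U \<and> dim U = k \<and> Rad U = {0}"
proof -
  assume "even k"
  have "rdim U \<le> 1 \<longleftrightarrow> rdim U = 0" if "subspace U" "dim U = k"
    using even_rdim[OF that(1)] that(2) \<open>even k\<close> by (auto simp: le_Suc_eq)
  moreover have "rdim U = 0 \<longleftrightarrow> Rad U = {0}" if "subspace U"
    using regular_iff_dim[OF that] that by (simp add: regular_def)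
  ultimately show ?thesis by (auto simp: TR_def)
qed

lemma Regular_eq_TR: "even k \<Longrightarrow> Regular k = TR k"
  using TR_even[of k] by (auto simp: Regular_def regular_def)

lemma TR_odd_Rad:
  assumes "odd k" "U \<in> TR k"
  obtains r where "r \<noteq> 0" "Rad U = span {r}" "r \<in> U" "\<And>w. w \<in> U \<Longrightarrow> \<xi> r w = 0"
proof -
  have s: "subspace (Rad U)" using assms TR_D by auto
  have "odd (rdim U)" using even_rdim[OF TR_D(1)[OF assms(2)]] TR_D(2)[OF assms(2)] assms(1) by simp
  then have "rdim U = 1" using TR_D(3)[OF assms(2)] by (auto simp: le_Suc_eq)
  then have d: "dim (Rad U) = 1" by (simp add: rdim_def)
  then obtain r where r: "r \<in> Rad U" "r \<noteq> 0" using s by (metis dim_eq_0 subsetI singleton_iff zero_neq_one)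
  have "span {r} = Rad U"
    using r d s by (intro subspace_dim_equal span_minimal) auto
  then show thesis using that r by (metis Rad_iff)
qed

lemma TR_orth: "U \<in> TR k \<Longrightarrow> orth U \<in> TR (dimension - k)"
  using dim_orth[of U] by (auto simp: TR_def rdim_def Rad_orth)

lemma TR_dim_le: "U \<in> TR k \<Longrightarrow> k \<le> dimension"
  using dim_subset_UNIV[of U] by (auto simp: TR_def)

lemma even_dimension: "even dimension"
proof -
  have "Rad UNIV = {0}" by (auto simp: Rad_def orth_UNIV)
  then show ?thesis using even_rdim[OF subspace_UNIV] dim_UNIV' by (simp add: rdim_def)
qed

lemma orth_TR_image: "k \<le> dimension \<Longrightarrow> orth ` TR k = TR (dimension - k)"
proof
  assume k: "k \<le> dimension"
  show "TR (dimension - k) \<subseteq> orth ` TR k"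
  proof
    fix W assume W: "W \<in> TR (dimension - k)"
    then have "orth W \<in> TR k" using TR_orth[OF W] k by simp
    then show "W \<in> orth ` TR k" using TR_D(1)[OF W] by (metis imageI orth_orth)
  qed
qed (auto intro: TR_orth)

section \<open>Adjacency\<close>

lemma TR_eqI: "U \<in> TR k \<Longrightarrow> W \<in> TR k \<Longrightarrow> U \<subseteq> W \<Longrightarrow> U = W"
  using subspace_dim_equal[of U W] by (simp add: TR_def)

lemma dim_Int_less:
  assumes "U \<in> TR k" "W \<in> TR k" "U \<noteq> W"
  shows "dim (U \<inter> W) < k"
proof (rule ccontr)
  assume a: "\<not> dim (U \<inter> W) < k"
  have s: "subspace (U \<inter> W)" using TR_D(1)[OF assms(1)] TR_D(1)[OF assms(2)] by (rule subspace_inter)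
  have "U \<inter> W = U"
    by (rule subspace_dim_equal[OF s TR_D(1)[OF assms(1)]]) (use a TR_D(2)[OF assms(1)] in auto)
  moreover have "U \<inter> W = W"
    by (rule subspace_dim_equal[OF s TR_D(1)[OF assms(2)]]) (use a TR_D(2)[OF assms(2)] in auto)
  ultimately show False using assms(3) by blast
qed

lemma Int_eqI:
  assumes "U \<in> TR k" "W \<in> TR k" "U \<noteq> W" "subspace H" "H \<subseteq> U" "H \<subseteq> W" "k \<le> dim H + 1"
  shows "U \<inter> W = H"
  using assms dim_Int_less[OF assms(1-3)] TR_D(1)
  by (intro subspace_dim_equal[symmetric] subspace_inter) auto

lemma dim_Int_join:
  assumes "U \<in> TR k" "W \<in> TR k" "U \<noteq> W" "subspace H" "H \<subseteq> U" "H \<subseteq> W" "k = dim H + 1"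
  shows "dim (join U W) = k + 1"
  using dim_join[of U W] Int_eqI[OF assms(1-6)] TR_D assms by simp

lemma join_eqI:
  assumes "U \<in> TR k" "W \<in> TR k" "U \<noteq> W" "subspace B" "U \<subseteq> B" "W \<subseteq> B" "dim B \<le> k + 1"
  shows "join U W = B"
proof (rule subspace_dim_equal)
  show "join U W \<subseteq> B" using assms by (simp add: join_least)
  have "dim (join U W) + dim (U \<inter> W) = k + k"
    using dim_join[of U W] assms(1,2) TR_D by simp
  then show "dim B \<le> dim (join U W)" using dim_Int_less[OF assms(1-3)] assms(7) by simp
qed (use assms in auto)

lemma adjI:
  assumes "1 \<le> k" "U \<in> TR k" "W \<in> TR k" "U \<noteq> W" "H \<in> TR (k - 1)" "B \<in> TR (k + 1)"
    "H \<subseteq> U" "H \<subseteq> W" "U \<subseteq> B" "W \<subseteq> B"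
  shows "adjacent k U W"
proof -
  have "H \<noteq> U" "H \<noteq> W" "U \<noteq> B" "W \<noteq> B"
    using TR_D(2)[OF assms(2)] TR_D(2)[OF assms(3)] TR_D(2)[OF assms(5)] TR_D(2)[OF assms(6)] assms(1)
    by auto
  then have "U \<in> pencil k H B" "W \<in> pencil k H B" "H \<subset> B" using assms by (auto simp: pencil_def)
  moreover from this have "pencil k H B \<in> pencils k" using assms(5,6) unfolding pencils_def by blast
  ultimately show ?thesis using assms(4) unfolding adjacent_def by blast
qed

text \<open>For dimension reasons the pencil through two different elements can only be the one
  given by their intersection and their join. Adjacency is thus a condition on these two
  spaces.\<close>

lemma adjD:
  assumes "adjacent k U W" "1 \<le> k"
  shows "U \<in> TR k" "W \<in> TR k" "U \<noteq> W" "U \<inter> W \<in> TR (k - 1)" "join U W \<in> TR (k + 1)"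
proof -
  obtain H B where HB: "H \<in> TR (k - 1)" "B \<in> TR (k + 1)" "U \<in> TR k" "W \<in> TR k" "U \<noteq> W"
    "H \<subseteq> U" "H \<subseteq> W" "U \<subseteq> B" "W \<subseteq> B"
    using assms(1) unfolding adjacent_def pencils_def pencil_def by blast
  then show "U \<in> TR k" "W \<in> TR k" "U \<noteq> W" by blast+
  have "U \<inter> W = H"
    by (rule Int_eqI[OF HB(3-5) TR_D(1)[OF HB(1)] HB(6,7)]) (use TR_D(2)[OF HB(1)] in simp)
  then show "U \<inter> W \<in> TR (k - 1)" using HB by simp
  have "join U W = B"
    by (rule join_eqI[OF HB(3-5) TR_D(1)[OF HB(2)] HB(8,9)]) (use TR_D(2)[OF HB(2)] in simp)
  then show "join U W \<in> TR (k + 1)" using HB by simp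
qed

lemma adj_sym: "adjacent k U W \<Longrightarrow> adjacent k W U"
  unfolding adjacent_def by blast

lemma adj_irrefl: "\<not> adjacent k U U"
  unfolding adjacent_def by blast

text \<open>Complements exchange intersection and join and keep radicals. This is the duality that
  carries every statement on stars over to tops.\<close>

lemma adj_orth:
  assumes "adjacent k U W" "1 \<le> k"
  shows "adjacent (dimension - k) (orth U) (orth W)"
proof -
  note a = adjD[OF assms]
  have k: "k + 1 \<le> dimension" using TR_dim_le[OF a(5)] .
  show ?thesis
  proof (rule adjI)
    show "orth (join U W) \<in> TR (dimension - k - 1)" using TR_orth[OF a(5)] by simp
    show "orth (U \<inter> W) \<in> TR (dimension - k + 1)"
      using TR_orth[OF a(4)] assms(2) k by (simp add: Suc_diff_Suc Suc_diff_le)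
    show "orth U \<noteq> orth W" using a TR_D(1) by (metis orth_orth)
    show "orth (join U W) \<subseteq> orth U" "orth (join U W) \<subseteq> orth W" by (simp_all add: orth_join)
    show "orth U \<subseteq> orth (U \<inter> W)" "orth W \<subseteq> orth (U \<inter> W)" by (simp_all add: orth_antimono)
    show "1 \<le> dimension - k" using k by simp
  qed (use a TR_orth in simp_all)
qed

lemma adj_orth_iff:
  assumes "subspace U" "subspace W" "1 \<le> k" "k + 1 \<le> dimension"
  shows "adjacent (dimension - k) (orth U) (orth W) \<longleftrightarrow> adjacent k U W"
  using adj_orth[of k U W] adj_orth[of "dimension - k" "orth U" "orth W"] assms by auto

text \<open>Below and above a regular space the radical dimension changes by at most 1 per
  dimension, so \<open>H\<close> and the join belong to \<open>TR\<close> automatically.\<close>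

lemma adj_even:
  assumes "even k" "1 \<le> k" "U \<in> TR k" "W \<in> TR k" "U \<noteq> W" "subspace H" "H \<subseteq> U" "H \<subseteq> W" "k = dim H + 1"
  shows "adjacent k U W"
proof (rule adjI)
  have r: "rdim U = 0" using assms(1,3) by (simp add: TR_even rdim_def)
  have s: "subspace U" "dim U = k" using TR_D[OF assms(3)] by simp_all
  have "rdim H \<le> 1" using rdim_hyperplane(1)[OF assms(6) s(1) assms(7)] s(2) assms(9) r by simp
  then show "H \<in> TR (k - 1)" using assms(6,9) by (simp add: TR_def)
  have d: "dim (join U W) = k + 1" by (rule dim_Int_join[OF assms(3-9)])
  have "rdim (join U W) \<le> 1"
    using rdim_hyperplane(2)[OF s(1) subspace_join join_upper(1), of W] d s(2) r by simp
  then show "join U W \<in> TR (k + 1)" using d by (simp add: TR_def)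
qed (use assms(2-5,7,8) join_upper in simp_all)

text \<open>If \<open>X\<close> misses part of \<open>U \<inter> W\<close>, its intersections with
  \<open>U\<close> and \<open>W\<close> are different hyperplanes of \<open>X\<close>, and these
  span \<open>X\<close> inside \<open>join U W\<close>.\<close>

lemma adj_three:
  assumes "1 \<le> k" "adjacent k U W" "adjacent k X U" "adjacent k X W"
  shows "U \<inter> W \<subseteq> X \<or> X \<subseteq> join U W"
proof (rule ccontr)
  assume not: "\<not> (U \<inter> W \<subseteq> X \<or> X \<subseteq> join U W)"
  note UW = adjD[OF assms(2,1)] and XU = adjD[OF assms(3,1)] and XW = adjD[OF assms(4,1)]
  have "\<not> X \<inter> U \<subseteq> X \<inter> W"
  proof
    assume "X \<inter> U \<subseteq> X \<inter> W"
    then have "X \<inter> U \<subseteq> U \<inter> W" by blast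
    then have "X \<inter> U = U \<inter> W" by (rule TR_eqI[OF XU(4) UW(4)])
    then show False using not by blast
  qed
  then obtain a where a: "a \<in> X" "a \<in> U" "a \<notin> X \<inter> W" by blast
  have "X = ext (X \<inter> W) a" using a XW TR_D XU by (intro ext_eqI) auto
  moreover have "ext (X \<inter> W) a \<subseteq> join U W"
    using a join_upper(1)[of U W] join_upper(2)[of W U] by (intro ext_least) auto
  ultimately show False using not by blast
qed

lemma regular_inter_orth: "Rad H = {0} \<Longrightarrow> x \<in> H \<Longrightarrow> x \<in> orth H \<Longrightarrow> x = 0"
  by (auto simp: Rad_def)

subsection \<open>Stars in odd dimension\<close>

text \<open>For odd \<open>k\<close> the star of a regular \<open>(k - 1)\<close>-space \<open>H\<close> is the set of points of the symplectic
  space \<open>orth H\<close>, with non-orthogonality as adjacency.\<close>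

lemma odd_regular: "odd k \<Longrightarrow> H \<in> TR (k - 1) \<Longrightarrow> Rad H = {0}"
  using TR_even[of "k - 1" H] by simp

lemma odd_ext:
  assumes "odd k" "H \<in> TR (k - 1)" "u \<in> orth H" "u \<noteq> 0"
  shows "ext H u \<in> TR k"
proof -
  have s: "subspace H" "dim H = k - 1" using assms(2) TR_D by auto
  have "u \<notin> H" using regular_inter_orth[OF odd_regular[OF assms(1,2)]] assms by blast
  then have d: "dim (ext H u) = k" using s assms(1) by (simp add: dim_ext)
  moreover have "rdim H = 0" using odd_regular[OF assms(1,2)] by (simp add: rdim_def)
  ultimately show ?thesis
    using rdim_hyperplane(2)[OF s(1) subspace_ext ext_upper(1), of u] s assms(1) by (simp add: TR_def)
qed

text \<open>The regular \<open>H\<close> is an orthogonal summand of the whole space; the component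
  in \<open>orth H\<close> of a vector of \<open>Y\<close> outside \<open>H\<close> is the required
  \<open>y\<close>. By \<open>odd_ext_eq\<close> it is unique up to a scalar.\<close>

lemma odd_star:
  assumes "odd k" "H \<in> TR (k - 1)" "Y \<in> TR k" "H \<subseteq> Y"
  obtains y where "y \<in> orth H" "y \<noteq> 0" "Y = ext H y"
proof -
  have s: "subspace H" "dim H = k - 1" "subspace Y" "dim Y = k" using assms(2,3) TR_D by auto
  have "\<not> Y \<subseteq> H" using dim_subset[of Y H] s assms(1) by (cases k) auto
  then obtain v where v: "v \<in> Y" "v \<notin> H" by blast
  obtain h y where hy: "h \<in> H" "y \<in> orth H" "v = h + y"
    using regular_decomp[OF s(1) odd_regular[OF assms(1,2)]] .
  have "y = v - h" using hy(3) by simp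
  then have "y \<in> Y" using v hy(1) assms(4) s subspace_diff by blast
  moreover have "y \<notin> H" using v hy(1,3) s subspace_add by blast
  ultimately have "Y = ext H y" using s assms(4) by (intro ext_eqI) auto
  moreover have "y \<noteq> 0" using \<open>y \<notin> H\<close> s(1) subspace_0 by blast
  ultimately show thesis using that hy(2) by blast
qed

lemma odd_ext_eq:
  assumes "odd k" "H \<in> TR (k - 1)" "u \<in> orth H" "w \<in> orth H" "w \<in> ext H u"
  obtains c where "w = scale c u"
proof -
  have s: "subspace H" using assms(2) TR_D by auto
  obtain h c where hc: "h \<in> H" "w = h + scale c u" using extE[OF s assms(5)] .
  then have "h = w - scale c u" by simp
  then have "h \<in> orth H" using assms(3,4) subspace_diff[OF subspace_orth] subspace_scale[OF subspace_orth] by metis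
  then have "h = 0" using regular_inter_orth[OF odd_regular[OF assms(1,2)] hc(1)] by blast
  then show thesis using that[of c] hc by simp
qed

text \<open>The join is the orthogonal sum of \<open>H\<close> and the span of \<open>u\<close> and
  \<open>w\<close>, hence regular exactly if this span is a hyperbolic plane.\<close>

lemma odd_adj:
  assumes "odd k" "H \<in> TR (k - 1)" "u \<in> orth H" "u \<noteq> 0" "w \<in> orth H" "w \<noteq> 0"
  shows "adjacent k (ext H u) (ext H w) \<longleftrightarrow> \<xi> u w \<noteq> 0"
proof
  have s: "subspace H" "dim H = k - 1" using assms(2) TR_D by auto
  have k: "1 \<le> k" using assms(1) by (cases k) auto
  note R = odd_regular[OF assms(1,2)]
  {
    assume a: "\<xi> u w \<noteq> 0"
    then have "\<not> (\<exists>c. w = scale c u)" by (auto simp: xi_simps)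
    then have ne: "w \<notin> ext H u" using odd_ext_eq[OF assms(1-3,5)] by blast
    let ?B = "ext (ext H u) w"
    have "Rad ?B = {0}"
    proof -
      have "x = 0" if x: "x \<in> Rad ?B" for x
      proof -
        have "x \<in> ?B" using x by (simp add: Rad_iff)
        then obtain b c where b: "b \<in> ext H u" "x = b + scale c w" using extE[OF subspace_ext] by metis
        obtain h d where h: "h \<in> H" "b = h + scale d u" using extE[OF s(1) b(1)] .
        have "u \<in> ?B" "w \<in> ?B" "H \<subseteq> ?B" using ext_upper by blast+
        then have x0: "\<xi> x u = 0" "\<xi> x w = 0" "\<And>y. y \<in> H \<Longrightarrow> \<xi> x y = 0" using x by (auto simp: Rad_iff)
        have hu: "\<xi> h u = 0" "\<xi> h w = 0" using h(1) assms orthD' by auto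
        have wu: "\<xi> w u \<noteq> 0" using a xi_eq_0_sym by blast
        have "c = 0" using x0(1) b h hu wu by (simp add: xi_simps)
        moreover have "d = 0" using x0(2) b h hu a by (simp add: xi_simps)
        ultimately have "x = h" using b h by simp
        then have "x \<in> Rad H" using x0(3) h by (simp add: Rad_iff)
        then show ?thesis using R by simp
      qed
      moreover have "0 \<in> Rad ?B" by (intro subspace_0 subspace_Rad subspace_ext)
      ultimately show ?thesis by blast
    qed
    moreover have "dim ?B = k + 1"
      using ne odd_ext[OF assms(1-4)] TR_D by (simp add: dim_ext)
    ultimately have B: "?B \<in> TR (k + 1)" using TR_even[of "k + 1" ?B] assms(1) by simp
    have "ext H u \<subseteq> ?B" "w \<in> ?B" by (rule ext_upper)+
    moreover have "H \<subseteq> ext H u" "H \<subseteq> ext H w" "w \<in> ext H w" by (rule ext_upper)+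
    moreover from calculation have "ext H w \<subseteq> ?B" by (intro ext_least) auto
    ultimately show "adjacent k (ext H u) (ext H w)"
      using odd_ext[OF assms(1-4)] odd_ext[OF assms(1,2,5,6)] ne
      by (intro adjI[OF k _ _ _ assms(2) B]) auto
  }
  assume a: "adjacent k (ext H u) (ext H w)"
  let ?J = "join (ext H u) (ext H w)"
  have J: "?J \<in> TR (k + 1)" using adjD[OF a k] by blast
  then have RJ: "Rad ?J = {0}" using TR_even[of "k + 1"] assms(1) by simp
  show "\<xi> u w \<noteq> 0"
  proof
    assume uw: "\<xi> u w = 0"
    have "?J \<subseteq> orth {u}"
    proof (intro join_least ext_least)
      show "H \<subseteq> orth {u}" using assms(3) xi_eq_0_sym by (auto simp: orth_def)
      then show "H \<subseteq> orth {u}" .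
      show "u \<in> orth {u}" "w \<in> orth {u}" using uw xi_eq_0_sym by (auto simp: orth_def alternating)
    qed auto
    moreover have "u \<in> ?J" using ext_upper join_upper by blast
    ultimately have "u \<in> Rad ?J" using xi_eq_0_sym by (auto simp: Rad_iff orth_def)
    then show False using RJ assms(4) by simp
  qed
qed

subsection \<open>Stars in even dimension\<close>

text \<open>Pairing a radical vector of \<open>ext H y\<close> with \<open>h\<close> kills its
  \<open>y\<close>-component; it then lies in \<open>Rad H\<close>, and pairing with
  \<open>y\<close> kills it. With the converse \<open>even_Rad_nonorth\<close>, the star of
  \<open>H\<close> comes from the vectors off the hyperplane \<open>orth {h}\<close>.\<close>

lemma even_ext:
  assumes "even k" "1 \<le> k" "H \<in> TR (k - 1)" "Rad H = span {h}" "\<xi> h y \<noteq> 0"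
  shows "ext H y \<in> TR k" "y \<notin> H"
proof -
  have s: "subspace H" "dim H = k - 1" using assms(3) TR_D by auto
  have h: "h \<in> Rad H" using assms(4) span_base[of h "{h}"] by simp
  show y: "y \<notin> H" using h assms(5) by (auto simp: Rad_iff)
  have "x = 0" if x: "x \<in> Rad (ext H y)" for x
  proof -
    obtain h' c where h': "h' \<in> H" "x = h' + scale c y" using x extE[OF s(1)] by (metis Rad_iff)
    have "\<xi> x h = 0" using x h ext_upper(1)[of H y] by (auto simp: Rad_iff)
    moreover have "\<xi> h' h = 0" using h h'(1) xi_eq_0_sym by (auto simp: Rad_iff)
    moreover have "\<xi> y h \<noteq> 0" using assms(5) xi_eq_0_sym by blast
    ultimately have "c = 0" using h'(2) by (simp add: xi_simps)
    then have "x \<in> H" using h' by simp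
    then have "x \<in> Rad H" using x ext_upper(1)[of H y] by (auto simp: Rad_iff)
    then obtain d where d: "x = scale d h" unfolding assms(4) span_singleton by blast
    have "\<xi> x y = 0" using x ext_upper(2)[of y H] by (auto simp: Rad_iff)
    then have "d = 0" using d assms(5) by (simp add: xi_simps)
    then show ?thesis using d by simp
  qed
  then have "Rad (ext H y) = {0}" using subspace_0[OF subspace_Rad[OF subspace_ext]] by blast
  then show "ext H y \<in> TR k" using TR_even[OF assms(1)] dim_ext[OF s(1) y] s(2) assms(2) by simp
qed

lemma even_Rad_nonorth:
  assumes "even k" "H \<in> TR (k - 1)" "Rad H = span {h}" "U \<in> TR k" "H \<subseteq> U" "y \<in> U" "y \<notin> H" "h \<noteq> 0" "1 \<le> k"
  shows "\<xi> h y \<noteq> 0"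
proof
  assume 0: "\<xi> h y = 0"
  have s: "subspace H" "dim H = k - 1" "subspace U" "dim U = k" using assms TR_D by auto
  have h: "h \<in> Rad H" using assms(3) span_base[of h "{h}"] by simp
  have U: "U = ext H y" using s assms by (intro ext_eqI) auto
  have "U \<subseteq> orth {h}" unfolding U
    using h 0 xi_eq_0_sym by (intro ext_least subspace_orth) (auto simp: orth_singleton Rad_iff)
  then have "h \<in> Rad U" using h assms(5) xi_eq_0_sym by (auto simp: Rad_iff orth_def)
  then show False using assms(8) TR_even[OF assms(1)] assms(4) by simp
qed

lemma even_star_adj:
  assumes "even k" "1 \<le> k" "H \<in> TR (k - 1)" "U \<in> TR k" "W \<in> TR k" "H \<subseteq> U" "H \<subseteq> W" "U \<noteq> W"
  shows "adjacent k U W"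
  using assms TR_D[OF assms(3)] by (intro adj_even[of k U W H]) auto

subsection \<open>Existence of neighbours\<close>

lemma nonorth_exists:
  assumes "h \<noteq> 0"
  obtains y where "\<xi> h y \<noteq> 0"
  using nondegenerate assms by blast

lemma not_UNIV_subset_orth: "h \<noteq> 0 \<Longrightarrow> \<not> UNIV \<subseteq> orth {h}"
  using nonorth_exists[of h] orth_singleton xi_eq_0_sym by (metis UNIV_I subsetD)

lemma star_nonempty:
  assumes "H \<in> TR (k - 1)" "1 \<le> k" "k \<le> dimension"
  obtains U where "U \<in> TR k" "H \<subseteq> U"
proof (cases "even k")
  case True
  then have "odd (k - 1)" using assms(2) by simp
  then obtain h where h: "h \<noteq> 0" "Rad H = span {h}" using TR_odd_Rad assms(1) by metis
  obtain y where "\<xi> h y \<noteq> 0" using nonorth_exists[OF h(1)] .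
  then show thesis using that even_ext(1)[OF True assms(2,1) h(2)] ext_upper by blast
next
  case False
  have "dim (orth H) \<noteq> 0" using dim_orth[OF TR_D(1)[OF assms(1)]] TR_D(2)[OF assms(1)] assms by (simp del: dim_eq_0)
  then obtain u where u: "u \<in> orth H" "u \<noteq> 0" by (metis dim_eq_0 singletonI subsetI)
  then show thesis using that[OF odd_ext[OF False assms(1) u]] ext_upper by blast
qed

lemma star_neighbour:
  assumes "H \<in> TR (k - 1)" "U \<in> TR k" "H \<subseteq> U" "1 \<le> k" "k + 1 \<le> dimension"
  obtains W where "adjacent k U W" "H \<subseteq> W"
proof (cases "even k")
  case True
  then have "odd (k - 1)" using assms(4) by simp
  then obtain h where h: "h \<noteq> 0" "Rad H = span {h}" using TR_odd_Rad assms(1) by metis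
  obtain y where y: "y \<notin> orth {h}" "y \<notin> U"
  proof (rule not_covered_by_two_subspaces[OF subspace_orth TR_D(1)[OF assms(2)] subspace_UNIV])
    show "\<not> UNIV \<subseteq> orth {h}"
      by (rule not_UNIV_subset_orth[OF h(1)])
    show "\<not> UNIV \<subseteq> U" using dim_subset[of UNIV U] dim_UNIV' TR_D(2)[OF assms(2)] assms(5) by auto
  qed
  then have "\<xi> h y \<noteq> 0" using xi_eq_0_sym by (auto simp: orth_def)
  then have W: "ext H y \<in> TR k" by (rule even_ext(1)[OF True assms(4,1) h(2)])
  have "U \<noteq> ext H y" using y(2) ext_upper(2) by blast
  then have "adjacent k U (ext H y)"
    using W assms True ext_upper by (intro even_star_adj[where H=H]) auto
  then show thesis using that ext_upper by blast
next
  case False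
  obtain u where u: "u \<in> orth H" "u \<noteq> 0" "U = ext H u" using odd_star[OF False assms(1-3)] .
  have s: "subspace H" using TR_D assms(1) by auto
  have "u \<notin> orth (orth H)"
    using regular_inter_orth[OF odd_regular[OF False assms(1)]] u s by auto
  then obtain w where w: "w \<in> orth H" "\<xi> u w \<noteq> 0" by (auto simp: orth_iff[of u])
  then have "w \<noteq> 0" by auto
  then show thesis using that[of "ext H w"] odd_adj[OF False assms(1) u(1,2) w(1)] w u(3) ext_upper by blast
qed

lemma hyperplane_exists:
  assumes "U \<in> TR k" "1 \<le> k"
  obtains H where "H \<in> TR (k - 1)" "H \<subseteq> U"
proof -
  have s: "subspace U" "dim U = k" "rdim U \<le> 1" using assms TR_D by auto
  \<comment> \<open>For odd \<open>k\<close> this is a generator of the radical, and the hyperplane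
    cut out by \<open>y\<close> becomes a regular complement of it; for even \<open>k\<close> any
    nonzero vector will do.\<close>
  have "\<exists>r. r \<in> U \<and> r \<noteq> 0 \<and> Rad U \<subseteq> span {r}"
  proof (cases "even k")
    case True
    have "dim U \<noteq> 0" using s assms by simp
    then obtain r where "r \<in> U" "r \<noteq> 0" by (metis dim_eq_0 singletonI subsetI)
    then show ?thesis using TR_even[OF True] assms(1) span_zero by (metis empty_subsetI insert_subset)
  next
    case False
    then show ?thesis using TR_odd_Rad[OF False assms(1)] by (metis subset_refl)
  qed
  then obtain r where r: "r \<in> U" "r \<noteq> 0" "Rad U \<subseteq> span {r}" by blast
  obtain y where y: "\<xi> r y \<noteq> 0" using nonorth_exists[OF r(2)] .
  let ?H = "U \<inter> orth {y}"
  have H: "subspace ?H" using s by (intro subspace_inter) auto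
  have d: "dim U = dim ?H + 1" by (rule dim_inter_perp[OF s(1) r(1) y])
  have "Rad U \<inter> ?H \<subseteq> {0}"
  proof
    fix x assume x: "x \<in> Rad U \<inter> ?H"
    then obtain c where c: "x = scale c r" using r(3) span_singleton by blast
    then have "c = 0" using x y by (auto simp: orth_def xi_simps)
    then show "x \<in> {0}" using c by simp
  qed
  have "rdim ?H \<le> 1"
  proof (cases "even k")
    case True
    then have "rdim U = 0" using TR_even[OF True] assms(1) by (simp add: rdim_def)
    then show ?thesis using rdim_hyperplane(1)[OF H s(1) _ d] by auto
  next
    case False
    obtain r' where r': "r' \<noteq> 0" "Rad U = span {r'}" "r' \<in> U" "\<And>w. w \<in> U \<Longrightarrow> \<xi> r' w = 0"
      using TR_odd_Rad[OF False assms(1)] by blast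
    have "r' \<notin> ?H" using \<open>Rad U \<inter> ?H \<subseteq> {0}\<close> r' span_base[of r' "{r'}"] by auto
    then have U: "U = ext ?H r'" using H s d r' by (intro ext_eqI) auto
    have "Rad ?H \<subseteq> Rad U \<inter> ?H"
    proof
      fix x assume x: "x \<in> Rad ?H"
      have "ext ?H r' \<subseteq> orth {x}"
        using x r' xi_eq_0_sym by (intro ext_least subspace_orth) (auto simp: Rad_iff orth_singleton)
      then have "U \<subseteq> orth {x}" using U by simp
      then have "x \<in> Rad U" using x xi_eq_0_sym by (auto simp: Rad_iff orth_def)
      then show "x \<in> Rad U \<inter> ?H" using x by (simp add: Rad_iff)
    qed
    then have "Rad ?H \<subseteq> {0}" using \<open>Rad U \<inter> ?H \<subseteq> {0}\<close> by blast
    then have "dim (Rad ?H) = 0" by simp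
    then show ?thesis unfolding rdim_def by linarith
  qed
  then have "?H \<in> TR (k - 1)" using H d s by (simp add: TR_def)
  then show thesis using that by blast
qed

subsection \<open>Stars and lines\<close>

text \<open>Provides the star side of the opposite pair in \<open>coll\<close>. The bound
  \<open>k + 2 \<le> dimension\<close> leaves room outside the join.\<close>

lemma star_outside:
  assumes "adjacent k U W" "1 \<le> k" "k + 2 \<le> dimension"
  obtains Y where "adjacent k Y U" "adjacent k Y W" "U \<inter> W \<subseteq> Y" "\<not> Y \<subseteq> join U W"
proof -
  note a = adjD[OF assms(1,2)]
  define H where "H = U \<inter> W"
  define B where "B = join U W"
  have H: "H \<in> TR (k - 1)" "H \<subseteq> U" "H \<subseteq> W" using a by (auto simp: H_def)
  have B: "B \<in> TR (k + 1)" "U \<subseteq> B" "W \<subseteq> B" using a join_upper by (auto simp: B_def)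
  have sB: "subspace B" "dim B = k + 1" using B TR_D by auto
  have "\<exists>Y. adjacent k Y U \<and> adjacent k Y W \<and> H \<subseteq> Y \<and> \<not> Y \<subseteq> B"
  proof (cases "even k")
    case True
    then have "odd (k - 1)" using assms(2) by simp
    then obtain h where h: "h \<noteq> 0" "Rad H = span {h}" using TR_odd_Rad H(1) by metis
    obtain y where y: "y \<notin> orth {h}" "y \<notin> B"
    proof (rule not_covered_by_two_subspaces[OF subspace_orth sB(1) subspace_UNIV])
      show "\<not> UNIV \<subseteq> orth {h}"
        by (rule not_UNIV_subset_orth[OF h(1)])
      show "\<not> UNIV \<subseteq> B" using dim_subset[of UNIV B] dim_UNIV' sB assms(3) by auto
    qed
    then have "\<xi> h y \<noteq> 0" using xi_eq_0_sym by (auto simp: orth_def)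
    then have Y: "ext H y \<in> TR k" by (rule even_ext(1)[OF True assms(2) H(1) h(2)])
    have "\<not> ext H y \<subseteq> B" using y(2) ext_upper(2) by blast
    moreover from this have "ext H y \<noteq> U" "ext H y \<noteq> W" using B by auto
    ultimately show ?thesis
      using even_star_adj[OF True assms(2) H(1) Y a(1) ext_upper(1) H(2)]
        even_star_adj[OF True assms(2) H(1) Y a(2) ext_upper(1) H(3)] ext_upper(1)[of H y] by blast
  next
    case False
    obtain u where u: "u \<in> orth H" "u \<noteq> 0" "U = ext H u" using odd_star[OF False H(1) a(1) H(2)] .
    obtain w where w: "w \<in> orth H" "w \<noteq> 0" "W = ext H w" using odd_star[OF False H(1) a(2) H(3)] .
    have uw: "\<xi> u w \<noteq> 0" using odd_adj[OF False H(1) u(1,2) w(1,2)] assms(1) u w by simp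
    have wu: "\<xi> w u \<noteq> 0" using uw xi_eq_0_sym by blast
    have "dim (orth B) \<noteq> 0" using dim_orth[OF sB(1)] sB(2) assms(3) by (simp del: dim_eq_0)
    then obtain z where z: "z \<in> orth B" "z \<noteq> 0" by (metis dim_eq_0 singletonI subsetI)
    have uwB: "u \<in> B" "w \<in> B" "H \<subseteq> B" using u w B H ext_upper by blast+
    \<comment> \<open>The sum of \<open>u\<close> and \<open>w\<close> is non-orthogonal to both,
      and adding \<open>z\<close> from \<open>orth B\<close> leaves these values unchanged but moves
      the vector out of the regular space \<open>B\<close>.\<close>
    define y where "y = u + w + z"
    have zH: "z \<in> orth H" using z(1) orth_antimono[OF uwB(3)] by blast
    have yH: "y \<in> orth H" unfolding y_def using u w zH by (intro subspace_add) auto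
    have zu: "\<xi> z u = 0" "\<xi> z w = 0" using z(1) uwB orthD by auto
    have yu: "\<xi> y u \<noteq> 0" "\<xi> y w \<noteq> 0" using uw wu zu by (simp_all add: y_def xi_simps)
    then have y0: "y \<noteq> 0" by auto
    have "z \<notin> B" using regular_inter_orth[of B z] z odd_regular[of "k + 2"] B(1) False by auto
    have "y \<notin> B"
    proof
      assume "y \<in> B"
      then have "y - u - w \<in> B" using uwB sB(1) by (intro subspace_diff) auto
      then show False using \<open>z \<notin> B\<close> by (simp add: y_def)
    qed
    then have "\<not> ext H y \<subseteq> B" using ext_upper by blast
    then show ?thesis
      using odd_adj[OF False H(1) yH y0] u w yu ext_upper by blast
  qed
  then show thesis using that by (auto simp: H_def B_def)
qed

text \<open>This makes a wedge visible to adjacency. \<open>X\<close> itself may be orthogonal to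
  \<open>W\<close> inside the star, but then another point of the line through \<open>U\<close> and
  \<open>X\<close> is not.\<close>

lemma star_line_meets_neighbours:
  assumes "adjacent k U W" "adjacent k U X" "U \<inter> W = U \<inter> X" "join U W \<noteq> join U X" "1 \<le> k"
  obtains X' where "X' \<in> TR k" "U \<inter> X \<subseteq> X'" "X' \<subseteq> join U X" "X' \<noteq> U" "adjacent k X' W"
proof -
  note UW = adjD[OF assms(1,5)] and UX = adjD[OF assms(2,5)]
  define H where "H = U \<inter> X"
  have H: "H \<in> TR (k - 1)" "H \<subseteq> U" "H \<subseteq> X" "H \<subseteq> W" using UX assms(3) by (auto simp: H_def)
  have "\<exists>X'. X' \<in> TR k \<and> H \<subseteq> X' \<and> X' \<subseteq> join U X \<and> X' \<noteq> U \<and> adjacent k X' W"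
  proof (cases "even k")
    case True
    have "adjacent k X W" using assms(4) UW UX H by (intro even_star_adj[OF True assms(5) H(1)]) auto
    then show ?thesis using UX(2,3) H(3) join_upper by blast
  next
    case False
    obtain u where u: "u \<in> orth H" "u \<noteq> 0" "U = ext H u" using odd_star[OF False H(1) UX(1) H(2)] .
    obtain w where w: "w \<in> orth H" "w \<noteq> 0" "W = ext H w" using odd_star[OF False H(1) UW(2) H(4)] .
    obtain x where x: "x \<in> orth H" "x \<noteq> 0" "X = ext H x" using odd_star[OF False H(1) UX(2) H(3)] .
    have uw: "\<xi> u w \<noteq> 0" using odd_adj[OF False H(1) u(1,2) w(1,2)] assms(1) u w by simp
    have ux: "\<xi> u x \<noteq> 0" using odd_adj[OF False H(1) u(1,2) x(1,2)] assms(2) u x by simp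
    define y where "y = (if \<xi> x w = 0 then x + u else x)"
    have y: "y \<in> orth H" using u x by (auto simp: y_def intro: subspace_add)
    have yw: "\<xi> y w \<noteq> 0" using uw by (simp add: y_def xi_simps)
    have uy: "\<xi> u y \<noteq> 0" using ux by (simp add: y_def xi_simps)
    have y0: "y \<noteq> 0" using uy by auto
    have "U \<subseteq> join U X" "X \<subseteq> join U X" using join_upper by blast+
    moreover have "u \<in> U" "x \<in> X" using u x ext_upper by auto
    ultimately have "y \<in> join U X" by (auto simp: y_def intro!: subspace_add)
    then have "ext H y \<subseteq> join U X" using H(2) join_upper by (intro ext_least) auto
    moreover have "adjacent k U (ext H y)" using odd_adj[OF False H(1) u(1,2) y y0] uy u by simp
    then have "ext H y \<noteq> U" using adj_irrefl by auto
    moreover have "adjacent k (ext H y) W" using odd_adj[OF False H(1) y y0 w(1,2)] yw w by simp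
    ultimately show ?thesis using odd_ext[OF False H(1) y y0] ext_upper by blast
  qed
  then show thesis using that by (auto simp: H_def)
qed

text \<open>In \<open>orth H\<close> some vector avoids the hyperplanes orthogonal to two given
  vectors. So two steps suffice to reach all of a star, as \<open>fan\<close> presupposes.\<close>

lemma star_diameter:
  assumes "H \<in> TR (k - 1)" "U \<in> TR k" "Y \<in> TR k" "H \<subseteq> U" "H \<subseteq> Y" "1 \<le> k"
  shows "Y = U \<or> adjacent k Y U \<or> (\<exists>Z. H \<subseteq> Z \<and> adjacent k Z U \<and> adjacent k Z Y)"
proof (cases "even k")
  case True
  then show ?thesis using even_star_adj[OF True assms(6,1)] assms by blast
next
  case False
  obtain u where u: "u \<in> orth H" "u \<noteq> 0" "U = ext H u" using odd_star[OF False assms(1,2,4)] .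
  obtain y where y: "y \<in> orth H" "y \<noteq> 0" "Y = ext H y" using odd_star[OF False assms(1,3,5)] .
  have s: "subspace H" using TR_D assms(1) by auto
  have R: "v \<in> orth H \<Longrightarrow> v \<noteq> 0 \<Longrightarrow> \<not> orth H \<subseteq> orth {v}" for v
    using regular_inter_orth[OF odd_regular[OF False assms(1)], of v] s
      subset_orth_iff[of "orth H" "{v}"] by auto
  obtain z where z: "z \<in> orth H" "z \<notin> orth {u}" "z \<notin> orth {y}"
    using not_covered_by_two_subspaces[OF subspace_orth subspace_orth subspace_orth R[OF u(1,2)] R[OF y(1,2)]] .
  then have n: "\<xi> z u \<noteq> 0" "\<xi> z y \<noteq> 0" by (auto simp: orth_singleton)
  then have "z \<noteq> 0" by auto
  then have "adjacent k (ext H z) U" "adjacent k (ext H z) Y"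
    using odd_adj[OF False assms(1) z(1)] u y n by auto
  then show ?thesis using ext_upper by blast
qed

lemma two_neq_0: "(2::'k) \<noteq> 0"
proof
  assume "(2::'k) = 0"
  then have "of_nat 2 = (0::'k)" by simp
  then have dvd: "CHAR('k) dvd 2" unfolding of_nat_eq_0_iff_char_dvd .
  have "\<not> CHAR('k) dvd 1" unfolding of_nat_eq_0_iff_char_dvd[symmetric] by simp
  then have "CHAR('k) \<noteq> 1" by auto
  moreover have "CHAR('k) \<noteq> 0" using dvd by (metis dvd_0_left zero_neq_numeral)
  ultimately have "CHAR('k) = 2" using dvd_imp_le[OF dvd] by linarith
  then show False using char_neq_2 by simp
qed

text \<open>For even \<open>k\<close> no such \<open>Y\<close> exists, as stars are cliques. For odd
  \<open>k\<close>, \<open>y\<close> is orthogonal to x = a u + b w, so on the plane of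
  \<open>u\<close> and \<open>w\<close> it acts as a multiple of \<open>x\<close>: y = c x + z with
  \<open>z\<close> orthogonal to the plane. The harmonic conjugate p = a u - b w and q = c p + z are
  non-orthogonal to \<open>u\<close>, \<open>w\<close>, \<open>x\<close> and \<open>y\<close>, but
  orthogonal to each other.\<close>

lemma star_line_not_opposite:
  assumes "adjacent k U W" "X \<in> TR k" "U \<inter> W \<subseteq> X" "X \<subseteq> join U W" "X \<noteq> U" "X \<noteq> W"
    and "adjacent k Y U" "adjacent k Y W" "U \<inter> W \<subseteq> Y" "Y \<noteq> X" "\<not> adjacent k Y X" "1 \<le> k"
  obtains P Q where "adjacent k P U" "adjacent k P W" "adjacent k P X" "adjacent k P Y"
    "adjacent k Q U" "adjacent k Q W" "adjacent k Q X" "adjacent k Q Y" "P \<noteq> Q" "\<not> adjacent k P Q"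
proof -
  note UW = adjD[OF assms(1,12)] and YU = adjD[OF assms(7,12)]
  define H where "H = U \<inter> W"
  have H: "H \<in> TR (k - 1)" "H \<subseteq> U" "H \<subseteq> X" "H \<subseteq> W" "H \<subseteq> Y" using UW assms(3,9) by (auto simp: H_def)
  have odd: "odd k" using even_star_adj[OF _ assms(12) H(1) YU(1) assms(2) H(5,3)] assms(10,11) by blast
  note adj = odd_adj[OF odd H(1)]
  obtain u where u: "u \<in> orth H" "u \<noteq> 0" "U = ext H u" using odd_star[OF odd H(1) UW(1) H(2)] .
  obtain w where w: "w \<in> orth H" "w \<noteq> 0" "W = ext H w" using odd_star[OF odd H(1) UW(2) H(4)] .
  obtain x where x: "x \<in> orth H" "x \<noteq> 0" "X = ext H x" using odd_star[OF odd H(1) assms(2) H(3)] .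
  obtain y where y: "y \<in> orth H" "y \<noteq> 0" "Y = ext H y" using odd_star[OF odd H(1) YU(1) H(5)] .
  have s: "subspace H" using TR_D H(1) by auto
  have uw: "\<xi> u w \<noteq> 0" using adj[OF u(1,2) w(1,2)] assms(1) u w by simp
  have wu: "\<xi> w u = - \<xi> u w" by (rule xi_skew)
  have yu: "\<xi> y u \<noteq> 0" using adj[OF y(1,2) u(1,2)] assms(7) u y by simp
  have yw: "\<xi> y w \<noteq> 0" using adj[OF y(1,2) w(1,2)] assms(8) w y by simp
  have yx: "\<xi> y x = 0" using adj[OF y(1,2) x(1,2)] assms(11) x y by simp
  have "x \<in> join U W" using x assms(4) ext_upper by blast
  have "W \<subseteq> ext U w"
    unfolding w(3) using H(2) ext_upper(1)[of U w] ext_upper(2)[of w U] by (intro ext_least) auto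
  moreover have "dim (ext U w) \<le> k + 1"
    using dim_insert[of w U] TR_D(2)[OF UW(1)] by (simp add: ext_def)
  ultimately have "join U W = ext U w"
    by (intro join_eqI[OF UW(1-3) subspace_ext ext_upper(1)])
  then obtain v b where v: "v \<in> U" "x = v + scale b w"
    using \<open>x \<in> join U W\<close> extE[of U x w] UW TR_D by metis
  have "v = x - scale b w" using v(2) by simp
  then have "v \<in> orth H" using x w by (metis subspace_diff subspace_scale subspace_orth)
  then obtain a where a: "v = scale a u" using odd_ext_eq[OF odd H(1) u(1) _] v(1) u(3) by metis
  have x_eq: "x = scale a u + scale b w" using v a by simp
  have a0: "a \<noteq> 0"
  proof
    assume "a = 0"
    then have "X \<subseteq> W" unfolding x(3) using x_eq w(3) ext_upper TR_D(1)[OF UW(2)] H(4)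
      by (intro ext_least) (auto intro: subspace_scale)
    then show False using assms(2,6) UW(2) TR_D subspace_dim_equal[of X W] by auto
  qed
  have b0: "b \<noteq> 0"
  proof
    assume "b = 0"
    then have "X \<subseteq> U" unfolding x(3) using x_eq u(3) ext_upper TR_D(1)[OF UW(1)] H(2)
      by (intro ext_least) (auto intro: subspace_scale)
    then show False using assms(2,5) UW(1) TR_D subspace_dim_equal[of X U] by auto
  qed
  have yab: "a * \<xi> y u + b * \<xi> y w = 0" using yx by (simp add: x_eq xi_simps)
  \<comment> \<open>On the plane of \<open>u\<close> and \<open>w\<close> the functionals of
    \<open>x\<close> and \<open>y\<close> both vanish at \<open>x\<close>, hence are proportional,
    with this factor.\<close>
  define c where "c = \<xi> y u / \<xi> x u"
  have xu: "\<xi> x u = - b * \<xi> u w" by (simp add: x_eq xi_simps wu)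
  have xw: "\<xi> x w = a * \<xi> u w" by (simp add: x_eq xi_simps)
  have c1: "\<xi> y u = c * \<xi> x u" using xu b0 uw by (simp add: c_def)
  have c0: "c \<noteq> 0" using c1 yu by auto
  have "b * \<xi> y w = b * (c * \<xi> x w)" using yab c1 xu xw by (simp add: algebra_simps add_eq_0_iff)
  then have c2: "\<xi> y w = c * \<xi> x w" using b0 by simp
  define p where "p = scale a u - scale b w"
  define z where "z = y - scale c x"
  define q where "q = scale c p + z"
  have zu: "\<xi> z u = 0" "\<xi> z w = 0" using c1 c2 by (simp_all add: z_def xi_simps)
  then have zx: "\<xi> z x = 0" "\<xi> z p = 0" by (simp_all add: x_eq p_def xi_simps)
  have zy: "\<xi> z y = 0" using zx(1) by (simp add: z_def xi_simps yx) (metis mult_zero_right neg_equal_0_iff_equal xi_skew yx)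
  have pu: "\<xi> p u = b * \<xi> u w" by (simp add: p_def xi_simps wu)
  have pw: "\<xi> p w = a * \<xi> u w" by (simp add: p_def xi_simps)
  have px: "\<xi> p x = 2 * a * b * \<xi> u w" by (simp add: p_def x_eq xi_simps wu)
  have py: "\<xi> p y = c * \<xi> p x"
  proof -
    have "y = scale c x + z" by (simp add: z_def)
    moreover have "\<xi> p z = 0" using zx(2) xi_eq_0_sym by blast
    ultimately show ?thesis by (simp add: xi_add_right xi_scale_right)
  qed
  \<comment> \<open>Here characteristic different from 2 is used.\<close>
  have px0: "\<xi> p x \<noteq> 0" using px a0 b0 uw two_neq_0 by simp
  have pH: "p \<in> orth H" unfolding p_def using u w by (intro subspace_diff subspace_scale) auto
  have zH: "z \<in> orth H" unfolding z_def using x y by (intro subspace_diff subspace_scale) auto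
  have qH: "q \<in> orth H" unfolding q_def using pH zH by (intro subspace_add subspace_scale) auto
  have p0: "p \<noteq> 0" using px0 by auto
  have qx: "\<xi> q x \<noteq> 0" using px0 c0 zx by (simp add: q_def xi_simps)
  then have q0: "q \<noteq> 0" by auto
  have q: "\<xi> q u \<noteq> 0" "\<xi> q w \<noteq> 0" "\<xi> q y \<noteq> 0"
    using pu pw py px0 a0 b0 c0 uw zu zy by (simp_all add: q_def xi_simps)
  have "\<xi> p z = 0" using zx(2) xi_eq_0_sym by blast
  then have pq: "\<xi> p q = 0" by (simp add: q_def xi_simps)
  \<comment> \<open>If \<open>p\<close> and \<open>q\<close> gave the same element, comparison of
    their values at \<open>u\<close> would give z = 0 and hence \<open>Y = X\<close>.\<close>
  have "q \<notin> ext H p"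
  proof
    assume "q \<in> ext H p"
    then obtain d where d: "q = scale d p" using odd_ext_eq[OF odd H(1) pH qH] by blast
    have "d * \<xi> p u = c * \<xi> p u" using arg_cong[OF d, of "\<lambda>t. \<xi> t u"] zu by (auto simp: q_def xi_simps)
    then have "d = c" using pu b0 uw by simp
    then have "z = 0" using d by (simp add: q_def)
    then have "y = scale c x" by (simp add: z_def)
    then have "Y \<subseteq> X" unfolding y(3) using H(3) ext_upper(2)[of x H] x(3) TR_D(1)[OF assms(2)]
      by (intro ext_least subspace_scale) (auto intro: subspace_scale)
    then show False using assms(2,10) YU(1) TR_D subspace_dim_equal[of Y X] by auto
  qed
  then have "ext H p \<noteq> ext H q" using ext_upper by blast
  then show thesis
    using that[of "ext H p" "ext H q"] adj[OF pH p0] adj[OF qH q0] u w x y q qx pq pu pw px0 py a0 b0 c0 uw pH p0 qH q0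
    by simp
qed

subsection \<open>Tops are stars of the dual geometry\<close>

lemma adj_dual:
  assumes "adjacent (dimension - k) Y U" "1 \<le> k" "k + 1 \<le> dimension"
  shows "adjacent k (orth Y) (orth U)"
  using adj_orth[OF assms(1)] assms by simp

lemma adj_dual':
  assumes "adjacent (dimension - k) Y (orth U)" "1 \<le> k" "k + 1 \<le> dimension" "subspace U"
  shows "adjacent k (orth Y) U"
  using adj_dual[OF assms(1-3)] assms(4) by simp

lemma adj_dim: "adjacent k U W \<Longrightarrow> 1 \<le> k \<Longrightarrow> k + 1 \<le> dimension"
  using adjD(5) TR_dim_le by blast

lemma adj_subspace: "adjacent k U W \<Longrightarrow> subspace U" "adjacent k U W \<Longrightarrow> subspace W"
  unfolding adjacent_def pencils_def pencil_def by (auto dest: TR_D(1))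

lemma orth_mem_iff: "subspace U \<Longrightarrow> subspace Y \<Longrightarrow> orth Y \<subseteq> U \<longleftrightarrow> orth U \<subseteq> Y"
  by (metis orth_orth orth_subset_iff subspace_orth)

lemma orth_subset_join: "orth U \<inter> orth W \<subseteq> Y \<Longrightarrow> orth Y \<subseteq> join U W"
  using orth_antimono[of "orth U \<inter> orth W" Y] by (simp add: orth_join[symmetric])

text \<open>The dual of \<open>star_outside\<close>; \<open>k + 2 \<le> dimension\<close> turns into
  \<open>2 \<le> k\<close>.\<close>

lemma top_outside:
  assumes "adjacent k U W" "2 \<le> k"
  obtains Y where "adjacent k Y U" "adjacent k Y W" "Y \<subseteq> join U W" "\<not> U \<inter> W \<subseteq> Y"
proof -
  have k: "1 \<le> k" "k + 1 \<le> dimension" using adj_dim[OF assms(1)] assms(2) by auto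
  note s = adj_subspace[OF assms(1)]
  obtain Y where Y: "adjacent (dimension - k) Y (orth U)" "adjacent (dimension - k) Y (orth W)"
    "orth U \<inter> orth W \<subseteq> Y" "\<not> Y \<subseteq> join (orth U) (orth W)"
    by (rule star_outside[OF adj_orth[OF assms(1) k(1)]]) (use k assms(2) in auto)
  have sY: "subspace Y" using adj_subspace(1)[OF Y(1)] .
  have "orth Y \<subseteq> join U W" using Y(3) by (rule orth_subset_join)
  moreover have "\<not> U \<inter> W \<subseteq> orth Y"
    using Y(4) s sY by (simp add: orth_inter[symmetric]) (metis orth_mem_iff orth_orth orth_subset_iff subspace_inter subspace_orth)
  ultimately show thesis using that adj_dual'[OF Y(1) k s(1)] adj_dual'[OF Y(2) k s(2)] by blast
qed

lemma top_line_meets_neighbours: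
  assumes "adjacent k U W" "adjacent k U X" "join U W = join U X" "U \<inter> W \<noteq> U \<inter> X" "1 \<le> k"
  obtains X' where "X' \<in> TR k" "U \<inter> X \<subseteq> X'" "X' \<subseteq> join U X" "X' \<noteq> U" "adjacent k X' W"
proof -
  have k: "k + 1 \<le> dimension" using adj_dim[OF assms(1,5)] .
  note s = adj_subspace[OF assms(1)] adj_subspace(2)[OF assms(2)]
  have "orth U \<inter> orth W = orth U \<inter> orth X" using assms(3) by (metis orth_join)
  moreover have "join (orth U) (orth W) \<noteq> join (orth U) (orth X)"
    using assms(4) s by (metis orth_eq_iff orth_inter subspace_inter)
  ultimately obtain X' where X': "X' \<in> TR (dimension - k)" "orth U \<inter> orth X \<subseteq> X'"
    "X' \<subseteq> join (orth U) (orth X)" "X' \<noteq> orth U" "adjacent (dimension - k) X' (orth W)"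
    using k by (elim star_line_meets_neighbours[OF adj_orth[OF assms(1,5)] adj_orth[OF assms(2,5)]])
      simp_all
  have sX: "subspace X'" using X' TR_D(1) by blast
  have "orth X' \<in> TR k" using TR_orth[OF X'(1)] k by simp
  moreover have "orth X' \<subseteq> join U X" using X'(2) by (rule orth_subset_join)
  moreover have "U \<inter> X \<subseteq> orth X'"
    using X'(3) s sX orth_subset_iff[of "U \<inter> X" "orth X'"]
    by (metis orth_inter orth_orth orth_subset_iff subspace_inter subspace_orth)
  moreover have "orth X' \<noteq> U" using X'(4) sX by auto
  ultimately show thesis using that adj_dual'[OF X'(5) assms(5) k s(2)] by blast
qed

lemma top_diameter:
  assumes "B \<in> TR (k + 1)" "U \<in> TR k" "Y \<in> TR k" "U \<subseteq> B" "Y \<subseteq> B" "1 \<le> k"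
  shows "Y = U \<or> adjacent k Y U \<or> (\<exists>Z. Z \<subseteq> B \<and> adjacent k Z U \<and> adjacent k Z Y)"
proof -
  have k: "k + 1 \<le> dimension" using TR_dim_le[OF assms(1)] .
  have s: "subspace U" "subspace Y" "subspace B" using assms TR_D(1) by blast+
  have "orth Y = orth U \<or> adjacent (dimension - k) (orth Y) (orth U) \<or>
      (\<exists>Z. orth B \<subseteq> Z \<and> adjacent (dimension - k) Z (orth U) \<and> adjacent (dimension - k) Z (orth Y))"
  proof (rule star_diameter)
    show "orth B \<in> TR (dimension - k - 1)" using TR_orth[OF assms(1)] by simp
  qed (use assms k in \<open>auto intro: TR_orth orth_antimono[THEN subsetD]\<close>)
  then consider "Y = U" | "adjacent k Y U"
    | Z where "orth B \<subseteq> Z" "adjacent (dimension - k) Z (orth U)" "adjacent (dimension - k) Z (orth Y)"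
    using s adj_orth_iff[OF s(2,1) assms(6) k] by (auto simp: orth_eq_iff)
  then show ?thesis
  proof cases
    case 3
    then have "orth Z \<subseteq> B" using s adj_subspace(1) by (simp add: orth_mem_iff)
    then show ?thesis using adj_dual'[OF 3(2) assms(6) k s(1)] adj_dual'[OF 3(3) assms(6) k s(2)] by blast
  qed auto
qed

lemma top_line_not_opposite:
  assumes "adjacent k U W" "X \<in> TR k" "U \<inter> W \<subseteq> X" "X \<subseteq> join U W" "X \<noteq> U" "X \<noteq> W"
    and "adjacent k Y U" "adjacent k Y W" "Y \<subseteq> join U W" "Y \<noteq> X" "\<not> adjacent k Y X" "1 \<le> k"
  obtains P Q where "adjacent k P U" "adjacent k P W" "adjacent k P X" "adjacent k P Y"
    "adjacent k Q U" "adjacent k Q W" "adjacent k Q X" "adjacent k Q Y" "P \<noteq> Q" "\<not> adjacent k P Q"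
proof -
  have k: "k + 1 \<le> dimension" using adj_dim[OF assms(1,12)] .
  note s = adj_subspace[OF assms(1)] TR_D(1)[OF assms(2)] adj_subspace(1)[OF assms(7)]
  let ?a = "adjacent (dimension - k)"
  obtain P Q where PQ: "?a P (orth U)" "?a P (orth W)" "?a P (orth X)" "?a P (orth Y)"
    "?a Q (orth U)" "?a Q (orth W)" "?a Q (orth X)" "?a Q (orth Y)" "P \<noteq> Q" "\<not> ?a P Q"
  proof (rule star_line_not_opposite[where k="dimension - k" and U="orth U" and W="orth W" and X="orth X" and Y="orth Y"])
    show "?a (orth U) (orth W)" using adj_orth assms(1,12) by blast
    show "?a (orth Y) (orth U)" "?a (orth Y) (orth W)" using adj_orth assms(7,8,12) by blast+
    show "orth X \<in> TR (dimension - k)" using assms(2) by (rule TR_orth)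
    show "\<not> ?a (orth Y) (orth X)" using assms(11) adj_orth_iff[OF s(4,3) assms(12) k] by blast
    show "orth X \<noteq> orth U" "orth X \<noteq> orth W" "orth Y \<noteq> orth X" using assms s by (auto simp: orth_eq_iff)
    show "orth U \<inter> orth W \<subseteq> orth X" "orth U \<inter> orth W \<subseteq> orth Y"
      using assms(4,9) by (simp_all add: orth_join[symmetric] orth_antimono)
    show "orth X \<subseteq> join (orth U) (orth W)"
      using assms(3) s by (simp add: orth_inter[symmetric] orth_antimono)
    show "1 \<le> dimension - k" using k by simp
  qed
  have sPQ: "subspace P" "subspace Q" using PQ adj_subspace by blast+
  have "orth P \<noteq> orth Q" using PQ(9) sPQ by (simp add: orth_eq_iff)
  moreover have "\<not> adjacent k (orth P) (orth Q)"
    using PQ(10) sPQ adj_orth_iff[of "orth P" "orth Q" k] assms(12) k by simp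
  ultimately show thesis
    by (rule that[rotated 8]) (use PQ adj_dual' assms(12) k s in blast)+
qed

section \<open>Stars and tops defined from adjacency\<close>

text \<open>\<open>coll k U W X\<close>: \<open>X\<close> lies on the line joining the adjacent \<open>U\<close> and \<open>W\<close>. A common neighbour
  \<open>X\<close> of \<open>U\<close> and \<open>W\<close> off this line has an opposite one, in the other one of the star and the top
  through \<open>U\<close> and \<open>W\<close>, such that all common neighbours of the four lie on the line.\<close>

definition coll :: "nat \<Rightarrow> 'v set \<Rightarrow> 'v set \<Rightarrow> 'v set \<Rightarrow> bool" where
  "coll k U W X \<longleftrightarrow> X = U \<or> X = W \<or> (adjacent k X U \<and> adjacent k X W \<and>
     \<not> (\<exists>Y\<in>TR k. adjacent k Y U \<and> adjacent k Y W \<and> Y \<noteq> X \<and> \<not> adjacent k Y X \<and>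
       (\<forall>P\<in>TR k. \<forall>Q\<in>TR k. adjacent k P U \<and> adjacent k P W \<and> adjacent k P X \<and> adjacent k P Y \<and>
         adjacent k Q U \<and> adjacent k Q W \<and> adjacent k Q X \<and> adjacent k Q Y \<and> P \<noteq> Q \<longrightarrow>
         adjacent k P Q)))"

text \<open>The lines through \<open>U\<close> form a grid, with \<open>U \<inter> W\<close> and \<open>join U W\<close> as the coordinates of the line
  joining \<open>U\<close> and \<open>W\<close>; a wedge consists of two different lines agreeing in one coordinate.\<close>

definition wedge :: "nat \<Rightarrow> 'v set \<Rightarrow> 'v set \<Rightarrow> 'v set \<Rightarrow> bool" where
  "wedge k U W X \<longleftrightarrow> adjacent k U W \<and> adjacent k U X \<and> \<not> coll k U W X \<and>
     (\<exists>X'\<in>TR k. X' \<noteq> U \<and> coll k U X X' \<and> adjacent k X' W)"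

text \<open>\<open>Y\<close> agrees in some coordinate with each of two lines that form a wedge.
  Since these differ in one coordinate, \<open>Y\<close> must share the other one, so a row consists
  of all neighbours of \<open>U\<close> in one star or one top.\<close>

definition row :: "nat \<Rightarrow> 'v set \<Rightarrow> 'v set \<Rightarrow> 'v set \<Rightarrow> 'v set \<Rightarrow> bool" where
  "row k U W X Y \<longleftrightarrow> adjacent k U Y \<and> (coll k U W Y \<or> wedge k U W Y) \<and> (coll k U X Y \<or> wedge k U X Y)"

text \<open>The whole star or top. Elements that are not neighbours of \<open>U\<close> are reached
  through a neighbour \<open>Z\<close>; \<open>U\<close> and \<open>Z'\<close> serve to fix the same
  star or top at \<open>Z\<close>.\<close>

definition fan :: "nat \<Rightarrow> 'v set \<Rightarrow> 'v set \<Rightarrow> 'v set \<Rightarrow> 'v set \<Rightarrow> bool" where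
  "fan k U W X Y \<longleftrightarrow> Y = U \<or> row k U W X Y \<or>
     (\<exists>Z\<in>TR k. \<exists>Z'\<in>TR k. row k U W X Z \<and> row k U W X Z' \<and> wedge k Z U Z' \<and> row k Z U Z' Y)"

text \<open>\<open>P\<close> meets \<open>B\<close> only in \<open>H\<close>, so adjacency would
  force \<open>P \<inter> Y\<close> to be \<open>H\<close>, inside \<open>Y\<close>.\<close>

lemma star_top_not_adj:
  assumes "H \<in> TR (k - 1)" "subspace B" "H \<subseteq> B" "1 \<le> k" "H \<subseteq> P" "\<not> P \<subseteq> B" "Y \<subseteq> B" "\<not> H \<subseteq> Y"
  shows "\<not> adjacent k P Y"
proof
  assume a: "adjacent k P Y"
  note PY = adjD[OF a assms(4)]
  note P = TR_D[OF PY(1)] and H = TR_D[OF assms(1)]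
  have s: "subspace (P \<inter> B)" using P assms(2) by (intro subspace_inter) auto
  have "\<not> dim P \<le> dim (P \<inter> B)" using subspace_dim_equal[OF s P(1)] assms(6) by blast
  then have "H = P \<inter> B" using P H assms by (intro subspace_dim_equal[OF H(1) s]) auto
  then have "P \<inter> Y \<subseteq> H" using assms(7) by blast
  then have "P \<inter> Y = H" by (rule TR_eqI[OF PY(4) assms(1)])
  then show False using assms(8) by blast
qed

lemma adj_betweenI:
  assumes "adjacent k U W" "1 \<le> k" "P \<in> TR k" "Q \<in> TR k" "P \<noteq> Q" "U \<inter> W \<subseteq> P" "P \<subseteq> join U W"
    "U \<inter> W \<subseteq> Q" "Q \<subseteq> join U W"
  shows "adjacent k P Q"
  using adjD[OF assms(1,2)] assms by (intro adjI[where H="U \<inter> W" and B="join U W"]) auto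

lemma line_upper: "U \<inter> W \<subseteq> U" "U \<inter> W \<subseteq> W" "U \<subseteq> join U W" "W \<subseteq> join U W" "U \<inter> W \<subseteq> join U W"
  using join_upper(1)[of U W] join_upper(2)[of W U] by auto

text \<open>If \<open>X\<close> is on the line, a nonadjacent \<open>Y\<close> lies in the star or
  in the top, and the respective lemma yields a nonadjacent pair \<open>P\<close>, \<open>Q\<close>.
  If \<open>X\<close> is off the line, a \<open>Y\<close> on the other side exists; elements
  adjacent to both sides lie on the line, where all are adjacent.\<close>

lemma coll_iff:
  assumes "adjacent k U W" "X \<in> TR k" "2 \<le> k" "k + 2 \<le> dimension"
  shows "coll k U W X \<longleftrightarrow> U \<inter> W \<subseteq> X \<and> X \<subseteq> join U W"
proof
  have k: "1 \<le> k" using assms(3) by simp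
  note UW = adjD[OF assms(1) k]
  note line = line_upper[where U=U and W=W]
  {
    assume X: "U \<inter> W \<subseteq> X \<and> X \<subseteq> join U W"
    show "coll k U W X"
    proof (rule ccontr)
      assume nc: "\<not> coll k U W X"
      then have ne: "X \<noteq> U" "X \<noteq> W" by (auto simp: coll_def)
      have "adjacent k X U" "adjacent k X W"
        using X ne UW assms(2) line by (auto intro!: adj_betweenI[OF assms(1) k])
      then obtain Y where Y: "adjacent k Y U" "adjacent k Y W" "Y \<noteq> X" "\<not> adjacent k Y X" and
        clique: "\<And>P Q. P \<in> TR k \<Longrightarrow> Q \<in> TR k \<Longrightarrow> adjacent k P U \<Longrightarrow> adjacent k P W \<Longrightarrow> adjacent k P X \<Longrightarrow>
          adjacent k P Y \<Longrightarrow> adjacent k Q U \<Longrightarrow> adjacent k Q W \<Longrightarrow> adjacent k Q X \<Longrightarrow> adjacent k Q Y \<Longrightarrow>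
          P \<noteq> Q \<Longrightarrow> adjacent k P Q"
        using nc unfolding coll_def by blast
      have "\<exists>P Q. adjacent k P U \<and> adjacent k P W \<and> adjacent k P X \<and> adjacent k P Y \<and>
         adjacent k Q U \<and> adjacent k Q W \<and> adjacent k Q X \<and> adjacent k Q Y \<and> P \<noteq> Q \<and> \<not> adjacent k P Q"
      proof (cases "U \<inter> W \<subseteq> Y")
        case True
        show ?thesis
          by (rule star_line_not_opposite[OF assms(1,2) conjunct1[OF X] conjunct2[OF X] ne Y(1,2) True Y(3,4) k]) blast
      next
        case False
        then have "Y \<subseteq> join U W" using adj_three[OF k assms(1) Y(1,2)] by blast
        then show ?thesis
          by (rule top_line_not_opposite[OF assms(1,2) conjunct1[OF X] conjunct2[OF X] ne Y(1,2) _ Y(3,4) k]) blast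
      qed
      then show False using clique adjD(1)[OF _ k] by metis
    qed
  }
  assume c: "coll k U W X"
  show "U \<inter> W \<subseteq> X \<and> X \<subseteq> join U W"
  proof (rule ccontr)
    assume n: "\<not> (U \<inter> W \<subseteq> X \<and> X \<subseteq> join U W)"
    then have X: "adjacent k X U" "adjacent k X W" using c line by (auto simp: coll_def)
    have "X \<noteq> U" "X \<noteq> W" using X adj_irrefl by blast+
    then have no: "\<And>Y. adjacent k Y U \<Longrightarrow> adjacent k Y W \<Longrightarrow> Y \<noteq> X \<Longrightarrow> \<not> adjacent k Y X \<Longrightarrow>
        \<exists>P Q. adjacent k P U \<and> adjacent k P W \<and> adjacent k P X \<and> adjacent k P Y \<and>
         adjacent k Q U \<and> adjacent k Q W \<and> adjacent k Q X \<and> adjacent k Q Y \<and> P \<noteq> Q \<and> \<not> adjacent k P Q"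
      using c adjD(1)[OF _ k] unfolding coll_def by metis
    have sep: "\<not> adjacent k P Y" "\<not> adjacent k Y P"
      if "U \<inter> W \<subseteq> P" "\<not> P \<subseteq> join U W" "Y \<subseteq> join U W" "\<not> U \<inter> W \<subseteq> Y" for P Y
      using star_top_not_adj[OF UW(4) subspace_join line(5) k that] adj_sym by blast+
    have three: "U \<inter> W \<subseteq> P \<or> P \<subseteq> join U W" if "adjacent k P U" "adjacent k P W" for P
      using adj_three[OF k assms(1)] that by blast
    have "\<exists>Y. adjacent k Y U \<and> adjacent k Y W \<and>
      ((U \<inter> W \<subseteq> X \<and> \<not> X \<subseteq> join U W \<and> Y \<subseteq> join U W \<and> \<not> U \<inter> W \<subseteq> Y) \<or>
       (U \<inter> W \<subseteq> Y \<and> \<not> Y \<subseteq> join U W \<and> X \<subseteq> join U W \<and> \<not> U \<inter> W \<subseteq> X))"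
    proof (cases "U \<inter> W \<subseteq> X")
      case True
      then show ?thesis using n top_outside[OF assms(1,3)] by metis
    next
      case False
      then show ?thesis using three[OF X] star_outside[OF assms(1) k assms(4)] by metis
    qed
    then obtain Y where Y: "adjacent k Y U" "adjacent k Y W" and
      opp: "(U \<inter> W \<subseteq> X \<and> \<not> X \<subseteq> join U W \<and> Y \<subseteq> join U W \<and> \<not> U \<inter> W \<subseteq> Y) \<or>
       (U \<inter> W \<subseteq> Y \<and> \<not> Y \<subseteq> join U W \<and> X \<subseteq> join U W \<and> \<not> U \<inter> W \<subseteq> X)" by blast
    \<comment> \<open>\<open>X\<close> and \<open>Y\<close> lie on opposite sides, so an element
      strictly on one side fails to be adjacent to one of them.\<close>
    have between: "U \<inter> W \<subseteq> P \<and> P \<subseteq> join U W"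
      if "adjacent k P U" "adjacent k P W" "adjacent k P X" "adjacent k P Y" for P
    proof (rule ccontr)
      assume n: "\<not> (U \<inter> W \<subseteq> P \<and> P \<subseteq> join U W)"
      consider "U \<inter> W \<subseteq> P" "\<not> P \<subseteq> join U W" | "P \<subseteq> join U W" "\<not> U \<inter> W \<subseteq> P"
        using n three[of P] \<open>adjacent k P U\<close> \<open>adjacent k P W\<close> by blast
      then show False
      proof cases
        case 1
        then show ?thesis using opp sep(1)[OF 1] \<open>adjacent k P X\<close> \<open>adjacent k P Y\<close> by blast
      next
        case 2
        then show ?thesis using opp sep(2)[OF _ _ 2] \<open>adjacent k P X\<close> \<open>adjacent k P Y\<close> by blast
      qed
    qed
    have "Y \<noteq> X" using opp by blast
    moreover have "\<not> adjacent k Y X" using opp sep(2)[of X Y] sep(1)[of Y X] by argo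
    ultimately obtain P Q where PQ: "adjacent k P U" "adjacent k P W" "adjacent k P X" "adjacent k P Y"
       "adjacent k Q U" "adjacent k Q W" "adjacent k Q X" "adjacent k Q Y" "P \<noteq> Q" "\<not> adjacent k P Q"
      using no[OF Y] by blast
    have "adjacent k P Q"
      using between[OF PQ(1-4)] between[OF PQ(5-8)] adjD(1)[OF PQ(1) k] adjD(1)[OF PQ(5) k] PQ(9)
      by (intro adj_betweenI[OF assms(1) k]) auto
    then show False using PQ(10) by blast
  qed
qed

text \<open>Both intersections have dimension \<open>k - 1\<close>, so inclusion in \<open>X\<close>
  already means equality of this coordinate of the two lines.\<close>

lemma meet_subset_iff:
  assumes "adjacent k U W" "adjacent k U X" "1 \<le> k"
  shows "U \<inter> W \<subseteq> X \<longleftrightarrow> U \<inter> W = U \<inter> X"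
  using TR_eqI[OF adjD(4)[OF assms(1,3)] adjD(4)[OF assms(2,3)]] by blast

lemma join_subset_iff_eq:
  assumes "adjacent k U W" "adjacent k U X" "1 \<le> k"
  shows "X \<subseteq> join U W \<longleftrightarrow> join U W = join U X"
proof
  assume "X \<subseteq> join U W"
  then have "join U X \<subseteq> join U W" using line_upper[where U=U and W=W] by (simp add: join_subset_iff)
  then show "join U W = join U X" using TR_eqI[OF adjD(5)[OF assms(2,3)] adjD(5)[OF assms(1,3)]] by simp
qed (use line_upper[where U=U and W=X] in simp)

lemma coll_iff':
  assumes "adjacent k U W" "adjacent k U X" "2 \<le> k" "k + 2 \<le> dimension"
  shows "coll k U W X \<longleftrightarrow> U \<inter> W = U \<inter> X \<and> join U W = join U X"
proof -
  have k: "1 \<le> k" using assms(3) by simp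
  show ?thesis
    unfolding coll_iff[OF assms(1) adjD(2)[OF assms(2) k] assms(3,4)]
      meet_subset_iff[OF assms(1,2) k] join_subset_iff_eq[OF assms(1,2) k] ..
qed

text \<open>Exactly one coordinate agrees. Given \<open>X'\<close>, the pairwise adjacent
  \<open>U\<close>, \<open>W\<close>, \<open>X'\<close> share a star or a top by
  \<open>adj_three\<close>; conversely \<open>X'\<close> comes from the star or the top version of
  the lemma on lines meeting neighbourhoods.\<close>

lemma wedge_iff:
  assumes "2 \<le> k" "k + 2 \<le> dimension"
  shows "wedge k U W X \<longleftrightarrow> adjacent k U W \<and> adjacent k U X \<and>
    (U \<inter> W = U \<inter> X \<longleftrightarrow> join U W \<noteq> join U X)"
proof -
  have k: "1 \<le> k" using assms by simp
  have "wedge k U W X \<longleftrightarrow> (U \<inter> W = U \<inter> X \<longleftrightarrow> join U W \<noteq> join U X)"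
    if a: "adjacent k U W" "adjacent k U X"
  proof
    assume "wedge k U W X"
    then obtain X' where X': "X' \<in> TR k" "X' \<noteq> U" "coll k U X X'" "adjacent k X' W"
      and nc: "\<not> coll k U W X" unfolding wedge_def by blast
    have b: "U \<inter> X \<subseteq> X'" "X' \<subseteq> join U X" using coll_iff[OF a(2) X'(1) assms] X'(3) by blast+
    have "adjacent k U X'"
      using b X'(1,2) line_upper[where U=U and W=X] adjD[OF a(2) k] by (intro adj_betweenI[OF a(2) k]) auto
    then have eq: "U \<inter> X = U \<inter> X'" "join U X = join U X'"
      using b meet_subset_iff[OF a(2) _ k] join_subset_iff_eq[OF a(2) _ k] by blast+
    have "U \<inter> W \<subseteq> X' \<or> X' \<subseteq> join U W"
      using adj_three[OF k a(1) adj_sym X'(4)] \<open>adjacent k U X'\<close> by blast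
    then have "U \<inter> W = U \<inter> X \<or> join U W = join U X"
      unfolding eq meet_subset_iff[OF a(1) \<open>adjacent k U X'\<close> k] join_subset_iff_eq[OF a(1) \<open>adjacent k U X'\<close> k] .
    then show "U \<inter> W = U \<inter> X \<longleftrightarrow> join U W \<noteq> join U X" using nc coll_iff'[OF a assms] by blast
  next
    assume x: "U \<inter> W = U \<inter> X \<longleftrightarrow> join U W \<noteq> join U X"
    have "\<exists>X'\<in>TR k. U \<inter> X \<subseteq> X' \<and> X' \<subseteq> join U X \<and> X' \<noteq> U \<and> adjacent k X' W"
      using star_line_meets_neighbours[OF a _ _ k] top_line_meets_neighbours[OF a _ _ k] x by metis
    then show "wedge k U W X"
      using a x coll_iff'[OF a assms] coll_iff[OF a(2) _ assms] unfolding wedge_def by blast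
  qed
  then show ?thesis unfolding wedge_def by blast
qed

section \<open>Rows and fans are the stars and tops\<close>

context
  fixes k :: nat
  assumes k: "2 \<le> k" "k + 2 \<le> dimension"
begin

lemma k1: "1 \<le> k"
  using k by simp

lemma row_star:
  assumes "wedge k U W X" "U \<inter> W = U \<inter> X"
  shows "row k U W X Y \<longleftrightarrow> adjacent k U Y \<and> U \<inter> W \<subseteq> Y"
proof -
  have a: "adjacent k U W" "adjacent k U X" "join U W \<noteq> join U X"
    using assms by (simp_all add: wedge_iff[OF k])
  have "row k U W X Y \<longleftrightarrow> U \<inter> W = U \<inter> Y" if "adjacent k U Y"
    unfolding row_def coll_iff'[OF a(1) that k] coll_iff'[OF a(2) that k] wedge_iff[OF k]
    using a that assms(2) by auto
  then show ?thesis using meet_subset_iff[OF a(1) _ k1] unfolding row_def by blast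
qed

lemma row_top:
  assumes "wedge k U W X" "join U W = join U X"
  shows "row k U W X Y \<longleftrightarrow> adjacent k U Y \<and> Y \<subseteq> join U W"
proof -
  have a: "adjacent k U W" "adjacent k U X" "U \<inter> W \<noteq> U \<inter> X"
    using assms by (simp_all add: wedge_iff[OF k])
  have "row k U W X Y \<longleftrightarrow> join U W = join U Y" if "adjacent k U Y"
    unfolding row_def coll_iff'[OF a(1) that k] coll_iff'[OF a(2) that k] wedge_iff[OF k]
    using a that assms(2) by auto
  then show ?thesis using join_subset_iff_eq[OF a(1) _ k1] unfolding row_def by blast
qed

lemma fan_star:
  assumes "wedge k U W X" "U \<inter> W = U \<inter> X"
  shows "fan k U W X Y \<longleftrightarrow> Y \<in> TR k \<and> U \<inter> W \<subseteq> Y"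
proof
  have a: "adjacent k U W" "adjacent k U X" using assms(1) by (simp_all add: wedge_iff[OF k])
  note UW = adjD[OF a(1) k1]
  note row = row_star[OF assms]
  {
    assume "fan k U W X Y"
    then consider "Y = U" | "row k U W X Y"
      | Z Z' where "row k U W X Z" "row k U W X Z'" "wedge k Z U Z'" "row k Z U Z' Y"
      unfolding fan_def by blast
    then show "Y \<in> TR k \<and> U \<inter> W \<subseteq> Y"
    proof cases
      case 3
      have Z: "adjacent k U Z" "adjacent k U Z'" "U \<inter> W \<subseteq> Z" "U \<inter> W \<subseteq> Z'" using 3 row by blast+
      have Z': "adjacent k Z U" "adjacent k Z Z'" using 3(3) by (simp_all add: wedge_iff[OF k])
      have "U \<inter> W = Z \<inter> U" using TR_eqI[OF UW(4) adjD(4)[OF Z'(1) k1]] Z(3) by blast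
      moreover have "U \<inter> W = Z \<inter> Z'" using TR_eqI[OF UW(4) adjD(4)[OF Z'(2) k1]] Z(3,4) by blast
      ultimately show ?thesis using row_star[OF 3(3)] 3(4) adjD(2)[OF _ k1] by auto
    qed (use UW row adjD(2)[OF _ k1] in auto)
  }
  assume Y: "Y \<in> TR k \<and> U \<inter> W \<subseteq> Y"
  have "Y = U \<or> adjacent k Y U \<or> (\<exists>Z. U \<inter> W \<subseteq> Z \<and> adjacent k Z U \<and> adjacent k Z Y)"
    using Y UW by (intro star_diameter[OF UW(4,1)] k1) auto
  then consider "Y = U" | "adjacent k U Y" | Z where "U \<inter> W \<subseteq> Z" "adjacent k U Z" "adjacent k Z Y"
    using adj_sym by blast
  then show "fan k U W X Y"
  proof cases
    case 3
    \<comment> \<open>\<open>Z'\<close> lies in the same star but off the line of \<open>U\<close>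
      and \<open>Z\<close>, so that \<open>U\<close> and \<open>Z'\<close> form a wedge of star type
      at \<open>Z\<close>.\<close>
    obtain Z' where Z': "adjacent k Z' U" "adjacent k Z' Z" "U \<inter> Z \<subseteq> Z'" "\<not> Z' \<subseteq> join U Z"
      using star_outside[OF 3(2) k1 k(2)] .
    have H: "U \<inter> W = U \<inter> Z" using meet_subset_iff[OF a(1) 3(2) k1] 3(1) by blast
    have ZU: "adjacent k Z U" "adjacent k Z Z'" using 3(2) Z' adj_sym by blast+
    have H': "Z \<inter> U = Z \<inter> Z'" using meet_subset_iff[OF ZU k1] Z'(3) by blast
    have "wedge k Z U Z'"
      unfolding wedge_iff[OF k] using ZU H' join_subset_iff_eq[OF ZU k1] Z'(4) by (simp add: join_commute)
    moreover have "row k Z U Z' Y"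
      unfolding row_star[OF calculation H'] using 3(3) H Y by blast
    moreover have "row k U W X Z" "row k U W X Z'" using row 3 Z' H adj_sym by auto
    ultimately show ?thesis unfolding fan_def using adjD(2)[OF 3(2) k1] adjD(1)[OF Z'(1) k1] by blast
  qed (use Y row in \<open>auto simp: fan_def\<close>)
qed

lemma fan_top:
  assumes "wedge k U W X" "join U W = join U X"
  shows "fan k U W X Y \<longleftrightarrow> Y \<in> TR k \<and> Y \<subseteq> join U W"
proof
  have a: "adjacent k U W" "adjacent k U X" using assms(1) by (simp_all add: wedge_iff[OF k])
  note UW = adjD[OF a(1) k1]
  note row = row_top[OF assms]
  {
    assume "fan k U W X Y"
    then consider "Y = U" | "row k U W X Y"
      | Z Z' where "row k U W X Z" "row k U W X Z'" "wedge k Z U Z'" "row k Z U Z' Y"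
      unfolding fan_def by blast
    then show "Y \<in> TR k \<and> Y \<subseteq> join U W"
    proof cases
      case 3
      have Z: "adjacent k U Z" "adjacent k U Z'" "Z \<subseteq> join U W" "Z' \<subseteq> join U W" using 3 row by blast+
      have Z': "adjacent k Z U" "adjacent k Z Z'" using 3(3) by (simp_all add: wedge_iff[OF k])
      have "join Z U = join U W" using TR_eqI[OF adjD(5)[OF Z'(1) k1] UW(5)] Z(3) line_upper[where U=U and W=W]
        by (simp add: join_subset_iff)
      moreover have "join Z Z' = join U W" using TR_eqI[OF adjD(5)[OF Z'(2) k1] UW(5)] Z(3,4)
        by (simp add: join_subset_iff)
      ultimately show ?thesis using row_top[OF 3(3)] 3(4) adjD(2)[OF _ k1] by auto
    qed (use UW row adjD(2)[OF _ k1] line_upper[where U=U and W=W] in auto)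
  }
  assume Y: "Y \<in> TR k \<and> Y \<subseteq> join U W"
  have "Y = U \<or> adjacent k Y U \<or> (\<exists>Z. Z \<subseteq> join U W \<and> adjacent k Z U \<and> adjacent k Z Y)"
    using Y UW line_upper[where U=U and W=W] by (intro top_diameter[OF UW(5,1)] k1) auto
  then consider "Y = U" | "adjacent k U Y" | Z where "Z \<subseteq> join U W" "adjacent k U Z" "adjacent k Z Y"
    using adj_sym by blast
  then show "fan k U W X Y"
  proof cases
    case 3
    obtain Z' where Z': "adjacent k Z' U" "adjacent k Z' Z" "Z' \<subseteq> join U Z" "\<not> U \<inter> Z \<subseteq> Z'"
      using top_outside[OF 3(2) k(1)] .
    have H: "join U W = join U Z" using join_subset_iff_eq[OF a(1) 3(2) k1] 3(1) by blast
    have ZU: "adjacent k Z U" "adjacent k Z Z'" using 3(2) Z' adj_sym by blast+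
    have H': "join Z U = join Z Z'" using join_subset_iff_eq[OF ZU k1] Z'(3) by (simp add: join_commute)
    have "wedge k Z U Z'"
      unfolding wedge_iff[OF k] using ZU H' meet_subset_iff[OF ZU k1] Z'(4) by (simp add: Int_commute)
    moreover have "row k Z U Z' Y"
      unfolding row_top[OF calculation H'] using 3(3) H Y by (simp add: join_commute)
    moreover have "row k U W X Z" "row k U W X Z'" using row 3 Z' H adj_sym by auto
    ultimately show ?thesis unfolding fan_def using adjD(2)[OF 3(2) k1] adjD(1)[OF Z'(1) k1] by blast
  qed (use Y row in \<open>auto simp: fan_def\<close>)
qed

lemma star_wedge:
  assumes "H \<in> TR (k - 1)"
  obtains U W X where "wedge k U W X" "U \<inter> W = H" "U \<inter> X = H"
proof -
  obtain U where U: "U \<in> TR k" "H \<subseteq> U" using star_nonempty[OF assms k1] k by auto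
  obtain W where W: "adjacent k U W" "H \<subseteq> W" using star_neighbour[OF assms U k1] k by auto
  have H: "U \<inter> W = H" using TR_eqI[OF assms adjD(4)[OF W(1) k1]] U W by blast
  obtain X where X: "adjacent k X U" "adjacent k X W" "U \<inter> W \<subseteq> X" "\<not> X \<subseteq> join U W"
    using star_outside[OF W(1) k1 k(2)] .
  have a: "adjacent k U X" using X(1) by (rule adj_sym)
  have "U \<inter> X = H" using meet_subset_iff[OF W(1) a k1] X(3) H by simp
  moreover have "wedge k U W X"
    unfolding wedge_iff[OF k] using W(1) a H calculation join_subset_iff_eq[OF W(1) a k1] X(4) by simp
  ultimately show thesis using that H by blast
qed

text \<open>\<open>U\<close> and \<open>W\<close> are obtained as complements of neighbours in the
  dual star of \<open>orth B\<close>; only \<open>X\<close> needs a construction in the top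
  itself.\<close>

lemma top_wedge:
  assumes "B \<in> TR (k + 1)"
  obtains U W X where "wedge k U W X" "join U W = B" "join U X = B"
proof -
  have kd: "1 \<le> dimension - k" "dimension - k + 1 \<le> dimension" "k + 1 \<le> dimension" using k by auto
  have s: "subspace B" using assms TR_D(1) by blast
  have B: "orth B \<in> TR (dimension - k - 1)" using TR_orth[OF assms] by simp
  obtain U' where U': "U' \<in> TR (dimension - k)" "orth B \<subseteq> U'" using star_nonempty[OF B kd(1)] by auto
  obtain W' where W': "adjacent (dimension - k) U' W'" "orth B \<subseteq> W'" using star_neighbour[OF B U' kd(1,2)] .
  define U W where "U = orth U'" "W = orth W'"
  have a: "adjacent k U W" using adj_dual[OF W'(1) k1 kd(3)] by (simp add: U_W_def)
  have "U \<subseteq> B" "W \<subseteq> B" using U' W' TR_D(1)[OF U'(1)] adj_subspace[OF W'(1)] s by (simp_all add: U_W_def orth_mem_iff)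
  then have J: "join U W = B" using TR_eqI[OF adjD(5)[OF a k1] assms] s by (simp add: join_subset_iff)
  obtain X where X: "adjacent k X U" "adjacent k X W" "X \<subseteq> join U W" "\<not> U \<inter> W \<subseteq> X"
    using top_outside[OF a k(1)] .
  have aX: "adjacent k U X" using X(1) by (rule adj_sym)
  have "join U X = B" using join_subset_iff_eq[OF a aX k1] X(3) J by simp
  moreover have "wedge k U W X"
    unfolding wedge_iff[OF k] using a aX J calculation meet_subset_iff[OF a aX k1] X(4) by simp
  ultimately show thesis using that J by blast
qed

end

section \<open>Telling stars from tops\<close>

definition star :: "nat \<Rightarrow> 'v set \<Rightarrow> 'v set set" where
  "star k H = {Y \<in> TR k. H \<subseteq> Y}"

definition costar :: "nat \<Rightarrow> 'v set \<Rightarrow> 'v set set" where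
  "costar k B = {Y \<in> TR k. Y \<subseteq> B}"

text \<open>Both types together, because adjacency of stars must be definable before the types are
  told apart.\<close>

definition Cl :: "nat \<Rightarrow> 'v set set set" where
  "Cl k = star k ` TR (k - 1) \<union> costar k ` TR (k + 1)"

lemma star_iff: "Y \<in> star k H \<longleftrightarrow> Y \<in> TR k \<and> H \<subseteq> Y"
  by (simp add: star_def)

lemma costar_iff: "Y \<in> costar k B \<longleftrightarrow> Y \<in> TR k \<and> Y \<subseteq> B"
  by (simp add: costar_def)

lemma star_subset: "star k H \<subseteq> TR k"
  by (auto simp: star_def)

lemma costar_subset: "costar k B \<subseteq> TR k"
  by (auto simp: costar_def)

lemma orth_star:
  assumes "subspace H" "k \<le> dimension"
  shows "orth ` star k H = costar (dimension - k) (orth H)"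
proof
  show "orth ` star k H \<subseteq> costar (dimension - k) (orth H)"
    by (rule image_subsetI) (simp add: star_iff costar_iff TR_orth orth_antimono)
  show "costar (dimension - k) (orth H) \<subseteq> orth ` star k H"
  proof
    fix Y assume Y: "Y \<in> costar (dimension - k) (orth H)"
    then have s: "subspace Y" by (auto simp: costar_iff dest: TR_D(1))
    have "orth Y \<in> TR k" using TR_orth[of Y "dimension - k"] Y assms(2) by (simp add: costar_iff)
    moreover have "H \<subseteq> orth Y" using Y by (simp add: costar_iff subset_orth_iff)
    ultimately have "orth Y \<in> star k H" by (simp add: star_iff)
    then show "Y \<in> orth ` star k H" using s by (metis image_eqI orth_orth)
  qed
qed

lemma orth_image_image: "\<kappa> \<subseteq> TR k \<Longrightarrow> orth ` orth ` \<kappa> = \<kappa>"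
  using TR_D(1) by (force simp: image_image)

lemma orth_top:
  assumes "subspace B" "k \<le> dimension"
  shows "orth ` costar k B = star (dimension - k) (orth B)"
proof -
  have "costar k B = orth ` star (dimension - k) (orth B)"
    using orth_star[of "orth B" "dimension - k"] assms by simp
  then show ?thesis using orth_image_image[OF star_subset] by simp
qed

lemma Cl_subset: "x \<in> Cl k \<Longrightarrow> x \<subseteq> TR k"
  by (auto simp: Cl_def star_def costar_def)

lemma orth_Cl:
  assumes "x \<in> Cl k" "1 \<le> k" "k + 1 \<le> dimension"
  shows "orth ` x \<in> Cl (dimension - k)"
proof -
  consider H where "H \<in> TR (k - 1)" "x = star k H" | B where "B \<in> TR (k + 1)" "x = costar k B"
    using assms(1) by (auto simp: Cl_def)
  then show ?thesis
  proof cases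
    case 1
    then have "orth H \<in> TR (dimension - k + 1)" using TR_orth[OF 1(1)] assms by (simp add: Suc_diff_Suc Suc_diff_le)
    then show ?thesis using 1 orth_star[OF TR_D(1)[OF 1(1)]] assms by (simp add: Cl_def)
  next
    case 2
    then have "orth B \<in> TR (dimension - k - 1)" using TR_orth[OF 2(1)] by simp
    then show ?thesis using 2 orth_top[OF TR_D(1)[OF 2(1)]] assms by (simp add: Cl_def)
  qed
qed

lemma star_Int:
  assumes "H \<in> TR (k - 1)" "H' \<in> TR (k - 1)" "H \<noteq> H'" "U \<in> star k H" "U \<in> star k H'" "1 \<le> k"
  shows "star k H \<inter> star k H' = {U}" "join H H' = U"
proof -
  have "join H H' = Y" if "Y \<in> star k H" "Y \<in> star k H'" for Y
    using that assms(6) TR_D[of Y k] by (intro join_eqI[OF assms(1-3)]) (auto simp: star_iff)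
  then show "star k H \<inter> star k H' = {U}" "join H H' = U" using assms by blast+
qed

lemma top_Int:
  assumes "B \<in> TR (k + 1)" "B' \<in> TR (k + 1)" "B \<noteq> B'" "U \<in> costar k B" "U \<in> costar k B'"
  shows "costar k B \<inter> costar k B' = {U}"
proof -
  have "B \<inter> B' = Y" if "Y \<in> costar k B" "Y \<in> costar k B'" for Y
    using that TR_D[of Y k] by (intro Int_eqI[OF assms(1-3)]) (auto simp: costar_iff)
  then show ?thesis using assms by blast
qed

lemma star_two:
  assumes "H \<in> TR (k - 1)" "1 \<le> k" "k + 1 \<le> dimension"
  obtains U W where "U \<in> star k H" "W \<in> star k H" "U \<noteq> W"
proof -
  obtain U where U: "U \<in> TR k" "H \<subseteq> U" using star_nonempty[OF assms(1,2)] assms(3) by auto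
  obtain W where W: "adjacent k U W" "H \<subseteq> W" using star_neighbour[OF assms(1) U assms(2,3)] .
  then show thesis using that U adjD[OF W(1) assms(2)] by (auto simp: star_iff)
qed

text \<open>The dimension is even, so \<open>2 * k < dimension\<close> gives at least 2 k + 2, which
  is at least k + 4.\<close>

lemma even_codim_ge:
  assumes "even k" "2 \<le> k" "2 * k < dimension"
  shows "k + 4 \<le> dimension"
proof -
  have "dimension \<noteq> 2 * k + 1" using even_dimension by (metis even_plus_one_iff even_mult_iff even_numeral)
  then show ?thesis using assms by (cases "k = 2"; cases "k = 3") auto
qed

subsection \<open>Odd dimension: covering numbers\<close>

text \<open>The elements of \<open>\<kappa>\<close> being the points of a symplectic space, this
  says that \<open>m\<close> of them have no common orthogonal point. The least such
  \<open>m\<close> is the dimension of that space.\<close>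

definition cover :: "nat \<Rightarrow> nat \<Rightarrow> 'v set set \<Rightarrow> bool" where
  "cover k m \<kappa> \<longleftrightarrow> (\<exists>ps. length ps = m \<and> set ps \<subseteq> \<kappa> \<and> (\<forall>q\<in>\<kappa>. \<exists>p\<in>set ps. adjacent k q p))"

lemma exists_orth_to_few:
  assumes "finite B" "subspace S" "card B < dim S"
  obtains q where "q \<in> S" "q \<noteq> 0" "\<And>b. b \<in> B \<Longrightarrow> \<xi> q b = 0"
proof -
  have "dim (S \<inter> orth B) \<noteq> 0" using dim_inter_orth_le[OF assms(1,2)] assms(3) by linarith
  then obtain q where "q \<in> S \<inter> orth B" "q \<noteq> 0" by (metis dim_eq_0 singletonI subsetI)
  then show thesis using that by (auto simp: orth_def)
qed

lemma dim_orth_hyperplane: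
  assumes "H \<in> TR (k - 1)" "1 \<le> k" "k \<le> dimension"
  shows "dim (orth H) = dimension - k + 1"
  using dim_orth[OF TR_D(1)[OF assms(1)]] TR_D(2)[OF assms(1)] assms(2,3) by simp

text \<open>Fewer vectors than the dimension of \<open>orth H\<close> have a nonzero common
  orthogonal vector in \<open>orth H\<close>.\<close>

lemma star_not_cover:
  assumes "odd k" "H \<in> TR (k - 1)" "m < dimension - k + 1" "k \<le> dimension"
  shows "\<not> cover k m (star k H)"
proof
  have k: "1 \<le> k" using assms(1) by (cases k) auto
  assume "cover k m (star k H)"
  then obtain ps where ps: "length ps = m" "set ps \<subseteq> star k H"
    "\<And>q. q \<in> star k H \<Longrightarrow> \<exists>p\<in>set ps. adjacent k q p"
    unfolding cover_def by blast
  have "\<exists>y. y \<in> orth H \<and> y \<noteq> 0 \<and> p = ext H y" if "p \<in> set ps" for p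
    using odd_star[OF assms(1,2), of p] ps(2) that by (metis star_iff subsetD)
  then obtain y where y: "\<And>p. p \<in> set ps \<Longrightarrow> y p \<in> orth H \<and> y p \<noteq> 0 \<and> p = ext H (y p)" by metis
  have "card (y ` set ps) \<le> m" using card_image_le[of "set ps" y] card_length[of ps] ps(1) by simp
  then obtain q where q: "q \<in> orth H" "q \<noteq> 0" "\<And>p. p \<in> set ps \<Longrightarrow> \<xi> q (y p) = 0"
    using exists_orth_to_few[of "y ` set ps" "orth H"] dim_orth_hyperplane[OF assms(2) k assms(4)] assms(3)
    by (metis List.finite_set finite_imageI imageI le_less_trans subspace_orth)
  have "ext H q \<in> star k H" using odd_ext[OF assms(1,2) q(1,2)] ext_upper by (simp add: star_iff)
  then obtain p where p: "p \<in> set ps" "adjacent k (ext H q) p" using ps(3) by blast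
  then show False using odd_adj[OF assms(1,2) q(1,2), of "y p"] y[OF p(1)] q(3)[OF p(1)] by metis
qed

text \<open>A basis of \<open>orth H\<close> covers: a vector orthogonal to all of it lies in
  \<open>H\<close> as well as in \<open>orth H\<close>.\<close>

lemma star_cover:
  assumes "odd k" "H \<in> TR (k - 1)" "k \<le> dimension"
  shows "cover k (dimension - k + 1) (star k H)"
proof -
  have k: "1 \<le> k" using assms(1) by (cases k) auto
  obtain B where B: "B \<subseteq> orth H" "independent B" "orth H \<subseteq> span B" "card B = dim (orth H)"
    using basis_exists by blast
  have fin: "finite B" using B(2) by (rule finiteI_independent)
  obtain bs where bs: "set bs = B" "length bs = card B" using fin finite_distinct_list distinct_card by metis
  have B0: "b \<noteq> 0" if "b \<in> B" for b using B(2) that dependent_zero by blast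
  show ?thesis unfolding cover_def
  proof (intro exI[of _ "map (ext H) bs"] conjI ballI)
    show "length (map (ext H) bs) = dimension - k + 1"
      using bs B(4) dim_orth_hyperplane[OF assms(2) k assms(3)] by simp
    show "set (map (ext H) bs) \<subseteq> star k H"
      using odd_ext[OF assms(1,2)] B(1) B0 bs(1) ext_upper(1) by (auto simp: star_iff)
    fix q assume "q \<in> star k H"
    then obtain y where y: "y \<in> orth H" "y \<noteq> 0" "q = ext H y" using odd_star[OF assms(1,2)] by (metis star_iff)
    have "\<exists>b\<in>B. \<xi> y b \<noteq> 0"
    proof (rule ccontr)
      assume "\<not> (\<exists>b\<in>B. \<xi> y b \<noteq> 0)"
      then have "y \<in> orth (span B)" by (simp add: orth_iff[of y B])
      then have "y \<in> orth (orth H)" using orth_antimono[OF B(3)] by blast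
      then have "y \<in> H" using TR_D(1)[OF assms(2)] by simp
      then show False using regular_inter_orth[OF odd_regular[OF assms(1,2)]] y by blast
    qed
    then obtain b where b: "b \<in> B" "\<xi> y b \<noteq> 0" by blast
    then have "adjacent k q (ext H b)"
      using odd_adj[OF assms(1,2) y(1,2), of b] B(1) B0 y(3) by blast
    then show "\<exists>p\<in>set (map (ext H) bs). adjacent k q p" using b(1) bs(1) by auto
  qed
qed

text \<open>The dual star consists of the points of \<open>orth (orth B) = B\<close>, of dimension
  \<open>k + 1\<close>.\<close>

lemma top_cover:
  assumes "odd k" "B \<in> TR (k + 1)"
  shows "cover k (k + 1) (costar k B)"
proof -
  have k: "1 \<le> k" "k + 1 \<le> dimension" using assms TR_dim_le[OF assms(2)] by (cases k; auto)+
  have odd: "odd (dimension - k)" using assms(1) even_dimension k by simp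
  have "orth B \<in> TR (dimension - k - 1)" using TR_orth[OF assms(2)] by simp
  then have "cover (dimension - k) (dimension - (dimension - k) + 1) (star (dimension - k) (orth B))"
    by (rule star_cover[OF odd]) simp
  then obtain ps where ps: "length ps = k + 1" "set ps \<subseteq> star (dimension - k) (orth B)"
    "\<And>q. q \<in> star (dimension - k) (orth B) \<Longrightarrow> \<exists>p\<in>set ps. adjacent (dimension - k) q p"
    using k unfolding cover_def by auto
  have eq: "orth ` costar k B = star (dimension - k) (orth B)"
    using orth_top[OF TR_D(1)[OF assms(2)]] k by simp
  then have eq': "orth ` star (dimension - k) (orth B) = costar k B"
    using orth_image_image[OF costar_subset, of k B] by simp
  show ?thesis unfolding cover_def
  proof (intro exI[of _ "map orth ps"] conjI ballI)
    show "set (map orth ps) \<subseteq> costar k B" using ps(2) eq' by auto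
    fix q assume q: "q \<in> costar k B"
    then have "orth q \<in> star (dimension - k) (orth B)" using eq by blast
    then obtain p where p: "p \<in> set ps" "adjacent (dimension - k) (orth q) p" using ps(3) by blast
    have "subspace q" using q TR_D(1) by (auto simp: costar_iff)
    then have "adjacent k q (orth p)" using adj_dual[OF p(2) k] by simp
    then show "\<exists>p\<in>set (map orth ps). adjacent k q p" using p(1) by auto
  qed (use ps in simp)
qed

subsection \<open>Even dimension: adjacency of stars\<close>

definition one :: "'v set set \<Rightarrow> 'v set set \<Rightarrow> bool" where
  "one x y \<longleftrightarrow> (\<exists>c. x \<inter> y = {c})"

text \<open>For stars \<open>\<kappa>\<close>, \<open>\<kappa>'\<close> of hyperplanes \<open>H\<close>, \<open>H'\<close> of a regular space, \<open>x\<close>, \<open>y\<close>, \<open>z\<close> are stars of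
  spaces containing \<open>G = H \<inter> H'\<close>. If \<open>G\<close> has a two-dimensional radical, having no common neighbour
  is an equivalence relation among these spaces; if \<open>G\<close> is regular, it is orthogonality of points
  in \<open>orth G\<close>, which is not transitive.\<close>

definition star_adj :: "nat \<Rightarrow> 'v set set \<Rightarrow> 'v set set \<Rightarrow> bool" where
  "star_adj k \<kappa> \<kappa>' \<longleftrightarrow> (\<exists>c. \<kappa> \<inter> \<kappa>' = {c} \<and> (\<exists>x\<in>Cl k. \<exists>y\<in>Cl k. \<exists>z\<in>Cl k.
     c \<notin> x \<and> c \<notin> y \<and> c \<notin> z \<and> one x \<kappa> \<and> one x \<kappa>' \<and> one y \<kappa> \<and> one y \<kappa>' \<and> one z \<kappa> \<and> one z \<kappa>' \<and>
     one x z \<and> (x = y \<or> x \<inter> y = {}) \<and> (y = z \<or> y \<inter> z = {})))"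

text \<open>The definition speaks only of intersections of members of \<open>Cl\<close>, and the
  complement is an injection preserving \<open>Cl\<close>.\<close>

lemma star_adj_orth:
  assumes "star_adj k \<kappa> \<kappa>'" "\<kappa> \<in> Cl k" "\<kappa>' \<in> Cl k" "1 \<le> k" "k + 1 \<le> dimension"
  shows "star_adj (dimension - k) (orth ` \<kappa>) (orth ` \<kappa>')"
proof -
  obtain c x y z where c: "\<kappa> \<inter> \<kappa>' = {c}" and xyz: "x \<in> Cl k" "y \<in> Cl k" "z \<in> Cl k"
     "c \<notin> x" "c \<notin> y" "c \<notin> z" "one x \<kappa>" "one x \<kappa>'" "one y \<kappa>" "one y \<kappa>'" "one z \<kappa>" "one z \<kappa>'"
     "one x z" "x = y \<or> x \<inter> y = {}" "y = z \<or> y \<inter> z = {}"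
    using assms(1) unfolding star_adj_def by (elim exE bexE conjE) (rule that)
  have inj: "inj_on orth (TR k)" by (rule inj_onI) (metis TR_D(1) orth_orth)
  have Int: "orth ` a \<inter> orth ` b = orth ` (a \<inter> b)" if "a \<in> Cl k" "b \<in> Cl k" for a b
    using inj_on_image_Int[OF inj Cl_subset[OF that(1)] Cl_subset[OF that(2)]] by simp
  have one: "one (orth ` a) (orth ` b)" if ab: "one a b" "a \<in> Cl k" "b \<in> Cl k" for a b
  proof -
    obtain d where "a \<inter> b = {d}" using ab(1) unfolding one_def by (elim exE) (rule that)
    then have "orth ` a \<inter> orth ` b = {orth d}" using Int[OF ab(2,3)] by simp
    then show ?thesis unfolding one_def by (rule exI)
  qed
  have nin: "orth c \<notin> orth ` a" if "c \<notin> a" "a \<in> Cl k" for a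
  proof
    have "c \<in> \<kappa> \<inter> \<kappa>'" using c by simp
    then have "c \<in> TR k" using Cl_subset[OF assms(2)] by auto
    moreover assume "orth c \<in> orth ` a"
    ultimately have "c \<in> a" using inj_on_image_mem_iff[OF inj _ Cl_subset[OF that(2)]] by simp
    then show False using that(1) by simp
  qed
  have Cl: "orth ` a \<in> Cl (dimension - k)" if "a \<in> Cl k" for a using orth_Cl[OF that assms(4,5)] .
  have "orth ` \<kappa> \<inter> orth ` \<kappa>' = {orth c}" using Int[OF assms(2,3)] c by simp
  moreover have "orth ` x = orth ` y \<or> orth ` x \<inter> orth ` y = {}" using xyz(14) Int[OF xyz(1,2)] by auto
  moreover have "orth ` y = orth ` z \<or> orth ` y \<inter> orth ` z = {}" using xyz(15) Int[OF xyz(2,3)] by auto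
  ultimately show ?thesis unfolding star_adj_def
    by (intro exI[of _ "orth c"] conjI bexI[of _ "orth ` x"] bexI[of _ "orth ` y"] bexI[of _ "orth ` z"]
        one nin Cl xyz(1-13) assms(2,3))
qed

text \<open>With one common element \<open>c\<close>, a vector of \<open>B\<close> off both
  \<open>orth {h}\<close> and \<open>c\<close> yields a second one. Hence members of
  \<open>Cl\<close> that share exactly one element are of the same type.\<close>

lemma star_top_not_one:
  assumes "even k" "H \<in> TR (k - 1)" "B \<in> TR (k + 1)" "1 \<le> k"
  shows "\<not> one (star k H) (costar k B)"
proof
  assume "one (star k H) (costar k B)"
  then obtain c where c: "star k H \<inter> costar k B = {c}" by (auto simp: one_def)
  then have "c \<in> star k H \<inter> costar k B" by simp
  then have c': "c \<in> TR k" "H \<subseteq> c" "c \<subseteq> B" by (simp_all add: star_iff costar_iff)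
  have "odd (k - 1)" using assms(1,4) by simp
  then obtain h where h: "h \<noteq> 0" "Rad H = span {h}" using TR_odd_Rad assms(2) by metis
  have "\<not> c \<subseteq> H" using dim_subset[of c H] TR_D(2)[OF c'(1)] TR_D(2)[OF assms(2)] assms(4) by auto
  then obtain a where a: "a \<in> c" "a \<notin> H" by blast
  have "\<xi> h a \<noteq> 0" by (rule even_Rad_nonorth[OF assms(1,2) h(2) c'(1,2) a h(1) assms(4)])
  then have aB: "\<not> B \<subseteq> orth {h}" using a(1) c'(3) xi_eq_0_sym by (auto simp: orth_singleton)
  have "\<not> B \<subseteq> c" using dim_subset[of B c] TR_D(2)[OF c'(1)] TR_D(2)[OF assms(3)] by auto
  then obtain y where y: "y \<in> B" "y \<notin> orth {h}" "y \<notin> c"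
    using not_covered_by_two_subspaces[OF subspace_orth TR_D(1)[OF c'(1)] TR_D(1)[OF assms(3)] aB] by blast
  then have "\<xi> h y \<noteq> 0" using xi_eq_0_sym by (auto simp: orth_singleton)
  then have "ext H y \<in> TR k" by (rule even_ext(1)[OF assms(1,4,2) h(2)])
  moreover have "ext H y \<subseteq> B" using c' y TR_D(1)[OF assms(3)] by (intro ext_least) auto
  ultimately have "ext H y \<in> star k H \<inter> costar k B" using ext_upper by (simp add: star_iff costar_iff)
  then show False using c y(3) ext_upper(2)[of y H] by auto
qed

lemma one_commute: "one x y \<longleftrightarrow> one y x"
  by (simp add: one_def Int_commute)

lemma Cl_one_star:
  assumes "even k" "H \<in> TR (k - 1)" "1 \<le> k" "x \<in> Cl k" "one x (star k H)"
  obtains X where "X \<in> TR (k - 1)" "x = star k X"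
  using assms star_top_not_one[OF assms(1,2) _ assms(3)] unfolding Cl_def by (auto simp: one_commute)

lemma star_inj:
  assumes "star k H = star k H'" "H \<in> TR (k - 1)" "H' \<in> TR (k - 1)" "1 \<le> k" "k + 1 \<le> dimension"
  shows "H = H'"
proof (rule ccontr)
  assume ne: "H \<noteq> H'"
  obtain U W where "U \<in> star k H" "W \<in> star k H" "U \<noteq> W" using star_two[OF assms(2,4,5)] .
  then show False using star_Int(2)[OF assms(2,3) ne _ _ assms(4), of U] star_Int(2)[OF assms(2,3) ne _ _ assms(4), of W] assms(1)
    by auto
qed

lemma star_not_single:
  assumes "H \<in> TR (k - 1)" "1 \<le> k" "k + 1 \<le> dimension"
  shows "star k H \<noteq> {c}"
  using star_two[OF assms] by (metis singletonD)

text \<open>Suppose \<open>R = Rad G\<close> has dimension at least 2. Every \<open>X\<close> in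
  \<open>TR (k - 1)\<close> containing \<open>G\<close> determines a point
  \<open>R \<inter> orth X\<close> of \<open>R\<close>. Spaces with equal or disjoint stars have the
  same point, spaces with a common regular neighbour do not; the chain from \<open>x\<close> over
  \<open>y\<close> to \<open>z\<close> contradicts this.\<close>

lemma star_adj_star:
  assumes "even k" "2 \<le> k" "k + 2 \<le> dimension" "H \<in> TR (k - 1)" "H' \<in> TR (k - 1)"
    and PP: "star_adj k (star k H) (star k H')"
  shows "adjacent (k - 1) H H'"
proof -
  have k: "1 \<le> k" "1 \<le> k - 1" "k + 1 \<le> dimension" "k - 1 - 1 = k - 2" "k - 1 + 1 = k" using assms(2,3) by auto
  obtain U x y z where U: "star k H \<inter> star k H' = {U}" and xyz: "x \<in> Cl k" "y \<in> Cl k" "z \<in> Cl k"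
     "U \<notin> x" "U \<notin> y" "U \<notin> z" "one x (star k H)" "one x (star k H')" "one y (star k H)" "one y (star k H')"
     "one z (star k H)" "one z (star k H')"
     "one x z" "x = y \<or> x \<inter> y = {}" "y = z \<or> y \<inter> z = {}"
    using PP unfolding star_adj_def by (elim exE bexE conjE) (rule that)
  have "U \<in> star k H \<inter> star k H'" using U by simp
  then have U': "U \<in> TR k" "H \<subseteq> U" "H' \<subseteq> U" by (simp_all add: star_iff)
  have ne: "H \<noteq> H'" using star_not_single[OF assms(4) k(1,3)] U by auto
  have J: "join H H' = U" using star_Int(2)[OF assms(4,5) ne _ _ k(1), of U] U' by (simp add: star_iff)
  have sH: "subspace H" "subspace H'" "dim H = k - 1" "dim H' = k - 1"
    using TR_D[OF assms(4)] TR_D[OF assms(5)] by auto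
  define G where "G = H \<inter> H'"
  have sG: "subspace G" unfolding G_def using sH by (intro subspace_inter)
  have dG: "dim G = k - 2" using dim_join[OF sH(1,2)] J TR_D(2)[OF U'(1)] sH assms(2) by (simp add: G_def)
  show ?thesis
  proof (cases "rdim G \<le> 1")
    case True
    then have "G \<in> TR (k - 1 - 1)" using sG dG k by (simp add: TR_def)
    then show ?thesis using U' k by (intro adjI[OF k(2) assms(4,5) ne]) (auto simp: G_def)
  next
    case False
    define R where "R = Rad G"
    have sR: "subspace R" and dR: "2 \<le> dim R" using False sG by (simp_all add: R_def rdim_def)
    have RG: "R \<subseteq> G" "\<And>r g. r \<in> R \<Longrightarrow> g \<in> G \<Longrightarrow> \<xi> r g = 0" by (auto simp: R_def Rad_iff)
    have GR: "\<xi> g r = 0" if "r \<in> R" "g \<in> G" for r g using RG(2)[OF that] xi_eq_0_sym by blast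
    \<comment> \<open>If \<open>X\<close> did not contain \<open>G\<close>, its intersections with
      \<open>H\<close> and \<open>H'\<close> would differ and span it inside \<open>U\<close>,
      against \<open>U \<notin> x\<close>.\<close>
    have good: "\<exists>X. X \<in> TR (k - 1) \<and> x = star k X \<and> G \<subseteq> X"
      if x: "x \<in> Cl k" "U \<notin> x" "one x (star k H)" "one x (star k H')" for x
    proof -
      obtain X where X: "X \<in> TR (k - 1)" "x = star k X" using Cl_one_star[OF assms(1,4) k(1) x(1,3)] .
      have XU: "\<not> X \<subseteq> U" using x(2) X(2) U'(1) by (simp add: star_iff)
      then have XH: "X \<noteq> H" "X \<noteq> H'" using U' by auto
      have sX: "subspace X" "dim X = k - 1" using TR_D X(1) by auto
      have d: "dim (X \<inter> L) = k - 2" if L: "L \<in> TR (k - 1)" "X \<noteq> L" "one x (star k L)" for L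
      proof -
        obtain c where "star k X \<inter> star k L = {c}" using L(3) X(2) by (auto simp: one_def)
        then have "c \<in> star k X \<inter> star k L" by simp
        then have "join X L = c" "c \<in> TR k"
          using star_Int(2)[OF X(1) L(1,2) _ _ k(1), of c] by (simp_all add: star_iff)
        then show ?thesis
          using dim_join[OF sX(1) TR_D(1)[OF L(1)]] sX TR_D(2)[OF L(1)] TR_D(2)[of c k] assms(2) by simp
      qed
      have dXH: "dim (X \<inter> H) = k - 2" "dim (X \<inter> H') = k - 2" using d assms(4,5) XH x by auto
      have "G \<subseteq> X"
      proof (rule ccontr)
        assume nG: "\<not> G \<subseteq> X"
        have "\<not> X \<inter> H \<subseteq> X \<inter> H'"
        proof
          assume "X \<inter> H \<subseteq> X \<inter> H'"
          then have "X \<inter> H \<subseteq> G" by (auto simp: G_def)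
          then have "X \<inter> H = G" using dXH dG sX sH sG by (intro subspace_dim_equal subspace_inter) auto
          then show False using nG by blast
        qed
        then obtain a where a: "a \<in> X" "a \<in> H" "a \<notin> X \<inter> H'" by blast
        have "X = ext (X \<inter> H') a"
          using a sX sH dXH by (intro ext_eqI subspace_inter) auto
        moreover have "ext (X \<inter> H') a \<subseteq> U" using a U' TR_D(1)[OF U'(1)] by (intro ext_least) auto
        ultimately show False using XU by simp
      qed
      then show ?thesis using X by blast
    qed
    obtain X where X: "X \<in> TR (k - 1)" "x = star k X" "G \<subseteq> X" using good[OF xyz(1,4,7,8)] by blast
    obtain Y where Y: "Y \<in> TR (k - 1)" "y = star k Y" "G \<subseteq> Y" using good[OF xyz(2,5,9,10)] by blast
    obtain Z where Z: "Z \<in> TR (k - 1)" "z = star k Z" "G \<subseteq> Z" using good[OF xyz(3,6,11,12)] by blast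
    \<comment> \<open>\<open>X\<close> is \<open>G\<close> plus one vector, hence one condition on
      \<open>R\<close>, which leaves dimension at least 1; the intersection lies in
      \<open>Rad X\<close>, of dimension at most 1.\<close>
    have dim_rho: "dim (R \<inter> orth X) = 1" if X: "X \<in> TR (k - 1)" "G \<subseteq> X" for X
    proof -
      have sX: "subspace X" "dim X = k - 1" "rdim X \<le> 1" using TR_D X(1) by auto
      have "\<not> X \<subseteq> G" using dim_subset[of X G] dG sX assms(2) by auto
      then obtain v where v: "v \<in> X" "v \<notin> G" by blast
      have Xe: "X = ext G v" using v sX dG sG X(2) by (intro ext_eqI) auto
      have "R \<inter> orth {v} \<subseteq> R \<inter> orth X"
      proof
        fix r assume r: "r \<in> R \<inter> orth {v}"
        then have "ext G v \<subseteq> orth {r}"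
          using GR xi_skew[of v r] by (intro ext_least subspace_orth) (auto simp: orth_singleton)
        then show "r \<in> R \<inter> orth X" using r Xe subset_orth_iff[of X "{r}"] by auto
      qed
      then have "dim (R \<inter> orth {v}) \<le> dim (R \<inter> orth X)" by (rule dim_subset)
      moreover have "dim R \<le> dim (R \<inter> orth {v}) + 1" by (rule dim_inter_perp_le[OF sR])
      moreover have "dim (R \<inter> orth X) \<le> rdim X"
        unfolding rdim_def Rad_def using RG(1) X(2) by (intro dim_subset) auto
      ultimately show ?thesis using dR sX(3) by linarith
    qed
    have rho_eq: "R \<inter> orth X = R \<inter> orth Y"
      if X: "X \<in> TR (k - 1)" "G \<subseteq> X" and Y: "Y \<in> TR (k - 1)" "G \<subseteq> Y"
        and XY: "star k X = star k Y \<or> star k X \<inter> star k Y = {}" for X Y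
    proof (cases "X = Y")
      case False
      have dis: "star k X \<inter> star k Y = {}"
        using XY star_inj[OF _ X(1) Y(1) k(1,3)] False by blast
      let ?J = "join X Y"
      have dJ: "dim ?J = k"
        using dim_Int_join[OF X(1) Y(1) False sG X(2) Y(2)] dG assms(2) by simp
      have GJ: "G \<subseteq> ?J" using X(2) line_upper[where U=X and W=Y] by blast
      have "?J \<notin> TR k" using dis line_upper[where U=X and W=Y] by (auto simp: star_iff)
      then have "Rad ?J \<noteq> {0}" using TR_even[OF assms(1)] dJ by simp
      moreover have "0 \<in> Rad ?J" by (intro subspace_0 subspace_Rad subspace_join)
      ultimately obtain s where s: "s \<in> Rad ?J" "s \<noteq> 0" by blast
      \<comment> \<open>A radical vector \<open>s\<close> of the join either lies in
        \<open>R\<close>, or the join is \<open>G\<close> plus \<open>s\<close> plus one vector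
        \<open>t\<close>; then only \<open>t\<close> imposes a condition on \<open>R\<close>, whose
        dimension is at least 2.\<close>
      have "\<exists>r. r \<in> R \<inter> orth ?J \<and> r \<noteq> 0"
      proof (cases "s \<in> G")
        case True
        then have "s \<in> R" using s(1) GJ by (auto simp: R_def Rad_iff)
        then show ?thesis using s by (auto simp: Rad_def)
      next
        case sG': False
        let ?G' = "ext G s"
        have dG': "dim ?G' = k - 1" using dim_ext[OF sG sG'] dG assms(2) by simp
        have G'J: "?G' \<subseteq> ?J" using s(1) GJ by (intro ext_least) (auto simp: Rad_iff)
        have "\<not> ?J \<subseteq> ?G'" using dim_subset[of ?J ?G'] dG' dJ assms(2) by auto
        then obtain t where t: "t \<in> ?J" "t \<notin> ?G'" by blast
        have Je: "?J = ext ?G' t" using t dG' dJ G'J assms(2) by (intro ext_eqI) auto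
        have "dim (R \<inter> orth {t}) \<noteq> 0" using dim_inter_perp_le[OF sR, of t] dR by linarith
        then obtain r where r: "r \<in> R" "\<xi> r t = 0" "r \<noteq> 0"
          by (metis IntE dim_eq_0 orth_singleton singletonI subsetI)
        have "\<xi> s r = 0" using s(1) r(1) RG(1) GJ by (auto simp: Rad_iff)
        then have "ext ?G' t \<subseteq> orth {r}"
          using r GR xi_skew[of t r] by (intro ext_least subspace_orth) (auto simp: orth_singleton)
        then have "r \<in> orth ?J" using Je subset_orth_iff[of ?J "{r}"] by auto
        then show ?thesis using r by blast
      qed
      then obtain r where r: "r \<in> R" "r \<in> orth X" "r \<in> orth Y" "r \<noteq> 0"
        by (auto simp: orth_join)
      have "R \<inter> orth L = span {r}" if L: "L \<in> TR (k - 1)" "G \<subseteq> L" "r \<in> orth L" for L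
      proof (rule subspace_dim_equal[symmetric])
        show s: "subspace (R \<inter> orth L)" using sR by (intro subspace_inter) auto
        show "span {r} \<subseteq> R \<inter> orth L" using r(1) L(3) by (intro span_minimal[OF _ s]) simp
      qed (use dim_rho[OF L(1,2)] r(4) in simp_all)
      then show ?thesis using X Y r by simp
    qed simp
    have "R \<inter> orth X = R \<inter> orth Y"
      by (rule rho_eq[OF X(1,3) Y(1,3)]) (use xyz(14) X(2) Y(2) in simp)
    also have "R \<inter> orth Y = R \<inter> orth Z"
      by (rule rho_eq[OF Y(1,3) Z(1,3)]) (use xyz(15) Y(2) Z(2) in simp)
    finally have XZ: "R \<inter> orth X = R \<inter> orth Z" .
    obtain c where c: "star k X \<inter> star k Z = {c}" using xyz(13) X Z by (auto simp: one_def)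
    have neXZ: "X \<noteq> Z" using c star_not_single[OF X(1) k(1,3)] by auto
    have c2: "c \<in> star k X \<inter> star k Z" using c by simp
    then have cX: "c \<in> TR k" "X \<subseteq> c" "Z \<subseteq> c" by (simp_all add: star_iff)
    have Jc: "join X Z = c" using star_Int(2)[OF X(1) Z(1) neXZ _ _ k(1)] c2 by simp
    have "dim (R \<inter> orth X) \<noteq> 0" using dim_rho[OF X(1,3)] by linarith
    then obtain r where r: "r \<in> R" "r \<in> orth X" "r \<noteq> 0" by (metis IntE dim_eq_0 singletonI subsetI)
    then have "r \<in> orth c" using XZ Jc orth_join by blast
    moreover have "r \<in> c" using r(1) RG(1) X(3) cX by blast
    ultimately have "r \<in> Rad c" by (simp add: Rad_def)
    then show ?thesis using r(3) cX(1) TR_even[OF assms(1)] by simp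
  qed
qed

text \<open>Here \<open>G\<close> is regular and sharing a regular neighbour is non-orthogonality in
  \<open>orth G\<close>; the witnesses show that orthogonality is not transitive there.\<close>

lemma star_adjI:
  assumes "even k" "2 \<le> k" "k + 4 \<le> dimension" "adjacent (k - 1) H H'"
  shows "star_adj k (star k H) (star k H')"
proof -
  have k: "1 \<le> k" "1 \<le> k - 1" "k - 1 + 1 = k" "odd (k - 1)" using assms(1,2) by auto
  note HH = adjD[OF assms(4) k(2)]
  define G where "G = H \<inter> H'"
  define U where "U = join H H'"
  have G: "G \<in> TR (k - 1 - 1)" "G \<subseteq> H" "G \<subseteq> H'" using HH by (auto simp: G_def)
  have U: "U \<in> TR k" "H \<subseteq> U" "H' \<subseteq> U" using HH(5) k(3) line_upper[where U=H and W=H'] by (auto simp: U_def)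
  note adj = odd_adj[OF k(4) G(1)]
  have RU: "Rad U = {0}" using U(1) TR_even[OF assms(1)] by simp
  have sU: "subspace U" "dim U = k" using TR_D U(1) by auto
  obtain h where h: "h \<in> orth G" "h \<noteq> 0" "H = ext G h" using odd_star[OF k(4) G(1) HH(1) G(2)] .
  obtain h' where h': "h' \<in> orth G" "h' \<noteq> 0" "H' = ext G h'" using odd_star[OF k(4) G(1) HH(2) G(3)] .
  have hh': "\<xi> h h' \<noteq> 0" using adj[OF h(1,2) h'(1,2)] assms(4) h h' by simp
  have h'h: "\<xi> h' h = - \<xi> h h'" by (rule xi_skew)
  have hU: "h \<in> U" "h' \<in> U" using h h' U ext_upper by blast+
  have dZ: "dim (orth U) = dimension - k" using dim_orth[OF sU(1)] sU(2) by simp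
  obtain e where e: "e \<in> orth U" "e \<noteq> 0"
    using exists_orth_to_few[of "{}" "orth U"] dZ assms(3) by auto
  have "e \<notin> orth (orth U)" using regular_inter_orth[OF RU] e sU by auto
  then obtain f where f: "f \<in> orth U" "\<xi> e f \<noteq> 0" by (auto simp: orth_iff[of e])
  \<comment> \<open>The bound \<open>k + 4 \<le> dimension\<close> makes room for a \<open>g\<close>
    orthogonal to both of the non-orthogonal vectors \<open>e\<close> and \<open>f\<close>.\<close>
  have "card {e, f} < dim (orth U)" using dZ assms(3) card_insert_le_m1[of 2 "{f}" e] by simp
  then obtain g where g: "g \<in> orth U" "g \<noteq> 0" "\<xi> g e = 0" "\<xi> g f = 0"
    by (rule exists_orth_to_few[of "{e, f}" "orth U", rotated 2]) auto
  have GU: "G \<subseteq> U" using G U by blast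
  \<comment> \<open>The shift by \<open>h + h'\<close> makes \<open>v w\<close> non-orthogonal to
    \<open>h\<close> and \<open>h'\<close>, yet keeps the form between vectors of
    \<open>orth U\<close>, since \<open>h + h'\<close> is isotropic and orthogonal to
    \<open>orth U\<close>.\<close>
  define v where "v w = h + h' + w" for w
  have vG: "v w \<in> orth G" if "w \<in> orth U" for w
    unfolding v_def using h h' that orth_antimono[OF GU] by (intro subspace_add) auto
  have wh: "\<xi> w h = 0" "\<xi> w h' = 0" "\<xi> h w = 0" "\<xi> h' w = 0" if "w \<in> orth U" for w
    using that hU orthD orthD' by auto
  have vh: "\<xi> (v w) h \<noteq> 0" "\<xi> (v w) h' \<noteq> 0" if "w \<in> orth U" for w
    using wh[OF that] hh' h'h by (simp_all add: v_def xi_simps)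
  have v0: "v w \<noteq> 0" if "w \<in> orth U" for w using vh(1)[OF that] by auto
  have vv: "\<xi> (v w) (v w') = \<xi> w w'" if "w \<in> orth U" "w' \<in> orth U" for w w'
    using wh[OF that(1)] wh[OF that(2)] h'h by (simp add: v_def xi_simps)
  define S where "S w = ext G (v w)" for w
  have S: "S w \<in> TR (k - 1)" if "w \<in> orth U" for w
    unfolding S_def by (rule odd_ext[OF k(4) G(1) vG[OF that] v0[OF that]])
  have star1: "one (star k A) (star k B)" if a: "adjacent (k - 1) A B" for A B
  proof -
    note AB = adjD[OF a k(2)]
    have "join A B \<in> star k A" "join A B \<in> star k B"
      using AB(5) k(3) line_upper[where U=A and W=B] by (simp_all add: star_iff)
    then show ?thesis using star_Int(1)[OF AB(1-3) _ _ k(1)] by (auto simp: one_def)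
  qed
  have star0: "star k (S w) = star k (S w') \<or> star k (S w) \<inter> star k (S w') = {}"
    if w: "w \<in> orth U" "w' \<in> orth U" "\<xi> w w' = 0" for w w'
  proof (rule ccontr)
    assume n: "\<not> (star k (S w) = star k (S w') \<or> star k (S w) \<inter> star k (S w') = {})"
    then obtain Y where "Y \<in> star k (S w) \<inter> star k (S w')" by blast
    then have Y: "Y \<in> TR k" "S w \<subseteq> Y" "S w' \<subseteq> Y" by (simp_all add: star_iff)
    have "S w \<noteq> S w'" using n by auto
    moreover have "G \<subseteq> S w" "G \<subseteq> S w'" using ext_upper by (auto simp: S_def)
    ultimately have "adjacent (k - 1) (S w) (S w')"
      using Y S[OF w(1)] S[OF w(2)] G(1) k by (intro adjI[where H=G and B=Y]) auto
    then show False using adj[OF vG[OF w(1)] v0[OF w(1)] vG[OF w(2)] v0[OF w(2)]] vv[OF w(1,2)] w(3)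
      by (simp add: S_def)
  qed
  have SH: "one (star k (S w)) (star k H)" "one (star k (S w)) (star k H')" if "w \<in> orth U" for w
    using adj[OF vG[OF that] v0[OF that] h(1,2)] adj[OF vG[OF that] v0[OF that] h'(1,2)] vh[OF that] h h'
    by (auto simp: S_def intro!: star1)
  have SU: "U \<notin> star k (S w)" if "w \<in> orth U" "w \<noteq> 0" for w
  proof
    assume "U \<in> star k (S w)"
    then have "v w \<in> U" using ext_upper(2)[of "v w" G] by (auto simp: star_iff S_def)
    then have "v w - h - h' \<in> U" using hU sU by (intro subspace_diff) auto
    then have "w \<in> U" by (simp add: v_def)
    then show False using regular_inter_orth[OF RU] that by blast
  qed
  have Cl: "star k (S w) \<in> Cl k" if "w \<in> orth U" for w using S[OF that] by (simp add: Cl_def)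
  have f0: "f \<noteq> 0" using f by auto
  have "adjacent (k - 1) (S e) (S f)"
    unfolding S_def using adj[OF vG[OF e(1)] v0[OF e(1)] vG[OF f(1)] v0[OF f(1)]] vv[OF e(1) f(1)] f(2) by simp
  then have ef: "one (star k (S e)) (star k (S f))" by (rule star1)
  have eg: "\<xi> e g = 0" using g xi_eq_0_sym by blast
  have HU: "star k H \<inter> star k H' = {U}"
    using U star_Int(1)[OF HH(1-3) _ _ k(1)] by (simp add: star_iff)
  show ?thesis unfolding star_adj_def
    by (intro exI[of _ U] conjI bexI[of _ "star k (S e)"] bexI[of _ "star k (S g)"] bexI[of _ "star k (S f)"])
      (use HU SU e f f0 g eg ef SH Cl star0 in auto)
qed

text \<open>The alternative with \<open>\<kappa>\<close> selects the members of \<open>Cl\<close>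
  through \<open>U\<close> of the type of \<open>\<kappa>\<close>. Stars through \<open>U\<close>
  are hyperplanes of \<open>U\<close>, that is, points of the symplectic space \<open>U\<close> of
  dimension \<open>k\<close>; tops are points of \<open>orth U\<close>, of dimension
  \<open>dimension - k\<close>. The list is a cover as in \<open>cover\<close>, with
  \<open>star_adj\<close> as non-orthogonality.\<close>

definition star_test :: "nat \<Rightarrow> 'v set set \<Rightarrow> bool" where
  "star_test k \<kappa> \<longleftrightarrow> (\<exists>U\<in>\<kappa>. \<exists>xs. length xs = k \<and>
     (\<forall>x\<in>set xs. x \<in> Cl k \<and> U \<in> x \<and> (x = \<kappa> \<or> x \<inter> \<kappa> = {U})) \<and>
     (\<forall>y\<in>Cl k. U \<in> y \<and> (y = \<kappa> \<or> y \<inter> \<kappa> = {U}) \<longrightarrow> (\<exists>x\<in>set xs. star_adj k x y)))"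

lemma star_test_star:
  assumes "even k" "2 \<le> k" "k + 4 \<le> dimension" "H \<in> TR (k - 1)"
  shows "star_test k (star k H)"
proof -
  have k: "1 \<le> k" "1 \<le> k - 1" "k - 1 + 1 = k" "k - 1 - 1 = k - 2" "odd (k - 1)" "k \<le> dimension"
    using assms(1-3) by auto
  obtain U where U: "U \<in> TR k" "H \<subseteq> U" using star_nonempty[OF assms(4) k(1,6)] .
  have sU: "subspace U" "dim U = k" using TR_D U(1) by auto
  have RU: "Rad U = {0}" using U(1) TR_even[OF assms(1)] by simp
  obtain B where B: "B \<subseteq> U" "independent B" "U \<subseteq> span B" "card B = dim U" using basis_exists by blast
  have fin: "finite B" using B(2) by (rule finiteI_independent)
  obtain bs where bs: "set bs = B" "length bs = card B" using fin finite_distinct_list distinct_card by metis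
  have B0: "b \<noteq> 0" if "b \<in> B" for b using B(2) that dependent_zero by blast
  \<comment> \<open>The hyperplane of \<open>U\<close> polar to \<open>u\<close>; a basis of
    \<open>U\<close> gives the \<open>k\<close> covering stars.\<close>
  define S where "S u = U \<inter> orth {u}" for u
  have S: "S u \<in> TR (k - 1)" "S u \<subseteq> U" if u: "u \<in> U" "u \<noteq> 0" for u
  proof -
    have "u \<notin> orth U" using regular_inter_orth[OF RU] u by blast
    then obtain b where b: "b \<in> U" "\<xi> b u \<noteq> 0" using xi_eq_0_sym by (auto simp: orth_iff[of u])
    have d: "dim U = dim (S u) + 1" unfolding S_def by (rule dim_inter_perp[OF sU(1) b])
    have s: "subspace (S u)" unfolding S_def using sU by (intro subspace_inter) auto
    show "S u \<subseteq> U" by (auto simp: S_def)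
    then have "rdim (S u) \<le> 1" using rdim_hyperplane(1)[OF s sU(1) _ d] RU by (simp add: rdim_def)
    then show "S u \<in> TR (k - 1)" using s d sU by (simp add: TR_def)
  qed
  have same: "star k L = star k H \<or> star k L \<inter> star k H = {U}" if "L \<in> TR (k - 1)" "L \<subseteq> U" for L
    using star_Int(1)[OF that(1) assms(4) _ _ _ k(1)] U that by (auto simp: star_iff)
  show ?thesis unfolding star_test_def
  proof (intro bexI[of _ U] exI[of _ "map (\<lambda>b. star k (S b)) bs"] conjI ballI impI)
    show "length (map (\<lambda>b. star k (S b)) bs) = k" using bs B(4) sU by simp
    show "U \<in> star k H" using U by (simp add: star_iff)
    fix x assume "x \<in> set (map (\<lambda>b. star k (S b)) bs)"
    then obtain b where b: "b \<in> U" "b \<noteq> 0" "x = star k (S b)" using bs B(1) B0 by auto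
    show "x \<in> Cl k" using S(1)[OF b(1,2)] b(3) by (simp add: Cl_def)
    show "U \<in> x" using S(2)[OF b(1,2)] b(3) U by (simp add: star_iff)
    show "x = star k H \<or> x \<inter> star k H = {U}" using same S b by blast
  next
    fix y assume y: "y \<in> Cl k" "U \<in> y \<and> (y = star k H \<or> y \<inter> star k H = {U})"
    have "\<exists>L. L \<in> TR (k - 1) \<and> y = star k L"
      using y(2) assms(4) Cl_one_star[OF assms(1,4) k(1) y(1)] by (auto simp: one_def)
    then obtain L where L: "L \<in> TR (k - 1)" "y = star k L" by blast
    have LU: "L \<subseteq> U" using y L by (simp add: star_iff)
    have sL: "subspace L" "dim L = k - 1" using TR_D L(1) by auto
    obtain l where l: "l \<noteq> 0" "Rad L = span {l}" "l \<in> L" "\<And>w. w \<in> L \<Longrightarrow> \<xi> l w = 0"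
      using TR_odd_Rad[OF k(5) L(1)] by blast
    have "\<exists>b\<in>B. \<xi> l b \<noteq> 0"
    proof (rule ccontr)
      assume "\<not> (\<exists>b\<in>B. \<xi> l b \<noteq> 0)"
      then have "l \<in> orth (span B)" by (simp add: orth_iff[of l B])
      then have "l \<in> orth U" using orth_antimono[OF B(3)] by blast
      then show False using regular_inter_orth[OF RU] l LU by blast
    qed
    then obtain b where b: "b \<in> B" "\<xi> l b \<noteq> 0" by blast
    have bU: "b \<in> U" "b \<noteq> 0" using b B by auto
    have bl: "\<xi> b l \<noteq> 0" using b(2) xi_eq_0_sym by blast
    \<comment> \<open>The complement in \<open>U\<close> of the hyperbolic plane spanned by
      \<open>b\<close> and \<open>l\<close>, hence regular.\<close>
    define G where "G = S b \<inter> orth {l}"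
    have sG: "subspace G" unfolding G_def using TR_D(1)[OF S(1)[OF bU]] by (intro subspace_inter) auto
    have bS: "b \<in> S b" using bU by (simp add: S_def orth_singleton alternating)
    have dG: "dim (S b) = dim G + 1"
      unfolding G_def by (rule dim_inter_perp[OF TR_D(1)[OF S(1)[OF bU]] bS bl])
    have Leq: "L = U \<inter> orth {l}"
    proof (rule subspace_dim_equal[OF sL(1)])
      show "L \<subseteq> U \<inter> orth {l}" using LU l(4) xi_eq_0_sym by (auto simp: orth_singleton)
      show "dim (U \<inter> orth {l}) \<le> dim L" using dim_inter_perp[OF sU(1) bU(1) bl] sU sL by simp
      show "subspace (U \<inter> orth {l})" using sU by (intro subspace_inter) auto
    qed
    have GL: "G \<subseteq> L" "G \<subseteq> S b" unfolding G_def using Leq S(2)[OF bU] by auto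
    have "Rad G \<subseteq> {0}"
    proof
      fix x assume x: "x \<in> Rad G"
      have x': "x \<in> U" "\<xi> x b = 0" "\<xi> x l = 0" "\<And>g. g \<in> G \<Longrightarrow> \<xi> x g = 0"
        using x by (auto simp: Rad_iff G_def S_def orth_singleton)
      have lG: "l \<notin> G" using b(2) by (auto simp: G_def S_def orth_singleton)
      have "L = ext G l"
        using sG sL GL(1) l(3) lG dG TR_D(2)[OF S(1)[OF bU]] by (intro ext_eqI) auto
      moreover have "b \<notin> L" using l(4) b(2) by blast
      then have "U = ext L b" using sL sU LU bU by (intro ext_eqI) auto
      moreover have "ext (ext G l) b \<subseteq> orth {x}"
        using x' xi_eq_0_sym by (intro ext_least subspace_orth) (auto simp: orth_singleton)
      ultimately have "U \<subseteq> orth {x}" by simp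
      then have "x \<in> orth U" using subset_orth_iff[of U "{x}"] by simp
      then show "x \<in> {0}" using regular_inter_orth[OF RU x'(1)] by simp
    qed
    then have "dim (Rad G) = 0" by simp
    then have "rdim G \<le> 1" unfolding rdim_def by linarith
    then have "G \<in> TR (k - 1 - 1)" using sG dG TR_D(2)[OF S(1)[OF bU]] by (simp add: TR_def)
    moreover have "S b \<noteq> L" using bS l(4) b(2) by auto
    ultimately have "adjacent (k - 1) (S b) L"
      using S[OF bU] L(1) GL LU U(1) k by (intro adjI[where H=G and B=U]) auto
    then have "star_adj k (star k (S b)) y" using star_adjI[OF assms(1-3)] L(2) by blast
    then show "\<exists>x\<in>set (map (\<lambda>b. star k (S b)) bs). star_adj k x y" using b(1) bs by auto
  qed
qed

text \<open>Complements turn the tops into stars in the even dimension \<open>dimension - k\<close>,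
  where \<open>star_adj_star\<close> applies.\<close>

lemma top_adj:
  assumes "even k" "2 \<le> k" "k + 2 \<le> dimension" "B \<in> TR (k + 1)" "B' \<in> TR (k + 1)"
    and "star_adj k (costar k B) (costar k B')"
  shows "adjacent (k + 1) B B'"
proof -
  have k: "1 \<le> k" "k \<le> dimension" "k + 1 \<le> dimension" using assms by auto
  have s: "subspace B" "subspace B'" using assms TR_D by auto
  have "costar k B \<in> Cl k" "costar k B' \<in> Cl k" using assms by (auto simp: Cl_def)
  from star_adj_orth[OF assms(6) this k(1,3)]
  have "star_adj (dimension - k) (star (dimension - k) (orth B)) (star (dimension - k) (orth B'))"
    using orth_top s k by simp
  then have "adjacent (dimension - k - 1) (orth B) (orth B')"
    using assms(1-5) even_dimension TR_orth[OF assms(4)] TR_orth[OF assms(5)]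
    by (intro star_adj_star) auto
  then have "adjacent (dimension - (dimension - k - 1)) B B'"
    using adj_orth[of "dimension - k - 1" "orth B" "orth B'"] s assms(3) by simp
  moreover have "dimension - (dimension - k - 1) = k + 1" using k by simp
  ultimately show ?thesis by simp
qed

text \<open>Each top of the list has a radical vector \<open>c x\<close>. As \<open>k\<close> is
  less than the dimension of \<open>orth U\<close>, some \<open>b\<close> there is orthogonal to all
  of them, and the top of \<open>ext U b\<close> is adjacent to none: \<open>c x\<close> would be
  radical in a regular join.\<close>

lemma not_star_test_top:
  assumes "even k" "2 \<le> k" "2 * k < dimension" "B \<in> TR (k + 1)"
  shows "\<not> star_test k (costar k B)"
proof
  have k: "1 \<le> k" "k + 2 \<le> dimension" using assms(2,3) by auto
  assume "star_test k (costar k B)"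
  then obtain U xs where U: "U \<in> costar k B" and xs: "length xs = k"
     "\<And>x. x \<in> set xs \<Longrightarrow> x \<in> Cl k \<and> U \<in> x \<and> (x = costar k B \<or> x \<inter> costar k B = {U})" and
     ys: "\<forall>y\<in>Cl k. U \<in> y \<and> (y = costar k B \<or> y \<inter> costar k B = {U}) \<longrightarrow> (\<exists>x\<in>set xs. star_adj k x y)"
    unfolding star_test_def by (elim bexE exE conjE) (rule that, assumption+, drule (1) bspec)
  have UT: "U \<in> TR k" using U by (simp add: costar_iff)
  have sU: "subspace U" "dim U = k" using TR_D UT by auto
  have RU: "Rad U = {0}" using UT TR_even[OF assms(1)] by simp
  \<comment> \<open>By \<open>star_top_not_one\<close> no star shares just \<open>U\<close> with the
    given top, so the list consists of tops.\<close>
  have "\<exists>C c. C \<in> TR (k + 1) \<and> x = costar k C \<and> U \<subseteq> C \<and> c \<noteq> 0 \<and> c \<in> Rad C" if x: "x \<in> set xs" for x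
  proof -
    have "\<exists>C. C \<in> TR (k + 1) \<and> x = costar k C"
    proof (cases "x = costar k B")
      case True
      then show ?thesis using assms(4) by blast
    next
      case False
      then have "one x (costar k B)" using xs(2)[OF x] unfolding one_def by (intro exI[of _ U]) simp
      then have "x \<notin> star k ` TR (k - 1)" using star_top_not_one[OF assms(1) _ assms(4) k(1)] by auto
      then show ?thesis using xs(2)[OF x] unfolding Cl_def by blast
    qed
    then obtain C where C: "C \<in> TR (k + 1)" "x = costar k C" by blast
    have "odd (k + 1)" using assms(1) by simp
    then obtain c where "c \<noteq> 0" "Rad C = span {c}" using TR_odd_Rad C(1) by metis
    moreover from this have "c \<in> Rad C" using span_base[of c "{c}"] by simp
    ultimately show ?thesis using C xs(2)[OF x] by (auto simp: costar_iff)
  qed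
  then obtain C c where C: "\<And>x. x \<in> set xs \<Longrightarrow> C x \<in> TR (k + 1) \<and> x = costar k (C x) \<and> U \<subseteq> C x \<and> c x \<noteq> 0 \<and> c x \<in> Rad (C x)"
    by metis
  have "card (c ` set xs) \<le> k" using card_image_le[of "set xs" c] card_length[of xs] xs(1) by simp
  moreover have "dim (orth U) > k" using dim_orth[OF sU(1)] sU(2) assms(3) by simp
  ultimately obtain b where b: "b \<in> orth U" "b \<noteq> 0" "\<And>x. x \<in> set xs \<Longrightarrow> \<xi> b (c x) = 0"
    using exists_orth_to_few[of "c ` set xs" "orth U"] by (metis List.finite_set finite_imageI imageI le_less_trans subspace_orth)
  have bU: "b \<notin> U" using regular_inter_orth[OF RU] b by blast
  have "rdim (ext U b) \<le> 1"
    using rdim_hyperplane(2)[OF sU(1) subspace_ext ext_upper(1)] dim_ext[OF sU(1) bU] RU by (simp add: rdim_def)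
  then have B': "ext U b \<in> TR (k + 1)" using dim_ext[OF sU(1) bU] sU by (simp add: TR_def)
  have Ub: "U \<in> costar k (ext U b)" using UT ext_upper by (simp add: costar_iff)
  have "costar k (ext U b) = costar k B \<or> costar k (ext U b) \<inter> costar k B = {U}"
    using top_Int[OF B' assms(4) _ Ub U] by auto
  then obtain x where x: "x \<in> set xs" "star_adj k x (costar k (ext U b))"
    using bspec[OF ys, of "costar k (ext U b)"] B' Ub by (auto simp: Cl_def)
  have a: "adjacent (k + 1) (C x) (ext U b)"
    using top_adj[OF assms(1,2) k(2) _ B'] C[OF x(1)] x(2) by simp
  have J: "join (C x) (ext U b) \<in> TR (k + 1 + 1)" using adjD(5)[OF a] by simp
  have cx: "c x \<in> C x" "C x \<subseteq> orth {c x}" using C[OF x(1)] xi_eq_0_sym by (auto simp: Rad_iff orth_singleton)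
  have "U \<subseteq> orth {c x}" using C[OF x(1)] cx(2) by blast
  then have "join (C x) (ext U b) \<subseteq> orth {c x}"
    using b(3)[OF x(1)] cx(2) by (intro join_least ext_least subspace_orth) (auto simp: orth_singleton)
  then have "c x \<in> orth (join (C x) (ext U b))" using subset_orth_iff[of "join (C x) (ext U b)" "{c x}"] by simp
  moreover have "c x \<in> join (C x) (ext U b)" using cx(1) line_upper[where U="C x" and W="ext U b"] by blast
  ultimately have "c x \<in> Rad (join (C x) (ext U b))" by (simp add: Rad_def)
  then show False using J TR_even[of "k + 1 + 1" "join (C x) (ext U b)"] assms(1) C[OF x(1)] by simp
qed

section \<open>Definability of stars\<close>

abbreviation AS :: "nat \<Rightarrow> (adj_symbol, 'v set) struct" where
  "AS k \<equiv> adjacency_structure k (TR k)"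

lemma univ_AS: "univ (AS k) = TR k"
  by (simp add: adjacency_structure_def)

lemma rels_AS: "rels (AS k) r = {[U, W] | U W. U \<in> TR k \<and> W \<in> TR k \<and> adjacent k U W}"
  by (simp add: adjacency_structure_def)

lemma rels_AS_length: "xs \<in> rels (AS k) r \<Longrightarrow> length xs = 2"
  by (auto simp: rels_AS)

lemma fo_adj: "fo (AS k) (\<lambda>e. adjacent k (e i) (e j))"
proof (rule fo_cong[OF fo_atom[of _ "[i, j]" Adj]])
  fix e :: "nat \<Rightarrow> 'v set" assume "range e \<subseteq> univ (AS k)"
  then have "e i \<in> TR k" "e j \<in> TR k" by (auto simp: univ_AS)
  then show "(map e [i, j] \<in> rels (AS k) Adj) = adjacent k (e i) (e j)" by (simp add: rels_AS)
qed

lemma fo_exT: "fo (AS k) (\<lambda>e. \<Psi> (\<lambda>i. e (Suc i)) (e 0)) \<Longrightarrow> fo (AS k) (\<lambda>e. \<exists>a\<in>TR k. \<Psi> e a)"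
  using fo_ex[of "AS k" \<Psi>] by (simp add: univ_AS)

lemma fo_allT: "fo (AS k) (\<lambda>e. \<Psi> (\<lambda>i. e (Suc i)) (e 0)) \<Longrightarrow> fo (AS k) (\<lambda>e. \<forall>a\<in>TR k. \<Psi> e a)"
  using fo_all[of "AS k" \<Psi>] by (simp add: univ_AS)

lemma fo_ex_tupleT:
  "fo (AS k) (\<lambda>e. \<Psi> (\<lambda>i. e (m + i)) (map e [0..<m])) \<Longrightarrow>
   fo (AS k) (\<lambda>e. \<exists>xs\<in>tuples (TR k) m. \<Psi> e xs)"
  using fo_ex_tuple[of "AS k" \<Psi> m] by (simp add: univ_AS)

lemmas fo_intros = fo_eq fo_not fo_conj fo_disj fo_imp fo_iff fo_exT fo_allT fo_adj

lemma fo_coll: "fo (AS k) (\<lambda>e. coll k (e i) (e j) (e l))"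
  unfolding coll_def by (intro fo_intros)

lemma fo_wedge: "fo (AS k) (\<lambda>e. wedge k (e i) (e j) (e l))"
  unfolding wedge_def by (intro fo_intros fo_coll)

lemma fo_row: "fo (AS k) (\<lambda>e. row k (e i) (e j) (e l) (e m))"
  unfolding row_def by (intro fo_intros fo_coll fo_wedge)

lemma fo_fan: "fo (AS k) (\<lambda>e. fan k (e i) (e j) (e l) (e m))"
  unfolding fan_def by (intro fo_intros fo_row fo_wedge)

text \<open>A triple of elements serves as the code of a star or top; it is meaningful if
  \<open>wedge\<close> holds.\<close>

definition cl :: "nat \<Rightarrow> 'v set \<Rightarrow> 'v set \<Rightarrow> 'v set \<Rightarrow> 'v set set" where
  "cl k U W X = {Y \<in> TR k. fan k U W X Y}"

lemma fo_mem_cl: "fo (AS k) (\<lambda>e. e m \<in> cl k (e i) (e j) (e l))"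
  by (rule fo_cong[OF fo_fan[of k i j l m]]) (auto simp: cl_def univ_AS)

lemma fo_cl_eq: "fo (AS k) (\<lambda>e. cl k (e i) (e j) (e l) = cl k (e i') (e j') (e l'))"
proof -
  have "fo (AS k) (\<lambda>e. \<forall>Y\<in>TR k. fan k (e i) (e j) (e l) Y = fan k (e i') (e j') (e l') Y)"
    by (intro fo_intros fo_fan)
  then show ?thesis by (rule fo_cong) (auto simp: cl_def)
qed

lemma fo_cl_disjoint: "fo (AS k) (\<lambda>e. cl k (e i) (e j) (e l) \<inter> cl k (e i') (e j') (e l') = {})"
proof -
  have "fo (AS k) (\<lambda>e. \<forall>Y\<in>TR k. \<not> (fan k (e i) (e j) (e l) Y \<and> fan k (e i') (e j') (e l') Y))"
    by (intro fo_intros fo_fan)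
  then show ?thesis by (rule fo_cong) (auto simp: cl_def)
qed

lemma cl_Int_single:
  "c \<in> TR k \<Longrightarrow> cl k U W X \<inter> cl k U' W' X' = {c} \<longleftrightarrow>
    (\<forall>Y\<in>TR k. (fan k U W X Y \<and> fan k U' W' X' Y) = (Y = c))"
  unfolding cl_def by blast

lemma fo_cl_single: "fo (AS k) (\<lambda>e. cl k (e i) (e j) (e l) \<inter> cl k (e i') (e j') (e l') = {e c})"
proof -
  have "fo (AS k) (\<lambda>e. \<forall>Y\<in>TR k. (fan k (e i) (e j) (e l) Y \<and> fan k (e i') (e j') (e l') Y) = (Y = e c))"
    by (intro fo_intros fo_fan)
  then show ?thesis
    by (rule fo_cong) (rule cl_Int_single[symmetric], auto simp: univ_AS)
qed

lemma cl_one_iff: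
  "one (cl k U W X) (cl k U' W' X') \<longleftrightarrow> (\<exists>c\<in>TR k. cl k U W X \<inter> cl k U' W' X' = {c})"
  unfolding one_def by (auto simp: cl_def)

lemma fo_one: "fo (AS k) (\<lambda>e. one (cl k (e i) (e j) (e l)) (cl k (e i') (e j') (e l')))"
  unfolding cl_one_iff by (intro fo_exT fo_cl_single)

context
  fixes k :: nat
  assumes k: "2 \<le> k" "k + 2 \<le> dimension"
begin

lemma cl_star: "wedge k U W X \<Longrightarrow> U \<inter> W = U \<inter> X \<Longrightarrow> cl k U W X = star k (U \<inter> W)"
  using fan_star[OF k] by (auto simp: cl_def star_def)

lemma cl_costar: "wedge k U W X \<Longrightarrow> join U W = join U X \<Longrightarrow> cl k U W X = costar k (join U W)"
  using fan_top[OF k] by (auto simp: cl_def costar_def)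

lemma wedge_TR:
  assumes "wedge k U W X"
  shows "U \<in> TR k" "W \<in> TR k" "X \<in> TR k" "U \<inter> W \<in> TR (k - 1)" "join U W \<in> TR (k + 1)"
  using assms adjD[OF _ k1[OF k]] by (auto simp: wedge_iff[OF k])

lemma wedge_cl_Cl: "wedge k U W X \<Longrightarrow> cl k U W X \<in> Cl k"
  using cl_star[of U W X] cl_costar[of U W X] wedge_TR[of U W X]
  by (cases "U \<inter> W = U \<inter> X") (auto simp: Cl_def wedge_iff[OF k])

text \<open>Quantifiers over stars and tops become quantifiers over triples of elements.\<close>

lemma Cl_iff:
  "x \<in> Cl k \<longleftrightarrow> (\<exists>U\<in>TR k. \<exists>W\<in>TR k. \<exists>X\<in>TR k. wedge k U W X \<and> x = cl k U W X)"
proof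
  assume "x \<in> Cl k"
  then consider H where "H \<in> TR (k - 1)" "x = star k H" | B where "B \<in> TR (k + 1)" "x = costar k B"
    by (auto simp: Cl_def)
  then have "\<exists>U W X. wedge k U W X \<and> x = cl k U W X"
  proof cases
    case 1
    obtain U W X where "wedge k U W X" "U \<inter> W = H" "U \<inter> X = H" using star_wedge[OF k 1(1)] .
    then show ?thesis using cl_star[of U W X] 1 by metis
  next
    case 2
    obtain U W X where "wedge k U W X" "join U W = B" "join U X = B" using top_wedge[OF k 2(1)] .
    then show ?thesis using cl_costar[of U W X] 2 by metis
  qed
  then show "\<exists>U\<in>TR k. \<exists>W\<in>TR k. \<exists>X\<in>TR k. wedge k U W X \<and> x = cl k U W X"
    using wedge_TR(1-3) by blast
qed (auto intro: wedge_cl_Cl)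

lemma bex_Cl_iff:
  "(\<exists>x\<in>Cl k. \<Phi> x) \<longleftrightarrow> (\<exists>U\<in>TR k. \<exists>W\<in>TR k. \<exists>X\<in>TR k. wedge k U W X \<and> \<Phi> (cl k U W X))"
  using Cl_iff by (metis (no_types, lifting))

lemma ball_Cl_iff:
  "(\<forall>x\<in>Cl k. \<Phi> x) \<longleftrightarrow> (\<forall>U\<in>TR k. \<forall>W\<in>TR k. \<forall>X\<in>TR k. wedge k U W X \<longrightarrow> \<Phi> (cl k U W X))"
  using bex_Cl_iff[of "\<lambda>x. \<not> \<Phi> x"] by blast

lemma fo_star_adj: "fo (AS k) (\<lambda>e. star_adj k (cl k (e i) (e j) (e l)) (cl k (e i') (e j') (e l')))"
proof -
  have "star_adj k (cl k U W X) (cl k U' W' X') \<longleftrightarrow>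
    (\<exists>c\<in>TR k. cl k U W X \<inter> cl k U' W' X' = {c} \<and> (\<exists>x\<in>Cl k. \<exists>y\<in>Cl k. \<exists>z\<in>Cl k.
     c \<notin> x \<and> c \<notin> y \<and> c \<notin> z \<and> one x (cl k U W X) \<and> one x (cl k U' W' X') \<and>
     one y (cl k U W X) \<and> one y (cl k U' W' X') \<and> one z (cl k U W X) \<and> one z (cl k U' W' X') \<and>
     one x z \<and> (x = y \<or> x \<inter> y = {}) \<and> (y = z \<or> y \<inter> z = {})))" (is "?l = (\<exists>c\<in>_. ?P c)") for U W X U' W' X'
  proof -
    have "c \<in> TR k" if "cl k U W X \<inter> cl k U' W' X' = {c}" for c
    proof -
      have "c \<in> cl k U W X \<inter> cl k U' W' X'" using that by simp
      then show ?thesis by (simp add: cl_def)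
    qed
    then show ?thesis unfolding star_adj_def Bex_def[of "TR k"] by (intro ex_cong1) auto
  qed
  then show ?thesis
    unfolding bex_Cl_iff
    by (simp only:) (intro fo_intros fo_cl_single fo_mem_cl fo_one fo_wedge fo_cl_eq fo_cl_disjoint)
qed

text \<open>The list of members of \<open>Cl\<close> is replaced by three tuples of fixed length
  \<open>k\<close>, over which formulas can quantify.\<close>

lemma star_test_iff:
  "star_test k \<kappa> \<longleftrightarrow> (\<exists>U\<in>\<kappa>. \<exists>Us\<in>tuples (TR k) k. \<exists>Ws\<in>tuples (TR k) k. \<exists>Xs\<in>tuples (TR k) k.
     (\<forall>i<k. wedge k (Us ! i) (Ws ! i) (Xs ! i) \<and> U \<in> cl k (Us ! i) (Ws ! i) (Xs ! i) \<and>
       (cl k (Us ! i) (Ws ! i) (Xs ! i) = \<kappa> \<or> cl k (Us ! i) (Ws ! i) (Xs ! i) \<inter> \<kappa> = {U})) \<and>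
     (\<forall>y\<in>Cl k. U \<in> y \<and> (y = \<kappa> \<or> y \<inter> \<kappa> = {U}) \<longrightarrow>
       (\<exists>i<k. star_adj k (cl k (Us ! i) (Ws ! i) (Xs ! i)) y)))"
    (is "_ \<longleftrightarrow> (\<exists>U\<in>\<kappa>. \<exists>Us\<in>?T. \<exists>Ws\<in>?T. \<exists>Xs\<in>?T. ?P U Us Ws Xs)")
proof
  assume "star_test k \<kappa>"
  then obtain U xs where U: "U \<in> \<kappa>" and xs: "length xs = k"
     "\<forall>x\<in>set xs. x \<in> Cl k \<and> U \<in> x \<and> (x = \<kappa> \<or> x \<inter> \<kappa> = {U})"
     and ys: "\<forall>y\<in>Cl k. U \<in> y \<and> (y = \<kappa> \<or> y \<inter> \<kappa> = {U}) \<longrightarrow> (\<exists>x\<in>set xs. star_adj k x y)"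
    unfolding star_test_def by (elim bexE exE conjE) (rule that)
  have "\<exists>A B C. wedge k A B C \<and> x = cl k A B C" if "x \<in> set xs" for x
    using iffD1[OF Cl_iff conjunct1[OF bspec[OF xs(2) that]]] by (elim bexE) (intro exI)
  then obtain u w v where t: "\<And>x. x \<in> set xs \<Longrightarrow> wedge k (u x) (w x) (v x) \<and> x = cl k (u x) (w x) (v x)"
    by metis
  let ?Us = "map u xs" and ?Ws = "map w xs" and ?Xs = "map v xs"
  have cl: "cl k (?Us ! i) (?Ws ! i) (?Xs ! i) = xs ! i" "wedge k (?Us ! i) (?Ws ! i) (?Xs ! i)" if "i < k" for i
    using t[of "xs ! i"] that xs(1) by auto
  have T: "?Us \<in> ?T" "?Ws \<in> ?T" "?Xs \<in> ?T"
    using wedge_TR(1-3)[OF cl(2)] xs(1) by (simp_all add: tuplesI)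
  have "?P U ?Us ?Ws ?Xs"
  proof (intro conjI allI impI ballI)
    fix i assume i: "i < k"
    then have "xs ! i \<in> set xs" using xs(1) by simp
    then show "U \<in> cl k (?Us ! i) (?Ws ! i) (?Xs ! i)"
      "cl k (?Us ! i) (?Ws ! i) (?Xs ! i) = \<kappa> \<or> cl k (?Us ! i) (?Ws ! i) (?Xs ! i) \<inter> \<kappa> = {U}"
      using bspec[OF xs(2) \<open>xs ! i \<in> set xs\<close>] unfolding cl(1)[OF i] by simp_all
    show "wedge k (?Us ! i) (?Ws ! i) (?Xs ! i)" by (rule cl(2)[OF i])
  next
    fix y assume y: "y \<in> Cl k" "U \<in> y \<and> (y = \<kappa> \<or> y \<inter> \<kappa> = {U})"
    obtain x where "x \<in> set xs" "star_adj k x y"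
      using mp[OF bspec[OF ys y(1)] y(2)] by (elim bexE) (rule that)
    then show "\<exists>i<k. star_adj k (cl k (?Us ! i) (?Ws ! i) (?Xs ! i)) y"
      using cl(1) xs(1) by (metis in_set_conv_nth)
  qed
  then show "\<exists>U\<in>\<kappa>. \<exists>Us\<in>?T. \<exists>Ws\<in>?T. \<exists>Xs\<in>?T. ?P U Us Ws Xs"
    by (intro bexI[OF _ U] bexI[OF _ T(1)] bexI[OF _ T(2)] bexI[OF _ T(3)])
next
  assume "\<exists>U\<in>\<kappa>. \<exists>Us\<in>?T. \<exists>Ws\<in>?T. \<exists>Xs\<in>?T. ?P U Us Ws Xs"
  then obtain U Us Ws Xs where U: "U \<in> \<kappa>" and P: "?P U Us Ws Xs" by (elim bexE) (rule that)
  let ?xs = "map (\<lambda>i. cl k (Us ! i) (Ws ! i) (Xs ! i)) [0..<k]"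
  show "star_test k \<kappa>" unfolding star_test_def
  proof (intro bexI[OF _ U] exI[of _ ?xs] conjI ballI impI)
    fix x assume "x \<in> set ?xs"
    then obtain i where i: "i < k" "x = cl k (Us ! i) (Ws ! i) (Xs ! i)" by auto
    note Pi = mp[OF spec[OF conjunct1[OF P]] i(1)]
    show "x \<in> Cl k" unfolding i(2) by (rule wedge_cl_Cl[OF conjunct1[OF Pi]])
    show "U \<in> x" unfolding i(2) by (rule conjunct1[OF conjunct2[OF Pi]])
    show "x = \<kappa> \<or> x \<inter> \<kappa> = {U}" unfolding i(2) by (rule conjunct2[OF conjunct2[OF Pi]])
  next
    fix y assume y: "y \<in> Cl k" "U \<in> y \<and> (y = \<kappa> \<or> y \<inter> \<kappa> = {U})"
    obtain i where "i < k" "star_adj k (cl k (Us ! i) (Ws ! i) (Xs ! i)) y"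
      using mp[OF bspec[OF conjunct2[OF P] y(1)] y(2)] by (elim exE conjE) (rule that)
    then show "\<exists>x\<in>set ?xs. star_adj k x y" by auto
  qed simp
qed

lemma fo_star_test: "fo (AS k) (\<lambda>e. star_test k (cl k (e i) (e j) (e l)))"
proof -
  have bex: "(\<exists>U\<in>cl k A B C. \<Phi> U) \<longleftrightarrow> (\<exists>U\<in>TR k. U \<in> cl k A B C \<and> \<Phi> U)" for A B C \<Phi>
    by (auto simp: cl_def)
  show ?thesis
    unfolding star_test_iff bex ball_Cl_iff
    apply (intro fo_exT fo_conj fo_ex_tupleT fo_mem_cl fo_all_less)
    apply simp
    apply (intro fo_intros fo_wedge)
    apply simp
    apply (intro fo_intros fo_mem_cl)
    apply simp
    apply (intro fo_intros fo_cl_eq fo_cl_single)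
    apply (intro fo_allT fo_imp fo_conj fo_disj fo_wedge fo_cl_eq fo_cl_single fo_mem_cl fo_ex_less)
    apply simp
    apply (rule fo_star_adj)
    done
qed

lemma cover_iff:
  assumes \<kappa>: "\<kappa> \<subseteq> TR k"
  shows "cover k m \<kappa> \<longleftrightarrow> (\<exists>ps\<in>tuples (TR k) m. (\<forall>i<m. ps ! i \<in> \<kappa>) \<and>
     (\<forall>q\<in>TR k. q \<in> \<kappa> \<longrightarrow> (\<exists>i<m. adjacent k q (ps ! i))))"
proof
  assume "cover k m \<kappa>"
  then obtain ps where ps: "length ps = m" "set ps \<subseteq> \<kappa>" "\<forall>q\<in>\<kappa>. \<exists>p\<in>set ps. adjacent k q p"
    unfolding cover_def by blast
  show "\<exists>ps\<in>tuples (TR k) m. (\<forall>i<m. ps ! i \<in> \<kappa>) \<and>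
     (\<forall>q\<in>TR k. q \<in> \<kappa> \<longrightarrow> (\<exists>i<m. adjacent k q (ps ! i)))"
  proof (intro bexI[of _ ps] conjI allI ballI impI)
    show "ps \<in> tuples (TR k) m" using ps(1,2) \<kappa> by (auto simp: tuples_def)
    show "ps ! i \<in> \<kappa>" if "i < m" for i using that ps(1,2) nth_mem by blast
    fix q assume "q \<in> \<kappa>"
    then obtain p where "p \<in> set ps" "adjacent k q p" using ps(3) by blast
    then show "\<exists>i<m. adjacent k q (ps ! i)" using ps(1) by (auto simp: in_set_conv_nth)
  qed
next
  assume "\<exists>ps\<in>tuples (TR k) m. (\<forall>i<m. ps ! i \<in> \<kappa>) \<and>
     (\<forall>q\<in>TR k. q \<in> \<kappa> \<longrightarrow> (\<exists>i<m. adjacent k q (ps ! i)))"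
  then obtain ps where ps: "length ps = m" "\<forall>i<m. ps ! i \<in> \<kappa>"
    "\<forall>q\<in>TR k. q \<in> \<kappa> \<longrightarrow> (\<exists>i<m. adjacent k q (ps ! i))" by (auto simp: tuples_def)
  show "cover k m \<kappa>" unfolding cover_def
  proof (intro exI[of _ ps] conjI ballI)
    show "set ps \<subseteq> \<kappa>" using ps(1,2) by (auto simp: in_set_conv_nth)
    fix q assume "q \<in> \<kappa>"
    then obtain i where "i < m" "adjacent k q (ps ! i)" using ps(3) \<kappa> by blast
    then show "\<exists>p\<in>set ps. adjacent k q p" using ps(1) by (metis nth_mem)
  qed (rule ps(1))
qed

lemma fo_cover: "fo (AS k) (\<lambda>e. cover k m (cl k (e i) (e j) (e l)))"
proof -
  have sub: "cl k U W X \<subseteq> TR k" for U W X by (auto simp: cl_def)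
  show ?thesis
    unfolding cover_iff[OF sub]
    apply (intro fo_conj fo_ex_tupleT fo_all_less)
    apply simp
    apply (rule fo_mem_cl)
    apply (intro fo_allT fo_imp fo_mem_cl fo_ex_less)
    apply simp
    apply (rule fo_adj)
    done
qed

text \<open>For odd \<open>k\<close>, tops are covered by \<open>k + 1\<close> elements, while stars
  need \<open>dimension - k + 1\<close>, which is more if \<open>2 * k < dimension\<close>.\<close>

definition star_code :: "'v set \<Rightarrow> 'v set \<Rightarrow> 'v set \<Rightarrow> bool" where
  "star_code U W X \<longleftrightarrow> wedge k U W X \<and>
     (if even k then star_test k (cl k U W X) else \<not> cover k (k + 1) (cl k U W X))"

lemma fo_star_code: "fo (AS k) (\<lambda>e. star_code (e i) (e j) (e l))"
  unfolding star_code_def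
  by (cases "even k") (simp_all only: if_True if_False fo_conj fo_not fo_wedge fo_star_test fo_cover)

lemma star_code_iff:
  assumes "2 * k < dimension"
  shows "star_code U W X \<longleftrightarrow> wedge k U W X \<and> U \<inter> W = U \<inter> X"
proof (cases "wedge k U W X")
  case w: True
  note T = wedge_TR[OF w]
  note k4 = even_codim_ge[OF _ k(1) assms]
  show ?thesis
  proof (cases "U \<inter> W = U \<inter> X")
    case True
    have "even k \<Longrightarrow> star_test k (star k (U \<inter> W))"
      using star_test_star[OF _ k(1) k4 T(4)] by blast
    moreover have "odd k \<Longrightarrow> \<not> cover k (k + 1) (star k (U \<inter> W))"
      using star_not_cover[OF _ T(4)] assms by simp
    ultimately show ?thesis using w True cl_star[OF w True] by (simp add: star_code_def)
  next
    case False
    then have J: "join U W = join U X" using w by (simp add: wedge_iff[OF k])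
    have "even k \<Longrightarrow> \<not> star_test k (costar k (join U W))"
      using not_star_test_top[OF _ k(1) assms T(5)] by blast
    moreover have "odd k \<Longrightarrow> cover k (k + 1) (costar k (join U W))" using top_cover[OF _ T(5)] by blast
    ultimately show ?thesis using w False cl_costar[OF w J] by (simp add: star_code_def)
  qed
qed (simp add: star_code_def)

end

section \<open>From dimension \<open>k\<close> to dimension \<open>k - 1\<close>\<close>

lemma code_index: "j < m \<Longrightarrow> case_nat a (flatten m E) (Suc (i * m + j)) = E i ! j"
  by (simp add: flatten_def)

text \<open>For odd \<open>k\<close> the spaces \<open>H\<close> and \<open>H'\<close> are regular,
  so by \<open>adj_even\<close> it suffices that they lie in a common element of
  \<open>TR k\<close>. For even \<open>k\<close> they are tangential, and regularity or
  tangentiality of \<open>H \<inter> H'\<close> has to be detected by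
  \<open>star_adj\<close>.\<close>

lemma star_adj_iff_adjacent:
  assumes "2 \<le> k" "2 * k < dimension" "H \<in> TR (k - 1)" "H' \<in> TR (k - 1)"
  shows "adjacent (k - 1) H H' \<longleftrightarrow> (if even k then star_adj k (star k H) (star k H')
    else star k H \<noteq> star k H' \<and> star k H \<inter> star k H' \<noteq> {})"
proof (cases "even k")
  case True
  have "k + 4 \<le> dimension" by (rule even_codim_ge[OF True assms(1,2)])
  then show ?thesis
    using True star_adjI[OF True assms(1)] star_adj_star[OF True assms(1) _ assms(3,4)] by auto
next
  case False
  have k: "1 \<le> k" "1 \<le> k - 1" "k + 1 \<le> dimension" "k - 1 + 1 = k" "even (k - 1)" using assms(1,2) False by auto
  have "adjacent (k - 1) H H' \<longleftrightarrow> star k H \<noteq> star k H' \<and> star k H \<inter> star k H' \<noteq> {}"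
  proof
    assume a: "adjacent (k - 1) H H'"
    note HH = adjD[OF a k(2)]
    have "join H H' \<in> star k H \<inter> star k H'"
      using HH(5) k(4) line_upper[where U=H and W=H'] by (simp add: star_iff)
    then show "star k H \<noteq> star k H' \<and> star k H \<inter> star k H' \<noteq> {}"
      using HH(3) star_inj[OF _ assms(3,4) k(1,3)] by blast
  next
    assume a: "star k H \<noteq> star k H' \<and> star k H \<inter> star k H' \<noteq> {}"
    then obtain U where U: "U \<in> star k H" "U \<in> star k H'" by blast
    have ne: "H \<noteq> H'" using a by auto
    have "join H H' = U" by (rule star_Int(2)[OF assms(3,4) ne U k(1)])
    then have "dim (H \<inter> H') = k - 2"
      using dim_join[of H H'] TR_D[OF assms(3)] TR_D[OF assms(4)] U assms(1) by (auto simp: star_iff dest: TR_D(2))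
    moreover have "odd (k - 1) \<or> 2 \<le> k - 1" using k(5) assms(1) False by (cases "k = 2") auto
    ultimately show "adjacent (k - 1) H H'"
      using TR_D[OF assms(3)] TR_D[OF assms(4)] assms(1)
      by (intro adj_even[OF k(5,2) assms(3,4) ne, of "H \<inter> H'"] subspace_inter) auto
  qed
  then show ?thesis using False by simp
qed

lemma interp_step:
  assumes "2 \<le> k" "2 * k < dimension"
  obtains D f where "interp (AS k) (AS (k - 1)) 3 D f" "crel (AS k) 3 D f (\<lambda>e b. e 0 \<subseteq> b)"
proof -
  have k: "2 \<le> k" "k + 2 \<le> dimension" "1 \<le> k" "k + 1 \<le> dimension" using assms by auto
  \<comment> \<open>\<open>H\<close> is coded by two neighbours meeting in it; the third entry
    certifies that the star rather than the top is meant. Codes of the same \<open>H\<close> are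
    recognized by equal stars.\<close>
  define D where "D = {[U, W, X] | U W X. star_code k U W X}"
  define f :: "'v set list \<Rightarrow> 'v set" where "f xs = xs ! 0 \<inter> xs ! 1" for xs
  have D: "star_code k (xs ! 0) (xs ! 1) (xs ! 2)" "f xs \<in> TR (k - 1)"
      "cl k (xs ! 0) (xs ! 1) (xs ! 2) = star k (f xs)" "length xs = 3" if "xs \<in> D" for xs
    using that star_code_iff[OF k(1,2) assms(2)] wedge_TR(4)[OF k(1,2)] cl_star[OF k(1,2)]
    by (auto simp: D_def f_def)
  have D_tuples: "D \<subseteq> tuples (univ (AS k)) 3"
    using star_code_iff[OF k(1,2) assms(2)] wedge_TR(1-3)[OF k(1,2)] by (auto simp: D_def tuples_def univ_AS)
  have f_image: "f ` D = univ (AS (k - 1))"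
  proof
    show "f ` D \<subseteq> univ (AS (k - 1))" using D(2) by (auto simp: univ_AS)
    show "univ (AS (k - 1)) \<subseteq> f ` D"
    proof
      fix H assume "H \<in> univ (AS (k - 1))"
      then obtain U W X where w: "wedge k U W X" "U \<inter> W = H" "U \<inter> X = H"
        using star_wedge[OF k(1,2)] by (metis univ_AS)
      then have "[U, W, X] \<in> D" using star_code_iff[OF k(1,2) assms(2)] by (auto simp: D_def)
      moreover have "f [U, W, X] = H" using w by (simp add: f_def)
      ultimately show "H \<in> f ` D" by blast
    qed
  qed
  have D_def': "definable (AS k) 3 D"
  proof (rule definableI)
    show "fo (AS k) (\<lambda>e. star_code k (map e [0..<3] ! 0) (map e [0..<3] ! 1) (map e [0..<3] ! 2))"
      using fo_star_code[OF k(1,2), of 0 1 2] by (simp add: numeral_2_eq_2)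
    have "xs \<in> D" if "xs \<in> tuples (univ (AS k)) 3" "star_code k (xs ! 0) (xs ! 1) (xs ! 2)" for xs
    proof -
      have "length xs = 3" using that(1) by (simp add: tuples_def)
      then have "xs = [xs ! 0, xs ! 1, xs ! 2]" by (auto simp: list_eq_iff_nth_eq less_Suc_eq numeral_3_eq_3 numeral_2_eq_2)
      then show ?thesis unfolding D_def using that(2) by blast
    qed
    then show "D = {xs \<in> tuples (univ (AS k)) 3. star_code k (xs ! 0) (xs ! 1) (xs ! 2)}"
      using D(1) D_tuples by blast
  qed
  define C where "C e i = cl k (e (Suc (i * 3 + 0))) (e (Suc (i * 3 + 1))) (e (Suc (i * 3 + 2)))" for e :: "nat \<Rightarrow> 'v set" and i
  have C: "C (case_nat a (flatten 3 E)) i = star k (f (E i))" if "\<And>i. E i \<in> D" for a E i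
  proof -
    have "case_nat a (flatten 3 E) (Suc (i * 3 + j)) = E i ! j" if "j < 3" for j
      using that by (rule code_index)
    then show ?thesis unfolding C_def using D(3)[OF that] by (simp only:)
  qed
  have inj: "star k (f xs) = star k (f ys) \<longleftrightarrow> f xs = f ys" if "xs \<in> D" "ys \<in> D" for xs ys
    using star_inj[OF _ D(2)[OF that(1)] D(2)[OF that(2)] k(3,4)] by auto
  have "crel (AS k) 3 D f (\<lambda>e a. e 0 = e 1)"
  proof (rule crelI)
    show "fo (AS k) (\<lambda>e. C e 0 = C e 1)" unfolding C_def by (rule fo_cl_eq)
  qed (simp add: C inj)
  moreover have "crel (AS k) 3 D f (\<lambda>e a. map e [0..<j] \<in> rels (AS (k - 1)) r)" for r j
  proof (cases "j = 2")
    case True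
    define \<Psi> where "\<Psi> e \<longleftrightarrow> (if even k then star_adj k (C e 0) (C e 1)
      else C e 0 \<noteq> C e 1 \<and> C e 0 \<inter> C e 1 \<noteq> {})" for e
    have "fo (AS k) \<Psi>"
      unfolding \<Psi>_def[abs_def] C_def
      by (cases "even k") (simp_all only: if_True if_False fo_conj fo_not fo_star_adj[OF k(1,2)] fo_cl_eq fo_cl_disjoint)
    then show ?thesis
    proof (rule crelI)
      fix E :: "nat \<Rightarrow> 'v set list" and a assume E: "\<And>i. E i \<in> D"
      have "map (\<lambda>i. f (E i)) [0..<j] = [f (E 0), f (E 1)]" using True by (simp add: upt_rec numeral_2_eq_2)
      then have "map (\<lambda>i. f (E i)) [0..<j] \<in> rels (AS (k - 1)) r \<longleftrightarrow> adjacent (k - 1) (f (E 0)) (f (E 1))"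
        using D(2)[OF E] by (simp add: rels_AS)
      also have "\<dots> \<longleftrightarrow> \<Psi> (case_nat a (flatten 3 E))"
        unfolding \<Psi>_def C[OF E] by (rule star_adj_iff_adjacent[OF assms D(2)[OF E] D(2)[OF E]])
      finally show "\<Psi> (case_nat a (flatten 3 E)) = (map (\<lambda>i. f (E i)) [0..<j] \<in> rels (AS (k - 1)) r)" by simp
    qed
  next
    case False
    have "map g [0..<j] \<notin> rels (AS (k - 1)) r" for g
      using rels_AS_length[of "map g [0..<j]"] False by auto
    then show ?thesis by (intro crelI[OF fo_const[of _ False]]) simp
  qed
  ultimately have "interp (AS k) (AS (k - 1)) 3 D f"
    using interpI[OF _ D_tuples f_image D_def'] by simp
  moreover have "crel (AS k) 3 D f (\<lambda>e b. e 0 \<subseteq> b)"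
  proof (rule crelI)
    show "fo (AS k) (\<lambda>e. e 0 \<in> C e 0)" unfolding C_def by (rule fo_mem_cl)
  next
    fix E :: "nat \<Rightarrow> 'v set list" and b assume "\<And>i. E i \<in> D" "b \<in> univ (AS k)"
    then show "(case_nat b (flatten 3 E) 0 \<in> C (case_nat b (flatten 3 E)) 0) = (f (E 0) \<subseteq> b)"
      by (simp add: C star_iff univ_AS)
  qed
  ultimately show thesis using that by blast
qed

section \<open>Descent to the points\<close>

text \<open>\<open>c a\<close> is the orthogonal complement of the subspace coded by the element \<open>a\<close> of \<open>M\<close>; it is
  carried along the descent, because the incidences \<open>I\<close> do not compose to inclusion: a tangential
  space has no regular subspace containing its radical.\<close>

definition reach :: "('r, 'a) struct \<Rightarrow> nat \<Rightarrow> ('a \<Rightarrow> 'v set) \<Rightarrow> bool" where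
  "reach M j c \<longleftrightarrow> (\<exists>m D f I. interp M (AS j) m D f \<and> crel M m D f (\<lambda>e a. I (e 0) a) \<and>
     (\<forall>a\<in>univ M. orth (\<Union>{H \<in> TR j. I H a}) = c a))"

lemma orth_Union: "orth (\<Union>\<A>) = (\<Inter>A\<in>\<A>. orth A)"
  by (auto simp: orth_def)

text \<open>Two different hyperplanes of \<open>b\<close> in \<open>TR (k - 1)\<close> already span
  \<open>b\<close>; the second is cut out by a neighbour from \<open>top_outside\<close>.\<close>

lemma orth_hyperplanes:
  assumes "b \<in> TR k" "2 \<le> k" "k + 2 \<le> dimension"
  shows "orth (\<Union>{H \<in> TR (k - 1). H \<subseteq> b}) = orth b"
proof
  have k: "1 \<le> k" "k + 1 \<le> dimension" using assms by auto
  show "orth b \<subseteq> orth (\<Union>{H \<in> TR (k - 1). H \<subseteq> b})" by (intro orth_antimono) auto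
  obtain H where H: "H \<in> TR (k - 1)" "H \<subseteq> b" using hyperplane_exists[OF assms(1) k(1)] .
  obtain W where W: "adjacent k b W" "H \<subseteq> W" using star_neighbour[OF H(1) assms(1) H(2) k] .
  obtain Y where Y: "adjacent k Y b" "adjacent k Y W" "Y \<subseteq> join b W" "\<not> b \<inter> W \<subseteq> Y"
    using top_outside[OF W(1) assms(2)] .
  have T: "b \<inter> W \<in> TR (k - 1)" "b \<inter> Y \<in> TR (k - 1)"
    using adjD(4)[OF W(1) k(1)] adjD(4)[OF adj_sym[OF Y(1)] k(1)] .
  have "join (b \<inter> W) (b \<inter> Y) = b"
    using Y(4) assms(1) by (intro star_Int(2)[OF T _ _ _ k(1)]) (auto simp: star_iff)
  then have "orth b = orth (b \<inter> W) \<inter> orth (b \<inter> Y)" using orth_join by metis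
  then show "orth (\<Union>{H \<in> TR (k - 1). H \<subseteq> b}) \<subseteq> orth b"
    using T unfolding orth_Union by auto
qed

lemma reach_step:
  assumes "reach M k c" "2 \<le> k" "2 * k < dimension"
  shows "reach M (k - 1) c"
proof -
  obtain m D f I where M: "interp M (AS k) m D f" "crel M m D f (\<lambda>e a. I (e 0) a)"
    and c: "\<forall>a\<in>univ M. orth (\<Union>{H \<in> TR k. I H a}) = c a"
    using assms(1) unfolding reach_def by (elim exE conjE) (rule that)
  obtain D' f' where N: "interp (AS k) (AS (k - 1)) 3 D' f'" "crel (AS k) 3 D' f' (\<lambda>e b. e 0 \<subseteq> b)"
    using interp_step[OF assms(2,3)] .
  \<comment> \<open>This relation may be smaller than inclusion in the space coded by
    \<open>a\<close>, but the spaces related to \<open>a\<close> keep the same common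
    complement.\<close>
  define I' where "I' H a \<longleftrightarrow> (\<exists>b\<in>TR k. H \<subseteq> b \<and> I b a)" for H a
  have "crel M (3 * m) (comp_dom m D f 3 D') (comp_map m f 3 f') (\<lambda>e a. I' (e 0) a)"
    using crel_incidence_comp[OF M(1) N(1) M(2) N(2)] by (simp add: I'_def univ_AS)
  moreover have "orth (\<Union>{H \<in> TR (k - 1). I' H a}) = c a" if "a \<in> univ M" for a
  proof -
    have "\<Union>{H \<in> TR (k - 1). I' H a} = \<Union>((\<lambda>b. \<Union>{H \<in> TR (k - 1). H \<subseteq> b}) ` {b \<in> TR k. I b a})"
      by (auto simp: I'_def)
    then have "orth (\<Union>{H \<in> TR (k - 1). I' H a}) =
        (\<Inter>b\<in>{b \<in> TR k. I b a}. orth (\<Union>{H \<in> TR (k - 1). H \<subseteq> b}))"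
      by (simp only: orth_Union[of "_ ` _"] image_image)
    also have "\<dots> = (\<Inter>b\<in>{b \<in> TR k. I b a}. orth b)"
      using orth_hyperplanes assms(2,3) by (intro INF_cong) auto
    also have "\<dots> = c a" using c that by (simp add: orth_Union)
    finally show ?thesis .
  qed
  ultimately show ?thesis unfolding reach_def using interp_comp[OF M(1) N(1)] by blast
qed

lemma reach_points:
  assumes "reach M k c" "1 \<le> k" "2 * k < dimension"
  shows "reach M 1 c"
  using assms
proof (induction k)
  case (Suc k)
  show ?case
  proof (cases "k = 0")
    case True
    then show ?thesis using Suc.prems(1) by simp
  next
    case False
    then have "reach M k c" using reach_step[OF Suc.prems(1) _ Suc.prems(3)] by simp
    then show ?thesis using Suc False by simp
  qed
qed simp

text \<open>\<open>A\<close> separates the elements that code subspaces from those of other sorts;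
  for the latter the union is empty and its complement is everything. Admitting an arbitrary
  \<open>g\<close> allows passage to complements.\<close>

lemma reach_init:
  fixes M :: "('r, 'a) struct"
  assumes A: "A \<subseteq> univ M" "fo M (\<lambda>e. e 0 \<in> A)" and g: "inj_on g A" "g ` A = TR j"
    and R: "fo M (\<lambda>e. R (e 0) (e 1))" "\<And>a b. a \<in> A \<Longrightarrow> b \<in> A \<Longrightarrow> R a b \<longleftrightarrow> adjacent j (g a) (g b)"
    and c: "\<And>a. a \<in> univ M \<Longrightarrow> c a = (if a \<in> A then orth (g a) else UNIV)"
  shows "reach M j c"
proof -
  define D where "D = {[a] | a. a \<in> A}"
  define f :: "'a list \<Rightarrow> 'v set" where "f xs = g (xs ! 0)" for xs
  have D: "xs ! 0 \<in> A" if "xs \<in> D" for xs using that by (auto simp: D_def)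
  have code: "case_nat a (flatten 1 E) (Suc i) = E i ! 0" for a :: 'a and E i
    using code_index[of 0 1 a E i] by simp
  have fA: "fo M (\<lambda>e. e i \<in> A)" for i using fo_rename[OF A(2), of "\<lambda>_. i"] by simp
  have f1: "interp M (AS j) 1 D f"
  proof (rule interpI)
    show "D \<subseteq> tuples (univ M) 1" using A(1) by (auto simp: D_def tuples_def)
    have "f ` D = g ` A" by (force simp: D_def f_def)
    then show "f ` D = univ (AS j)" using g(2) by (simp add: univ_AS)
    show "definable M 1 D"
    proof (rule definableI)
      show "fo M (\<lambda>e. map e [0..<1] ! 0 \<in> A)" using fA[of 0] by simp
      show "D = {xs \<in> tuples (univ M) 1. xs ! 0 \<in> A}"
        using A(1) by (auto simp: D_def tuples_def length_Suc_conv)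
    qed
    show "crel M 1 D f (\<lambda>e a. e 0 = e 1)"
    proof (rule crelI[OF fo_eq[of _ "Suc 0" "Suc 1"]])
      fix E :: "nat \<Rightarrow> 'a list" and a assume E: "\<And>i. E i \<in> D"
      show "(case_nat a (flatten 1 E) (Suc 0) = case_nat a (flatten 1 E) (Suc 1)) = (f (E 0) = f (E 1))"
        unfolding code f_def using inj_on_eq_iff[OF g(1) D[OF E] D[OF E]] by simp
    qed
    show "crel M 1 D f (\<lambda>e a. map e [0..<i] \<in> rels (AS j) r)" for r i
    proof (cases "i = 2")
      case True
      have "fo M (\<lambda>e. R (e (Suc 0)) (e (Suc 1)))"
        using fo_rename[OF R(1), of Suc] by simp
      then show ?thesis
      proof (rule crelI)
        fix E :: "nat \<Rightarrow> 'a list" and a assume E: "\<And>i. E i \<in> D"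
        have "map (\<lambda>i. f (E i)) [0..<i] = [f (E 0), f (E 1)]" using True by (simp add: upt_rec numeral_2_eq_2)
        moreover have "f (E i) \<in> TR j" for i using D[OF E] g(2) by (auto simp: f_def)
        ultimately have "map (\<lambda>i. f (E i)) [0..<i] \<in> rels (AS j) r \<longleftrightarrow> adjacent j (f (E 0)) (f (E 1))"
          by (simp add: rels_AS)
        then show "R (case_nat a (flatten 1 E) (Suc 0)) (case_nat a (flatten 1 E) (Suc 1)) =
            (map (\<lambda>i. f (E i)) [0..<i] \<in> rels (AS j) r)"
          unfolding code using R(2)[OF D[OF E] D[OF E]] by (simp add: f_def)
      qed
    next
      case False
      have "map g' [0..<i] \<notin> rels (AS j) r" for g'
        using rels_AS_length[of "map g' [0..<i]"] False by auto
      then show ?thesis by (intro crelI[OF fo_const[of _ False]]) simp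
    qed
  qed simp
  define I where "I H a \<longleftrightarrow> a \<in> A \<and> H = g a" for H a
  have "crel M 1 D f (\<lambda>e a. I (e 0) a)"
  proof (rule crelI[OF fo_conj[OF fA[of 0] fo_eq[of _ "Suc 0" 0]]])
    fix E :: "nat \<Rightarrow> 'a list" and a assume E: "\<And>i. E i \<in> D"
    show "(case_nat a (flatten 1 E) 0 \<in> A \<and> case_nat a (flatten 1 E) (Suc 0) = case_nat a (flatten 1 E) 0) =
        I (f (E 0)) a"
      unfolding code f_def I_def using inj_on_eq_iff[OF g(1) D[OF E], of a] by auto
  qed
  moreover have "orth (\<Union>{H \<in> TR j. I H a}) = c a" if "a \<in> univ M" for a
  proof (cases "a \<in> A")
    case True
    then have "{H \<in> TR j. I H a} = {g a}" using g(2) by (auto simp: I_def)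
    then show ?thesis using True c[OF that] by simp
  next
    case False
    then have "{H \<in> TR j. I H a} = {}" by (simp add: I_def)
    then have "orth (\<Union>{H \<in> TR j. I H a}) = UNIV" unfolding orth_Union by (simp only: INT_empty)
    then show ?thesis using False c[OF that] by simp
  qed
  ultimately show ?thesis unfolding reach_def using f1 by blast
qed

section \<open>The projective geometry over its points\<close>

lemma TR_1: "TR 1 = Gr 1"
proof -
  have "rdim U \<le> 1" if "dim U = 1" for U
    using dim_subset[of "Rad U" U] that by (auto simp: rdim_def Rad_def)
  then show ?thesis by (auto simp: TR_def Gr_def)
qed

lemma perp_iff: "perp U W \<longleftrightarrow> U \<subseteq> orth W"
  by (auto simp: perp_def orth_def)

lemma perp_sym: "perp U W \<longleftrightarrow> perp W U"
  unfolding perp_iff by (rule subset_orth_iff)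

lemma perp_join: "perp X (join U W) \<longleftrightarrow> perp X U \<and> perp X W"
  by (auto simp: perp_iff orth_join)

lemma zero_TR_0: "{0} \<in> TR 0"
proof -
  have "dim (Rad {0}) \<le> dim {0}" by (rule dim_subset) (auto simp: Rad_def)
  moreover have "dim {0} = 0" by simp
  ultimately have "rdim {0} \<le> 1" unfolding rdim_def by linarith
  then show ?thesis by (simp add: TR_def)
qed

text \<open>The case \<open>H = {0}\<close> of \<open>odd_adj\<close>: the points of the whole space
  form a star.\<close>

lemma perp_iff_not_adjacent:
  assumes "p \<in> TR 1" "q \<in> TR 1"
  shows "perp p q \<longleftrightarrow> \<not> adjacent 1 p q"
proof -
  have odd: "odd (1::nat)" and T: "{0} \<in> TR (1 - 1)" using zero_TR_0 by auto
  have zero: "{0} \<subseteq> p" "{0} \<subseteq> q" using assms TR_D(1) subspace_0 by auto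
  obtain u where u: "u \<in> orth {0}" "u \<noteq> 0" "p = ext {0} u" using odd_star[OF odd T assms(1) zero(1)] .
  obtain w where w: "w \<in> orth {0}" "w \<noteq> 0" "q = ext {0} w" using odd_star[OF odd T assms(2) zero(2)] .
  have s: "p = span {u}" "q = span {w}" using u(3) w(3) by (simp_all add: ext_def insert_commute[of _ 0])
  have "perp p q \<longleftrightarrow> \<xi> u w = 0"
  proof
    assume "perp p q"
    then show "\<xi> u w = 0" unfolding perp_def s using span_base[of u "{u}"] span_base[of w "{w}"] by blast
  next
    assume "\<xi> u w = 0"
    then show "perp p q" unfolding perp_iff s by (intro span_minimal) (auto simp: orth_singleton)
  qed
  then show ?thesis using odd_adj[OF odd T u(1,2) w(1,2)] u w by simp
qed

lemma fo_perp: "fo (AS 1) (\<lambda>e. perp (e i) (e j))"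
proof (rule fo_cong[OF fo_not[OF fo_adj[of 1 i j]]])
  fix e :: "nat \<Rightarrow> 'v set" assume "range e \<subseteq> univ (AS 1)"
  then have "e i \<in> TR 1" "e j \<in> TR 1" by (auto simp: univ_AS)
  then show "(\<not> adjacent 1 (e i) (e j)) = perp (e i) (e j)" by (simp add: perp_iff_not_adjacent)
qed

lemma point_span: "v \<noteq> 0 \<Longrightarrow> span {v} \<in> TR 1"
  unfolding TR_1 by (simp add: Gr_def)

lemma subset_iff_points:
  assumes "subspace A" "subspace B"
  shows "A \<subseteq> B \<longleftrightarrow> (\<forall>r\<in>TR 1. r \<subseteq> A \<longrightarrow> r \<subseteq> B)"
proof
  assume r: "\<forall>r\<in>TR 1. r \<subseteq> A \<longrightarrow> r \<subseteq> B"
  show "A \<subseteq> B"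
  proof
    fix v assume v: "v \<in> A"
    show "v \<in> B"
    proof (cases "v = 0")
      case False
      have "span {v} \<subseteq> A" using v assms(1) by (intro span_minimal) auto
      then have "span {v} \<subseteq> B" using r point_span[OF False] by blast
      then show ?thesis using span_base[of v "{v}"] by blast
    qed (use assms(2) subspace_0 in simp)
  qed
qed auto

text \<open>Inclusion is reversed by complements, and complements are compared through their points;
  so lines become comparable by perpendicularity of points alone.\<close>

lemma join_subset_join_iff:
  "join p q \<subseteq> join p' q' \<longleftrightarrow> (\<forall>r\<in>TR 1. perp r p' \<and> perp r q' \<longrightarrow> perp r p \<and> perp r q)"
  unfolding perp_join[symmetric] unfolding perp_iff
  using orth_subset_iff[of "join p' q'" "join p q"]
    subset_iff_points[of "orth (join p' q')" "orth (join p q)"]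
  by simp

lemma fo_join_subset: "fo (AS 1) (\<lambda>e. join (e i) (e j) \<subseteq> join (e i') (e j'))"
  unfolding join_subset_join_iff by (intro fo_intros fo_perp)

lemma join_points:
  assumes "p \<in> TR 1" "q \<in> TR 1"
  shows "join p q \<in> Gr 1 \<union> Gr 2" "join p q \<in> Gr 1 \<longleftrightarrow> p = q" "join p q \<in> Gr 2 \<longleftrightarrow> p \<noteq> q"
proof -
  have s: "subspace p" "subspace q" "dim p = 1" "dim q = 1" using assms TR_D by auto
  have d: "dim (join p q) = 2" if "p \<noteq> q"
    using dim_join[OF s(1,2)] s(3,4) dim_Int_less[OF assms that] by linarith
  moreover have "join p p = p" using s by (simp add: join_def)
  ultimately show "join p q \<in> Gr 1 \<union> Gr 2" "join p q \<in> Gr 1 \<longleftrightarrow> p = q" "join p q \<in> Gr 2 \<longleftrightarrow> p \<noteq> q"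
    using s by (cases "p = q"; auto simp: Gr_def)+
qed

lemma Gr_join_points:
  assumes "x \<in> Gr 1 \<union> Gr 2"
  obtains p q where "p \<in> TR 1" "q \<in> TR 1" "x = join p q"
proof (cases "x \<in> Gr 1")
  case True
  then have "join x x = x" by (auto simp: join_def Gr_def)
  then show thesis using that[of x x] True TR_1 by simp
next
  case False
  then have x: "subspace x" "dim x = 2" using assms by (auto simp: Gr_def)
  obtain B where B: "B \<subseteq> x" "independent B" "x \<subseteq> span B" "card B = dim x" using basis_exists by blast
  obtain a b where ab: "B = {a, b}" using B(4) x(2) by (auto simp: card_2_iff)
  have "a \<noteq> 0" "b \<noteq> 0" using B(2) ab dependent_zero by auto
  moreover have "x = join (span {a}) (span {b})"
  proof
    show "join (span {a}) (span {b}) \<subseteq> x" using B(1) ab x(1) by (intro join_least span_minimal) auto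
    have "{a, b} \<subseteq> join (span {a}) (span {b})"
      using span_base[of a "{a}"] span_base[of b "{b}"] line_upper(3,4)[where U="span {a}" and W="span {b}"] by blast
    then have "span B \<subseteq> join (span {a}) (span {b})" unfolding ab by (intro span_minimal) auto
    then show "x \<subseteq> join (span {a}) (span {b})" using B(3) by blast
  qed
  ultimately show thesis using that point_span by blast
qed

lemma univ_proj: "univ projective_geometry = Gr 1 \<union> Gr 2"
  by (simp add: projective_geometry_def)

lemma perp_join_join: "perp (join p q) (join p' q') \<longleftrightarrow> perp p p' \<and> perp p q' \<and> perp q p' \<and> perp q q'"
  by (auto simp: perp_join perp_sym[of "join p q"] perp_sym[of p'] perp_sym[of q'])

text \<open>One coding map for both sorts: a pair of equal points codes a point, a pair of different
  points a line.\<close>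

lemma interp_proj:
  defines "D \<equiv> tuples (TR 1) 2" and "f \<equiv> \<lambda>xs. join (xs ! 0) (xs ! 1)"
  shows "interp (AS 1) projective_geometry 2 D f"
proof (rule interpI)
  show "D \<subseteq> tuples (univ (AS 1)) 2" by (simp add: D_def univ_AS)
  have D: "xs ! 0 \<in> TR 1" "xs ! 1 \<in> TR 1" if "xs \<in> D" for xs
    using that tuples_nth[of xs "TR 1" 2] by (simp_all add: D_def)
  show "f ` D = univ projective_geometry"
  proof
    show "f ` D \<subseteq> univ projective_geometry" using join_points(1) D unfolding univ_proj f_def by blast
    show "univ projective_geometry \<subseteq> f ` D"
    proof
      fix x assume "x \<in> univ projective_geometry"
      then obtain p q where pq: "p \<in> TR 1" "q \<in> TR 1" "x = join p q" using Gr_join_points univ_proj by metis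
      then have "[p, q] \<in> D" "f [p, q] = x" by (simp_all add: D_def f_def tuples_def)
      then show "x \<in> f ` D" by blast
    qed
  qed
  show "definable (AS 1) 2 D"
    by (rule definableI[of _ "\<lambda>_. True"]) (simp_all add: fo_const D_def univ_AS)
  define a b where "a e i = e (Suc (i * 2 + 0))" and "b e i = e (Suc (i * 2 + 1))" for e :: "nat \<Rightarrow> 'v set" and i
  have ab: "a (case_nat x (flatten 2 E)) i = E i ! 0" "b (case_nat x (flatten 2 E)) i = E i ! 1" for x E i
    unfolding a_def b_def by (rule code_index, simp)+
  have f: "f (E i) = join (E i ! 0) (E i ! 1)" for E :: "nat \<Rightarrow> 'v set list" and i by (simp add: f_def)
  have fo_le: "fo (AS 1) (\<lambda>e. join (a e i) (b e i) \<subseteq> join (a e j) (b e j))" for i j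
    unfolding a_def b_def by (rule fo_join_subset)
  have "fo (AS 1) (\<lambda>e. join (a e 0) (b e 0) \<subseteq> join (a e 1) (b e 1) \<and>
      join (a e 1) (b e 1) \<subseteq> join (a e 0) (b e 0))"
    by (intro fo_conj fo_le)
  then show "crel (AS 1) 2 D f (\<lambda>e x. e 0 = e 1)" by (rule crelI) (auto simp: ab f)
  have eq: "fo (AS 1) (\<lambda>e. a e i = b e i)" for i unfolding a_def b_def by (rule fo_eq)
  have fp: "fo (AS 1) (\<lambda>e. perp (a e i) (a e j))" "fo (AS 1) (\<lambda>e. perp (a e i) (b e j))"
    "fo (AS 1) (\<lambda>e. perp (b e i) (a e j))" "fo (AS 1) (\<lambda>e. perp (b e i) (b e j))" for i j
    unfolding a_def b_def by (rule fo_perp)+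
  have jp: "join (E i ! 0) (E i ! 1) \<in> Gr 1 \<longleftrightarrow> E i ! 0 = E i ! 1"
    "join (E i ! 0) (E i ! 1) \<in> Gr 2 \<longleftrightarrow> E i ! 0 \<noteq> E i ! 1" if "\<And>i. E i \<in> D" for E and i :: nat
    by (rule join_points(2)[OF D(1)[OF that] D(2)[OF that]],
        rule join_points(3)[OF D(1)[OF that] D(2)[OF that]])
  have list1: "map g [0..<j] = [x] \<longleftrightarrow> j = 1 \<and> g 0 = x" for g :: "nat \<Rightarrow> 'v set" and j x
  proof
    assume l: "map g [0..<j] = [x]"
    then have "length (map g [0..<j]) = 1" by (simp only: l) simp
    then have j: "j = 1" by simp
    then show "j = 1 \<and> g 0 = x" using l by simp
  qed simp
  have list2: "map g [0..<j] = [x, y] \<longleftrightarrow> j = 2 \<and> g 0 = x \<and> g 1 = y" for g :: "nat \<Rightarrow> 'v set" and j x y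
  proof
    assume l: "map g [0..<j] = [x, y]"
    then have "length (map g [0..<j]) = 2" by (simp only: l) simp
    then have j: "j = 2" by simp
    then show "j = 2 \<and> g 0 = x \<and> g 1 = y" using l by (simp add: upt_rec numeral_2_eq_2)
  qed (simp add: upt_rec numeral_2_eq_2)
  \<comment> \<open>Tuples of the wrong length satisfy no relation; the length is fixed outside the
    formula.\<close>
  have const: "crel (AS 1) 2 D f (\<lambda>e x. j = i \<and> \<Phi> e)" if "crel (AS 1) 2 D f (\<lambda>e x. \<Phi> e)" for i j :: nat and \<Phi>
    using that crelI[OF fo_const[of "AS 1" False], where D=D and m=2 and f=f and \<Phi>="\<lambda>e x. False"] by (cases "j = i") simp_all
  show "crel (AS 1) 2 D f (\<lambda>e x. map e [0..<j] \<in> rels projective_geometry r)" for r j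
  proof (cases r)
    case Proj_Point
    have "crel (AS 1) 2 D f (\<lambda>e x. j = 1 \<and> e 0 \<in> Gr 1)"
    proof (rule const, rule crelI[OF eq[of 0]])
      fix E :: "nat \<Rightarrow> 'v set list" and x assume "\<And>i. E i \<in> D"
      then show "(a (case_nat x (flatten 2 E)) 0 = b (case_nat x (flatten 2 E)) 0) = (f (E 0) \<in> Gr 1)"
        using jp(1)[of E 0] unfolding ab f by blast
    qed
    then show ?thesis by (rule crel_cong) (auto simp: Proj_Point projective_geometry_def list1)
  next
    case Proj_Line
    have "crel (AS 1) 2 D f (\<lambda>e x. j = 1 \<and> e 0 \<in> Gr 2)"
    proof (rule const, rule crelI[OF fo_not[OF eq[of 0]]])
      fix E :: "nat \<Rightarrow> 'v set list" and x assume "\<And>i. E i \<in> D"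
      then show "(a (case_nat x (flatten 2 E)) 0 \<noteq> b (case_nat x (flatten 2 E)) 0) = (f (E 0) \<in> Gr 2)"
        using jp(2)[of E 0] unfolding ab f by blast
    qed
    then show ?thesis by (rule crel_cong) (auto simp: Proj_Line projective_geometry_def list1)
  next
    case Proj_Inc
    have "crel (AS 1) 2 D f (\<lambda>e x. j = 2 \<and> e 0 \<in> Gr 1 \<and> e 1 \<in> Gr 2 \<and> e 0 \<subseteq> e 1)"
    proof (rule const, rule crelI[OF fo_conj[OF eq[of 0] fo_conj[OF fo_not[OF eq[of 1]] fo_le[of 0 1]]]])
      fix E :: "nat \<Rightarrow> 'v set list" and x assume "\<And>i. E i \<in> D"
      then show "(a (case_nat x (flatten 2 E)) 0 = b (case_nat x (flatten 2 E)) 0 \<and>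
          a (case_nat x (flatten 2 E)) 1 \<noteq> b (case_nat x (flatten 2 E)) 1 \<and>
          join (a (case_nat x (flatten 2 E)) 0) (b (case_nat x (flatten 2 E)) 0)
            \<subseteq> join (a (case_nat x (flatten 2 E)) 1) (b (case_nat x (flatten 2 E)) 1)) =
          (f (E 0) \<in> Gr 1 \<and> f (E 1) \<in> Gr 2 \<and> f (E 0) \<subseteq> f (E 1))"
        using jp(1)[of E 0] jp(2)[of E 1] unfolding ab f by blast
    qed
    then show ?thesis by (rule crel_cong) (auto simp: Proj_Inc projective_geometry_def list2)
  next
    case Proj_Perp
    have "crel (AS 1) 2 D f (\<lambda>e x. j = 2 \<and> perp (e 0) (e 1))"
      by (rule const, rule crelI[OF fo_conj[OF fp(1)[of 0 1] fo_conj[OF fp(2)[of 0 1] fo_conj[OF fp(3)[of 0 1] fp(4)[of 0 1]]]]])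
        (simp add: ab f perp_join_join)
    then show ?thesis
    proof (rule crel_cong)
      fix e :: "nat \<Rightarrow> 'v set" and x assume "range e \<subseteq> f ` D"
      then have "e i \<in> f ` D" for i by blast
      moreover have "f ` D \<subseteq> Gr 1 \<union> Gr 2"
        unfolding f_def by (rule image_subsetI, rule join_points(1)[OF D])
      ultimately have "e 0 \<in> Gr 1 \<union> Gr 2" "e 1 \<in> Gr 1 \<union> Gr 2" by blast+
      then show "(j = 2 \<and> perp (e 0) (e 1)) = (map e [0..<j] \<in> rels projective_geometry r)"
        by (auto simp: Proj_Perp projective_geometry_def list2)
    qed
  qed
qed simp

lemma definable_incidence:
  assumes M: "interp M N m D f" and J: "crel M m D f (\<lambda>e a. J (e 0) a)"
  shows "definable M (Suc m) {xs @ [a] | xs a. xs \<in> D \<and> a \<in> univ M \<and> J (f xs) a}"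
proof (rule crelE[OF J])
  note M' = interpD[OF M]
  fix \<Psi> assume \<Psi>: "fo M \<Psi>" "\<And>E a. (\<And>i. E i \<in> D) \<Longrightarrow> a \<in> univ M \<Longrightarrow>
    \<Psi> (case_nat a (flatten m E)) = J (f (E 0)) a"
  \<comment> \<open>The extra element stands behind its tuple, at index \<open>m\<close>, whereas
    \<open>\<Psi>\<close> expects it first; the single code is repeated to fill the remaining
    blocks.\<close>
  define \<rho> where "\<rho> = case_nat m (\<lambda>n. n mod m)"
  have "fo M (\<lambda>e. map e [0..<m] \<in> D \<and> \<Psi> (\<lambda>i. e (\<rho> i)))"
    by (rule fo_conj[OF fo_definable[OF M'(4)] fo_rename[OF \<Psi>(1)]])
  then have "fo M (\<lambda>e. take m (map e [0..<Suc m]) \<in> D \<and> J (f (take m (map e [0..<Suc m]))) (map e [0..<Suc m] ! m))"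
  proof (rule fo_cong)
    fix e :: "nat \<Rightarrow> _" assume e: "range e \<subseteq> univ M"
    have "\<Psi> (\<lambda>i. e (\<rho> i)) = J (f (map e [0..<m])) (e m)" if "map e [0..<m] \<in> D"
    proof -
      have "(\<lambda>i. e (\<rho> i)) = case_nat (e m) (flatten m (\<lambda>_. map e [0..<m]))"
        using M'(1) by (auto simp: \<rho>_def flatten_def fun_eq_iff split: nat.split)
      moreover have "e m \<in> univ M" using e by blast
      ultimately show ?thesis using \<Psi>(2)[of "\<lambda>_. map e [0..<m]" "e m"] that by simp
    qed
    then show "(map e [0..<m] \<in> D \<and> \<Psi> (\<lambda>i. e (\<rho> i))) =
      (take m (map e [0..<Suc m]) \<in> D \<and> J (f (take m (map e [0..<Suc m]))) (map e [0..<Suc m] ! m))"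
      by (auto simp: take_map simp del: upt_Suc)
  qed
  moreover have "{xs @ [a] | xs a. xs \<in> D \<and> a \<in> univ M \<and> J (f xs) a} =
    {zs \<in> tuples (univ M) (Suc m). take m zs \<in> D \<and> J (f (take m zs)) (zs ! m)}" (is "?L = ?R")
  proof
    show "?L \<subseteq> ?R" using M'(2) by (fastforce simp: tuples_def nth_append)
    show "?R \<subseteq> ?L"
    proof
      fix zs assume zs: "zs \<in> ?R"
      then have "zs = take m zs @ [zs ! m]" "zs ! m \<in> univ M"
        by (auto simp: tuples_def take_Suc_conv_app_nth[symmetric])
      then show "zs \<in> ?L" using zs by blast
    qed
  qed
  ultimately show ?thesis by (rule definableI)
qed

lemma definable_in_terms_ofI:
  assumes M: "interp M N m D f" and J: "crel M m D f (\<lambda>e a. J (e 0) a)"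
    and eq: "\<And>x a. x \<in> univ N \<Longrightarrow> a \<in> univ M \<Longrightarrow> J x a = J' x a"
  shows "definable_in_terms_of N M J'"
proof -
  have "J (f xs) a = J' (f xs) a" if "xs \<in> D" "a \<in> univ M" for xs a
    by (rule eq[OF _ that(2)]) (use interpD(3)[OF M] that(1) in blast)
  then have "{xs @ [a] | xs a. xs \<in> D \<and> a \<in> univ M \<and> J (f xs) a} =
      {xs @ [a] | xs a. xs \<in> D \<and> a \<in> univ M \<and> J' (f xs) a}"
    by (simp cong: conj_cong)
  then have "definable M (Suc m) {xs @ [a] | xs a. xs \<in> D \<and> a \<in> univ M \<and> J' (f xs) a}"
    using definable_incidence[OF M J] by simp
  then show ?thesis
    unfolding definable_in_terms_of_def by (intro exI[of _ m] exI[of _ D] exI[of _ f] conjI interp_interprets[OF M])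
qed

text \<open>A point lies in \<open>c a\<close> iff it is perpendicular to all points incident with
  \<open>a\<close> by \<open>I\<close>. The first version serves \<open>c a = orth (g a)\<close>,
  where \<open>x \<subseteq> orth (c a)\<close> is tested on the points of \<open>c a\<close>. The
  second serves the dual coding with \<open>c a = g a\<close>; there
  \<open>c a \<noteq> UNIV\<close>, the existence of an incident point, excludes elements that code
  no subspace.\<close>

lemma reach_definable:
  assumes "reach M 1 c"
  shows "(\<And>x a. x \<in> Gr 1 \<union> Gr 2 \<Longrightarrow> a \<in> univ M \<Longrightarrow> x \<subseteq> orth (c a) \<longleftrightarrow> J x a) \<Longrightarrow>
      definable_in_terms_of projective_geometry M J"
    and "(\<And>x a. x \<in> Gr 1 \<union> Gr 2 \<Longrightarrow> a \<in> univ M \<Longrightarrow> c a \<noteq> UNIV \<and> x \<subseteq> c a \<longleftrightarrow> J x a) \<Longrightarrow>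
      definable_in_terms_of projective_geometry M J"
proof -
  obtain m D f I where M: "interp M (AS 1) m D f" and I: "crel M m D f (\<lambda>e a. I (e 0) a)"
    and c: "\<forall>a\<in>univ M. orth (\<Union>{H \<in> TR 1. I H a}) = c a"
    using assms unfolding reach_def by (elim exE conjE) (rule that)
  note M' = interpD[OF M]
  have T: "f ` D = TR 1" using M'(3) by (simp add: univ_AS)
  define D' where "D' = tuples (TR 1) 2"
  define f' :: "'v set list \<Rightarrow> 'v set" where "f' = (\<lambda>xs. join (xs ! 0) (xs ! 1))"
  have N: "interp (AS 1) projective_geometry 2 D' f'" unfolding D'_def f'_def by (rule interp_proj)
  note comp = interp_comp[OF M N]
  have mem_c: "x \<subseteq> c a \<longleftrightarrow> (\<forall>z\<in>TR 1. I z a \<longrightarrow> perp x z)" if "a \<in> univ M" for x a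
  proof -
    have "c a = orth (\<Union>{H \<in> TR 1. I H a})" using c that by simp
    then show ?thesis by (auto simp: orth_Union perp_iff)
  qed
  have crel_perp: "crel M m D f (\<lambda>e a. perp (e i) (e j))" for i j
    using M'(5)[OF fo_perp] .
  have crel_I: "crel M m D f (\<lambda>e a. I (e i) a)" for i
    using crel_rename[OF M'(1) I, of "\<lambda>_. i"] by simp
  note crel_all' = crel_all[OF M'(1,4,2), of f, unfolded T]
  note crel_ex' = crel_ex[OF M'(1,4,2), of f, unfolded T]
  have le: "crel M m D f (\<lambda>e a. \<forall>z\<in>TR 1. I z a \<longrightarrow> perp (e i) z)" for i
    by (rule crel_all', rule crel_imp[OF crel_I crel_perp])
  {
    assume eq: "\<And>x a. x \<in> Gr 1 \<union> Gr 2 \<Longrightarrow> a \<in> univ M \<Longrightarrow> x \<subseteq> orth (c a) \<longleftrightarrow> J x a"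
    have "crel M m D f (\<lambda>e a. \<forall>y\<in>TR 1. (\<forall>z\<in>TR 1. I z a \<longrightarrow> perp y z) \<longrightarrow> perp y (e 0) \<and> perp y (e 1))"
      by (rule crel_all', rule crel_imp[OF le crel_conj[OF crel_perp crel_perp]])
    then have "crel M (2 * m) (comp_dom m D f 2 D') (comp_map m f 2 f') (\<lambda>e a. e 0 \<subseteq> orth (c a))"
    proof (rule crel_comp[OF M'(1,2) interpD(1)[OF N]])
      fix F :: "nat \<Rightarrow> 'v set list" and a assume a: "a \<in> univ M"
      have s: "subspace (c a)" using c a by (metis subspace_orth)
      have "f' (F 0) \<subseteq> orth (c a) \<longleftrightarrow> c a \<subseteq> orth (f' (F 0))" by (rule subset_orth_iff)
      also have "\<dots> \<longleftrightarrow> (\<forall>y\<in>TR 1. y \<subseteq> c a \<longrightarrow> y \<subseteq> orth (f' (F 0)))"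
        by (rule subset_iff_points[OF s subspace_orth])
      also have "\<dots> \<longleftrightarrow> (\<forall>y\<in>TR 1. (\<forall>z\<in>TR 1. I z a \<longrightarrow> perp y z) \<longrightarrow>
          perp y (flatten 2 F 0) \<and> perp y (flatten 2 F 1))"
        unfolding mem_c[OF a] by (simp add: f'_def flatten_def perp_join perp_iff[symmetric])
      finally show "(\<forall>y\<in>TR 1. (\<forall>z\<in>TR 1. I z a \<longrightarrow> perp y z) \<longrightarrow>
          perp y (flatten 2 F 0) \<and> perp y (flatten 2 F 1)) = (f' (F 0) \<subseteq> orth (c a))" by simp
    qed
    then show "definable_in_terms_of projective_geometry M J"
      by (rule definable_in_terms_ofI[OF comp]) (simp add: eq univ_proj)
  }
  {
    assume eq: "\<And>x a. x \<in> Gr 1 \<union> Gr 2 \<Longrightarrow> a \<in> univ M \<Longrightarrow> c a \<noteq> UNIV \<and> x \<subseteq> c a \<longleftrightarrow> J x a"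
    have "crel M m D f (\<lambda>e a. (\<exists>z\<in>TR 1. I z a) \<and>
        (\<forall>z\<in>TR 1. I z a \<longrightarrow> perp (e 0) z) \<and> (\<forall>z\<in>TR 1. I z a \<longrightarrow> perp (e 1) z))"
      by (intro crel_conj le, rule crel_ex', rule crel_I)
    then have "crel M (2 * m) (comp_dom m D f 2 D') (comp_map m f 2 f') (\<lambda>e a. c a \<noteq> UNIV \<and> e 0 \<subseteq> c a)"
    proof (rule crel_comp[OF M'(1,2) interpD(1)[OF N]])
      fix F :: "nat \<Rightarrow> 'v set list" and a assume a: "a \<in> univ M"
      have s: "subspace (c a)" using c a by (metis subspace_orth)
      have "c a \<noteq> UNIV \<longleftrightarrow> (\<exists>z\<in>TR 1. I z a)"
      proof
        assume "\<exists>z\<in>TR 1. I z a"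
        then obtain z where z: "z \<in> TR 1" "I z a" by blast
        have "c a \<subseteq> orth z" using c a z by (auto simp: orth_Union)
        moreover have "orth z \<noteq> UNIV"
          using dim_orth[OF TR_D(1)[OF z(1)]] TR_D(2)[OF z(1)] dim_UNIV' by auto
        ultimately show "c a \<noteq> UNIV" by blast
      next
        assume "c a \<noteq> UNIV"
        then show "\<exists>z\<in>TR 1. I z a" using c a by (auto simp: orth_Union)
      qed
      then show "((\<exists>z\<in>TR 1. I z a) \<and> (\<forall>z\<in>TR 1. I z a \<longrightarrow> perp (flatten 2 F 0) z) \<and>
          (\<forall>z\<in>TR 1. I z a \<longrightarrow> perp (flatten 2 F 1) z)) = (c a \<noteq> UNIV \<and> f' (F 0) \<subseteq> c a)"
        using join_subset_iff[OF s, of "F 0 ! 0" "F 0 ! 1"] mem_c[OF a] by (simp add: f'_def flatten_def)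
    qed
    then show "definable_in_terms_of projective_geometry M J"
      by (rule definable_in_terms_ofI[OF comp]) (simp add: eq univ_proj)
  }
qed

text \<open>If \<open>2 * k\<close> exceeds the dimension, elements are read as their complements,
  of dimension \<open>dimension - k\<close>, and the descent starts there.\<close>

lemma definable_from_Grassmannian:
  fixes M :: "('r, 'a) struct"
  assumes k: "1 \<le> k" "k + 1 \<le> dimension" "2 * k \<noteq> dimension"
    and A: "A \<subseteq> univ M" "fo M (\<lambda>e. e 0 \<in> A)" and g: "inj_on g A" "g ` A = TR k"
    and R: "fo M (\<lambda>e. R (e 0) (e 1))" "\<And>a b. a \<in> A \<Longrightarrow> b \<in> A \<Longrightarrow> R a b \<longleftrightarrow> adjacent k (g a) (g b)"
    and J: "\<And>x a. a \<in> univ M \<Longrightarrow> J x a \<longleftrightarrow> a \<in> A \<and> x \<subseteq> g a"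
  shows "definable_in_terms_of projective_geometry M J"
proof -
  have gT: "g a \<in> TR k" "subspace (g a)" if "a \<in> A" for a using g(2) that TR_D(1) by blast+
  show ?thesis
  proof (cases "2 * k < dimension")
    case True
    define c where "c a = (if a \<in> A then orth (g a) else UNIV)" for a
    have "reach M k c" by (rule reach_init[OF A g R]) (simp_all add: c_def)
    then have "reach M 1 c" using reach_points k(1) True by blast
    then show ?thesis
    proof (rule reach_definable(1))
      fix x a assume x: "x \<in> Gr 1 \<union> Gr 2" and a: "a \<in> univ M"
      \<comment> \<open>Outside \<open>A\<close> the complement of \<open>c a\<close> is 0, which
        contains no point or line, as \<open>J\<close> demands.\<close>
      have "\<not> x \<subseteq> {0}" using x by (auto simp: Gr_def dest!: dim_subset[of x "{0}"])
      then show "x \<subseteq> orth (c a) \<longleftrightarrow> J x a" using gT J[OF a] by (simp add: c_def orth_UNIV)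
    qed
  next
    case False
    define c where "c a = (if a \<in> A then g a else UNIV)" for a
    have inj: "inj_on (\<lambda>a. orth (g a)) A"
      using g(1) gT(2) by (auto simp: inj_on_def orth_eq_iff)
    have im: "(\<lambda>a. orth (g a)) ` A = TR (dimension - k)"
      using orth_TR_image[of k] g(2) k(2) by (simp add: image_image[symmetric])
    have "reach M (dimension - k) c"
      by (rule reach_init[OF A inj im R(1)]) (use R(2) adj_orth_iff[OF _ _ k(1,2)] gT in \<open>simp_all add: c_def\<close>)
    then have "reach M 1 c" using reach_points[of M "dimension - k" c] k False by simp
    then show ?thesis
    proof (rule reach_definable(2))
      fix x a assume a: "a \<in> univ M"
      have "g a \<noteq> UNIV" if "a \<in> A" using TR_D(2)[OF gT(1)[OF that]] k(2) dim_UNIV' by auto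
      then show "c a \<noteq> UNIV \<and> x \<subseteq> c a \<longleftrightarrow> J x a" using J[OF a] by (simp add: c_def)
    qed
  qed
qed

lemma definable_from_adjacency:
  assumes k: "1 \<le> k" "k + 1 \<le> dimension" "2 * k \<noteq> dimension"
  shows "definable_in_terms_of projective_geometry (AS k) (\<lambda>x U. x \<subseteq> U)"
proof (rule definable_from_Grassmannian[OF k, where A="TR k" and g=id and R="adjacent k"])
  show "fo (AS k) (\<lambda>e. e 0 \<in> TR k)"
    by (rule fo_cong[OF fo_const[of _ True]]) (auto simp: univ_AS)
qed (auto simp: univ_AS fo_adj)

lemma definable_from_Grassmann_space:
  assumes k: "1 \<le> k" "k + 1 \<le> dimension" "2 * k \<noteq> dimension"
  shows "definable_in_terms_of projective_geometry (Grassmann_space k) (\<lambda>x a. \<exists>U. a = Inl U \<and> x \<subseteq> U)"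
proof (rule definable_from_Grassmannian[OF k, where A="Inl ` TR k" and g=projl and
      R="\<lambda>a b. a \<noteq> b \<and> (\<exists>p\<in>univ (Grassmann_space k). [a, p] \<in> rels (Grassmann_space k) Grass_Inc \<and>
        [b, p] \<in> rels (Grassmann_space k) Grass_Inc)"])
  let ?G = "Grassmann_space k"
  have univ: "univ ?G = Inl ` TR k \<union> Inr ` pencils k" by (simp add: Grassmann_space_def)
  have inc: "[a, p] \<in> rels ?G Grass_Inc \<longleftrightarrow> (\<exists>U P. a = Inl U \<and> p = Inr P \<and> U \<in> TR k \<and> P \<in> pencils k \<and> U \<in> P)" for a p
    by (auto simp: Grassmann_space_def)
  show "Inl ` TR k \<subseteq> univ ?G" by (simp add: univ)
  show "fo ?G (\<lambda>e. e 0 \<in> Inl ` TR k)"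
    by (rule fo_cong[OF fo_atom[of _ "[0]" Grass_Point]]) (auto simp: Grassmann_space_def)
  show "inj_on projl (Inl ` TR k)" "projl ` Inl ` TR k = TR k" by (auto simp: inj_on_def image_image)
  have "fo ?G (\<lambda>e. [e i, e j] \<in> rels ?G Grass_Inc)" for i j
    using fo_atom[of ?G "[i, j]" Grass_Inc] by simp
  then show "fo ?G (\<lambda>e. e 0 \<noteq> e 1 \<and> (\<exists>p\<in>univ ?G. [e 0, p] \<in> rels ?G Grass_Inc \<and> [e 1, p] \<in> rels ?G Grass_Inc))"
    by (intro fo_conj fo_not fo_eq fo_ex)
  show "(a \<noteq> b \<and> (\<exists>p\<in>univ ?G. [a, p] \<in> rels ?G Grass_Inc \<and> [b, p] \<in> rels ?G Grass_Inc)) =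
      adjacent k (projl a) (projl b)" if ab: "a \<in> Inl ` TR k" "b \<in> Inl ` TR k" for a b
  proof -
    obtain U W where UW: "a = Inl U" "b = Inl W" "U \<in> TR k" "W \<in> TR k" using ab by blast
    have inc': "[Inl X, Inr P] \<in> rels ?G Grass_Inc \<longleftrightarrow> X \<in> P"
      if "X \<in> TR k" "P \<in> pencils k" for X P
      using that by (simp add: inc)
    have "(\<exists>p\<in>univ ?G. [a, p] \<in> rels ?G Grass_Inc \<and> [b, p] \<in> rels ?G Grass_Inc) \<longleftrightarrow>
        (\<exists>P\<in>pencils k. U \<in> P \<and> W \<in> P)"
    proof
      assume "\<exists>p\<in>univ ?G. [a, p] \<in> rels ?G Grass_Inc \<and> [b, p] \<in> rels ?G Grass_Inc"
      then show "\<exists>P\<in>pencils k. U \<in> P \<and> W \<in> P" unfolding inc UW by auto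
    next
      assume "\<exists>P\<in>pencils k. U \<in> P \<and> W \<in> P"
      then obtain P where P: "P \<in> pencils k" "U \<in> P" "W \<in> P" by blast
      show "\<exists>p\<in>univ ?G. [a, p] \<in> rels ?G Grass_Inc \<and> [b, p] \<in> rels ?G Grass_Inc"
        using P UW inc'(1)[OF _ P(1)] by (intro bexI[of _ "Inr P"]) (simp_all add: univ)
    qed
    then show ?thesis unfolding UW adjacent_def by simp
  qed
  show "(\<exists>U. a = Inl U \<and> x \<subseteq> U) = (a \<in> Inl ` TR k \<and> x \<subseteq> projl a)" if "a \<in> univ ?G" for x a
  proof (cases a)
    case (Inl U)
    then have "U \<in> TR k" using that unfolding univ by blast
    then show ?thesis using Inl by simp
  next
    case (Inr P)
    then show ?thesis by auto
  qed
qed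

end

theorem theorem1p4:
  fixes scale :: "'k::field \<Rightarrow> 'v::ab_group_add \<Rightarrow> 'v"
    and Basis :: "'v set"
    and \<xi> :: "'v \<Rightarrow> 'v \<Rightarrow> 'k"
    and n k :: nat
  assumes "symplectic_space scale Basis \<xi>"
    and "vector_space.dim scale (UNIV :: 'v set) = n"
    and "1 \<le> k" and "k \<le> n - 1" and "k \<noteq> n - k"
  shows
    "definable_in_terms_of
       (symplectic_space.projective_geometry scale \<xi>)
       (symplectic_space.adjacency_structure scale \<xi> k (symplectic_space.TR scale \<xi> k))
       (\<lambda>x U. x \<subseteq> U)
     \<and> definable_in_terms_of
       (symplectic_space.projective_geometry scale \<xi>)
       (symplectic_space.Grassmann_space scale \<xi> k)
       (\<lambda>x a. \<exists>U. a = Inl U \<and> x \<subseteq> U)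
     \<and> (even k \<longrightarrow>
         symplectic_space.Regular scale \<xi> k = symplectic_space.TR scale \<xi> k
         \<and> definable_in_terms_of
             (symplectic_space.projective_geometry scale \<xi>)
             (symplectic_space.adjacency_structure scale \<xi> k (symplectic_space.Regular scale \<xi> k))
             (\<lambda>x U. x \<subseteq> U))"
proof -
  interpret symplectic_space scale Basis \<xi> by (rule assms(1))
  have "n = dimension" using assms(2) dim_UNIV' by simp
  then have k: "1 \<le> k" "k + 1 \<le> dimension" "2 * k \<noteq> dimension" using assms(3-5) by auto
  show ?thesis
    using definable_from_adjacency[OF k] definable_from_Grassmann_space[OF k] Regular_eq_TR[of k] by simp
qed

end
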